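(* Let $G_0$ be an infinite, quasi-transitive, connected, cubic (simple) graph, and let $G_1=F(G_0)$ be the graph obtained by applying the Fisher transformation at every vertex of $G_0$. Assume that $|\gamma(G_0)|<\infty$ and that $\eta(G_1)$ exists. (a) Then $\gamma(G_0)=\gamma(G_1)$ and $\eta(G_0)=\eta(G_1)$ (in particular $\eta(G_0)$ exists). (b) Let $W_0$ be a minimal fundamental domain of $G_0$, $X_0$ the set of edges incident to vertices of $W_0$, $W_1$ the set of vertices of the triangles of $G_1$ arising from vertices of $W_0$, and $X_1$ the set of edges of $G_1$ incident to vertices of $W_1$. For $k=0,1$ let $\sigma_{n,k}$ be the number of $n$-step SAWs on $G_k$ starting at mid-edges in $X_k$, and let $\mu_k$ be the connective constant of $G_k$. Suppose that, with $\gamma=\gamma(G_0)$, there exist constants $C_{1,k},C_{2,k}\in(0,\infty)$ and a slowly varying function $L$ (common to $k=0,1$) such that $$C_{1,k}L(n)n^{\gamma-1}\mu_k^n\le\sigma_{n,k}\le C_{2,k}L(n)n^{\gamma-1}\mu_k^n,\qquad n\ge1,\ k=0,1.$$ Then $\nu(G_0)=\nu(G_1)$.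
   Context: All graphs are infinite, connected and simple. A graph is cubic if every vertex has degree 3; it is quasi-transitive if there is a finite set $W$ of vertices (a fundamental domain) such that every vertex is mapped into $W$ by some automorphism. The Fisher transformation at a degree-3 vertex $v$ with incident edges $\langle v,u_i\rangle$ ($i=1,2,3$) replaces $v$ by a triangle on new vertices $v_1,v_2,v_3$ and each edge $\langle v,u_i\rangle$ by $\langle v_i,u_i\rangle$; $F(G)$ applies this at every vertex. The connective constant of a quasi-transitive graph is $\mu=\lim_n\sigma_n(v)^{1/n}$, $\sigma_n(v)$ the number of $n$-step self-avoiding walks (SAWs) from vertex $v$. Mid-edge walks: each edge $e$ is identified with a point at its middle; one considers walks starting and ending at mid-edges, self-avoiding if they visit no vertex or mid-edge more than once, with length $|\pi|$ equal to the number of vertices visited. For a graph $G$ with connective constant $\mu$ and fundamental domain $W$, let $X$ be the set of edges incident to vertices of $W$ and $\Sigma$ the set of SAWs starting at mid-edges in $X$; $\Sigma_n$ is the set of those with $|\pi|=n$. Exponent $\gamma$: $Y(x,y)=\sum_{\pi\in\Sigma}x^{|\pi|}/|\pi|^y$ (denominator $1$ if $|\pi|=0$), and $\gamma\in[-\infty,\infty]$ is such that $Y(\mu^{-1},y)=\infty$ for $y<\gamma$ and $Y(\mu^{-1},y)<\infty$ for $y>\gamma$. Exponent $\nu$: with $\|\pi\|$ the graph-distance between the endpoints of $\pi$ and $\langle\cdot\rangle_n$ the uniform average over $\Sigma_n$, $V(z)=\sum_{n\ge1}n^{-(2z+1)}\langle\|\pi\|^2\rangle_n$, and $\nu\in[-\infty,\infty]$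 is such that $V(z)=\infty$ for $z<\nu$ and $V(z)<\infty$ for $z>\nu$. Exponent $\eta$: for an automorphism $\alpha$, let $\Sigma(\alpha)$ be the set of SAWs in $\Sigma$ ending at mid-edges in $\alpha X$ and $Z_\alpha(x)=\sum_{\pi\in\Sigma(\alpha)}x^{|\pi|}$. We say $\eta=\eta(G)\in[-\infty,\infty]$ exists if for every sequence of automorphisms $\alpha$ with $d_G(W,\alpha W)\to\infty$ ($d_G$ the graph distance), $Z_\alpha(\mu^{-1})\,d_G(W,\alpha W)^w\to0$ when $w<\eta$ and $\to\infty$ when $w>\eta$. These exponents do not depend on the choice of fundamental domain. A function $L$ is slowly varying in the usual sense. *)

theory Defs
  imports "HOL-Analysis.Analysis"
begin

section \<open>Undirected simple graphs\<close>

record 'a ugraph =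
  verts :: "'a set"
  edges :: "'a set set"

definition simple_graph :: "'a ugraph \<Rightarrow> bool" where
  "simple_graph G \<longleftrightarrow> (\<forall>e\<in>edges G. e \<subseteq> verts G \<and> card e = 2)"

definition adj :: "'a ugraph \<Rightarrow> 'a \<Rightarrow> 'a \<Rightarrow> bool" where
  "adj G u v \<longleftrightarrow> {u, v} \<in> edges G"

definition connected_graph :: "'a ugraph \<Rightarrow> bool" where
  "connected_graph G \<longleftrightarrow> (\<forall>u\<in>verts G. \<forall>v\<in>verts G. (adj G)\<^sup>*\<^sup>* u v)"

definition cubic :: "'a ugraph \<Rightarrow> bool" where
  "cubic G \<longleftrightarrow> (\<forall>v\<in>verts G. card {e\<in>edges G. v \<in> e} = 3)"

definition graph_dist :: "'a ugraph \<Rightarrow> 'a \<Rightarrow> 'a \<Rightarrow> nat" where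
  "graph_dist G u v = (LEAST n. (adj G ^^ n) u v)"

definition set_graph_dist :: "'a ugraph \<Rightarrow> 'a set \<Rightarrow> 'a set \<Rightarrow> nat" where
  "set_graph_dist G A B = (INF (u, v)\<in>A \<times> B. graph_dist G u v)"

definition automorphism :: "'a ugraph \<Rightarrow> ('a \<Rightarrow> 'a) \<Rightarrow> bool" where
  "automorphism G \<alpha> \<longleftrightarrow> bij_betw \<alpha> (verts G) (verts G) \<and>
     (\<forall>u\<in>verts G. \<forall>v\<in>verts G. adj G (\<alpha> u) (\<alpha> v) \<longleftrightarrow> adj G u v)"

definition fundamental_domain :: "'a ugraph \<Rightarrow> 'a set \<Rightarrow> bool" where
  "fundamental_domain G W \<longleftrightarrow> finite W \<and> W \<subseteq> verts G \<and>
     (\<forall>v\<in>verts G. \<exists>\<alpha>. automorphism G \<alpha> \<and> \<alpha> v \<in> W)"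

definition minimal_fundamental_domain :: "'a ugraph \<Rightarrow> 'a set \<Rightarrow> bool" where
  "minimal_fundamental_domain G W \<longleftrightarrow> fundamental_domain G W \<and>
     (\<forall>W'. W' \<subset> W \<longrightarrow> \<not> fundamental_domain G W')"

definition quasi_transitive :: "'a ugraph \<Rightarrow> bool" where
  "quasi_transitive G \<longleftrightarrow> (\<exists>W. fundamental_domain G W)"

definition incident_edges :: "'a ugraph \<Rightarrow> 'a set \<Rightarrow> 'a set set" where
  "incident_edges G W = {e\<in>edges G. e \<inter> W \<noteq> {}}"


section \<open>The Fisher transformation applied at every vertex\<close>

text \<open>The pair \<open>(v, u)\<close> is the vertex of the triangle replacing \<open>v\<close> that carries the former
  edge between \<open>v\<close> and \<open>u\<close>; that edge now joins \<open>(v, u)\<close> to \<open>(u, v)\<close>.\<close>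

definition fisher_verts :: "'a ugraph \<Rightarrow> 'a set \<Rightarrow> ('a \<times> 'a) set" where
  "fisher_verts G W = {(v, u). v \<in> W \<and> adj G v u}"

definition fisher :: "'a ugraph \<Rightarrow> ('a \<times> 'a) ugraph" where
  "fisher G = \<lparr> verts = fisher_verts G (verts G),
     edges = {{(v, u), (v, u')} | v u u'. adj G v u \<and> adj G v u' \<and> u \<noteq> u'}
           \<union> {{(v, u), (u, v)} | v u. adj G v u} \<rparr>"


section \<open>The connective constant\<close>

definition vertex_saws :: "'a ugraph \<Rightarrow> nat \<Rightarrow> 'a \<Rightarrow> 'a list set" where
  "vertex_saws G n v = {p. length p = Suc n \<and> hd p = v \<and> set p \<subseteq> verts G \<and> distinct p \<and>
     (\<forall>i<n. adj G (p ! i) (p ! Suc i))}"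

definition connective_constant :: "'a ugraph \<Rightarrow> real" where
  "connective_constant G =
     (THE \<mu>. \<forall>v\<in>verts G. (\<lambda>n. root n (real (card (vertex_saws G n v)))) \<longlonglongrightarrow> \<mu>)"


section \<open>Walks between mid-edges\<close>

text \<open>A walk between mid-edges is given by its successive mid-edges and the vertices visited in
  between: \<open>([e0, \<dots>, en], [v1, \<dots>, vn])\<close> visits \<open>e0, v1, e1, \<dots>, vn, en\<close> and has length \<open>n\<close>.\<close>

type_synonym 'a mid_path = "'a set list \<times> 'a list"

definition path_length :: "'a mid_path \<Rightarrow> nat" where
  "path_length \<pi> = length (snd \<pi>)"

definition path_start :: "'a mid_path \<Rightarrow> 'a set" where
  "path_start \<pi> = hd (fst \<pi>)"

definition path_end :: "'a mid_path \<Rightarrow> 'a set" where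
  "path_end \<pi> = last (fst \<pi>)"

definition mid_walk :: "'a ugraph \<Rightarrow> 'a mid_path \<Rightarrow> bool" where
  "mid_walk G \<pi> \<longleftrightarrow> length (fst \<pi>) = Suc (length (snd \<pi>)) \<and> set (fst \<pi>) \<subseteq> edges G \<and>
     (\<forall>i<length (snd \<pi>). snd \<pi> ! i \<in> fst \<pi> ! i \<and> snd \<pi> ! i \<in> fst \<pi> ! Suc i)"

definition mid_saw :: "'a ugraph \<Rightarrow> 'a mid_path \<Rightarrow> bool" where
  "mid_saw G \<pi> \<longleftrightarrow> mid_walk G \<pi> \<and> distinct (fst \<pi>) \<and> distinct (snd \<pi>)"

text \<open>The distance between mid-edges is the least length of a walk joining them, i.e. the distance
  between the midpoints when all edges have length one.\<close>

definition mid_dist :: "'a ugraph \<Rightarrow> 'a set \<Rightarrow> 'a set \<Rightarrow> nat" where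
  "mid_dist G e f =
     (LEAST n. \<exists>\<pi>. mid_walk G \<pi> \<and> path_start \<pi> = e \<and> path_end \<pi> = f \<and> path_length \<pi> = n)"

definition endpoint_dist :: "'a ugraph \<Rightarrow> 'a mid_path \<Rightarrow> nat" where
  "endpoint_dist G \<pi> = mid_dist G (path_start \<pi>) (path_end \<pi>)"

definition saws :: "'a ugraph \<Rightarrow> 'a set \<Rightarrow> 'a mid_path set" where
  "saws G W = {\<pi>. mid_saw G \<pi> \<and> path_start \<pi> \<in> incident_edges G W}"

definition saws_n :: "'a ugraph \<Rightarrow> 'a set \<Rightarrow> nat \<Rightarrow> 'a mid_path set" where
  "saws_n G W n = {\<pi>\<in>saws G W. path_length \<pi> = n}"

definition saws_to :: "'a ugraph \<Rightarrow> 'a set \<Rightarrow> ('a \<Rightarrow> 'a) \<Rightarrow> 'a mid_path set" where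
  "saws_to G W \<alpha> = {\<pi>\<in>saws G W. path_end \<pi> \<in> (\<lambda>e. \<alpha> ` e) ` incident_edges G W}"


section \<open>Critical exponents\<close>

text \<open>The exponents do not depend on the fundamental domain; accordingly, the defining property of
  each exponent is required for all fundamental domains.\<close>

definition Y_sum :: "'a ugraph \<Rightarrow> 'a set \<Rightarrow> real \<Rightarrow> real \<Rightarrow> ennreal" where
  "Y_sum G W x y = (\<Sum>\<^sub>\<infinity>\<pi>\<in>saws G W. ennreal (x ^ path_length \<pi> /
     (if path_length \<pi> = 0 then 1 else real (path_length \<pi>) powr y)))"

definition is_gamma :: "'a ugraph \<Rightarrow> ereal \<Rightarrow> bool" where
  "is_gamma G g \<longleftrightarrow> (\<forall>W. fundamental_domain G W \<longrightarrow>
     (\<forall>y::real. (ereal y < g \<longrightarrow> Y_sum G W (inverse (connective_constant G)) y = \<infinity>) \<and>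
                (g < ereal y \<longrightarrow> Y_sum G W (inverse (connective_constant G)) y < \<infinity>)))"

definition gamma_exponent :: "'a ugraph \<Rightarrow> ereal" where
  "gamma_exponent G = (THE g. is_gamma G g)"

definition mean_square_dist :: "'a ugraph \<Rightarrow> 'a set \<Rightarrow> nat \<Rightarrow> real" where
  "mean_square_dist G W n =
     (\<Sum>\<pi>\<in>saws_n G W n. (real (endpoint_dist G \<pi>))\<^sup>2) / real (card (saws_n G W n))"

definition V_sum :: "'a ugraph \<Rightarrow> 'a set \<Rightarrow> real \<Rightarrow> ennreal" where
  "V_sum G W z = (\<Sum>\<^sub>\<infinity>n\<in>{1..}. ennreal (real n powr (- (2 * z + 1)) * mean_square_dist G W n))"

definition is_nu :: "'a ugraph \<Rightarrow> ereal \<Rightarrow> bool" where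
  "is_nu G v \<longleftrightarrow> (\<forall>W. fundamental_domain G W \<longrightarrow>
     (\<forall>z::real. (ereal z < v \<longrightarrow> V_sum G W z = \<infinity>) \<and> (v < ereal z \<longrightarrow> V_sum G W z < \<infinity>)))"

definition nu_exponent :: "'a ugraph \<Rightarrow> ereal" where
  "nu_exponent G = (THE v. is_nu G v)"

definition Z_sum :: "'a ugraph \<Rightarrow> 'a set \<Rightarrow> ('a \<Rightarrow> 'a) \<Rightarrow> real \<Rightarrow> ennreal" where
  "Z_sum G W \<alpha> x = (\<Sum>\<^sub>\<infinity>\<pi>\<in>saws_to G W \<alpha>. ennreal (x ^ path_length \<pi>))"

definition is_eta :: "'a ugraph \<Rightarrow> ereal \<Rightarrow> bool" where
  "is_eta G h \<longleftrightarrow> (\<forall>W (\<alpha> :: nat \<Rightarrow> 'a \<Rightarrow> 'a).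
     fundamental_domain G W \<longrightarrow> (\<forall>k. automorphism G (\<alpha> k)) \<longrightarrow>
     filterlim (\<lambda>k. set_graph_dist G W (\<alpha> k ` W)) at_top sequentially \<longrightarrow>
     (\<forall>w::real.
        (ereal w < h \<longrightarrow>
          (\<lambda>k. Z_sum G W (\<alpha> k) (inverse (connective_constant G)) *
               ennreal (real (set_graph_dist G W (\<alpha> k ` W)) powr w)) \<longlonglongrightarrow> 0) \<and>
        (h < ereal w \<longrightarrow>
          (\<lambda>k. Z_sum G W (\<alpha> k) (inverse (connective_constant G)) *
               ennreal (real (set_graph_dist G W (\<alpha> k ` W)) powr w)) \<longlonglongrightarrow> \<infinity>)))"

definition eta_exists :: "'a ugraph \<Rightarrow> bool" where
  "eta_exists G \<longleftrightarrow> (\<exists>h. is_eta G h)"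

definition eta_exponent :: "'a ugraph \<Rightarrow> ereal" where
  "eta_exponent G = (THE h. is_eta G h)"


section \<open>Slow variation\<close>

definition slowly_varying :: "(real \<Rightarrow> real) \<Rightarrow> bool" where
  "slowly_varying L \<longleftrightarrow>
     (\<exists>a. (\<forall>x\<ge>a. L x > 0) \<and> set_borel_measurable borel {a..} L) \<and>
     (\<forall>t>0. ((\<lambda>x. L (t * x) / L x) \<longlongrightarrow> 1) at_top)"

end

theory Submission
  imports Defs
begin

text \<open>
  A self-avoiding walk between mid-edges of \<open>G\<^sub>0\<close> lifts to walks on the Fisher graph \<open>G\<^sub>1\<close> by crossing
  each triangle either directly (two vertices) or around its third corner (three vertices); a walk
  on \<open>G\<^sub>1\<close> is such a lift up to at most three steps at either end. Thus a sum
  of \<open>\<rho>(|\<pi>|) x\<^bsup>|\<pi>|\<^esup>\<close> over walks \<open>\<pi>\<close> of \<open>G\<^sub>1\<close> is comparable to the same sum over walks of \<open>G\<^sub>0\<close> with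
  \<open>x\<close> replaced by \<open>x\<^sup>2 + x\<^sup>3\<close>, as long as \<open>\<rho>\<close> changes by bounded factors on \<open>[n, 9n]\<close>. With \<open>\<rho> = 1\<close> this
  gives \<open>1/\<mu>\<^sub>0 = 1/\<mu>\<^sub>1\<^sup>2 + 1/\<mu>\<^sub>1\<^sup>3\<close>, and then powers \<open>\<rho>\<close> give \<open>\<gamma>\<close>, walks with prescribed ends give \<open>\<eta>\<close>,
  and weights \<open>\<rho>\<close> involving the slowly varying function and the squared distance give \<open>\<nu>\<close>.
\<close>

section \<open>Unordered sums of extended non-negative reals\<close>

text \<open>The connective constant is a definite description over all vertices, so it has to be
  shown to exist. Submultiplicativity controls only the largest count over a fundamental domain;
  that every single vertex has the same growth rate is the purpose of \<open>slow_growth\<close>.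
  Lifting is exact, but a walk on the Fisher graph may start or end inside a triangle. Cutting off
  such ends costs at most six steps, and only boundedly many walks share a core. If the core comes
  from n \<ge> 1 steps, the full walk has between n and 3n + 6 \<le> 9n steps, whence the interval
  [n, 9n]. For weights with a slowly varying factor, boundedness on it rests on the uniform
  convergence theorem. For \<nu> the obstacle is that averages over walks of one length cannot be
  compared, since lifting mixes lengths. The assumed bounds replace the number of walks by an
  explicit function, which turns V(z) into a weighted sum over walks. For \<eta>, automorphisms of
  the original graph induce automorphisms of the Fisher graph, so the limits postulated there
  restrict to the induced sequences; existence therefore passes from the Fisher graph to the
  original one.\<close>

lemma infsum_ennreal_SUP:
  fixes f :: "'a \<Rightarrow> ennreal"
  shows "infsum f A = (SUP F\<in>{F. finite F \<and> F \<subseteq> A}. sum f F)"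
  by (rule nonneg_infsum_complete) simp

lemma sum_le_infsum_ennreal:
  fixes f :: "'a \<Rightarrow> ennreal"
  assumes "finite F" "F \<subseteq> A"
  shows "sum f F \<le> infsum f A"
  unfolding infsum_ennreal_SUP using assms by (intro SUP_upper) auto

lemma infsum_ennreal_leI:
  fixes f :: "'a \<Rightarrow> ennreal"
  assumes "\<And>F. finite F \<Longrightarrow> F \<subseteq> A \<Longrightarrow> sum f F \<le> b"
  shows "infsum f A \<le> b"
  unfolding infsum_ennreal_SUP using assms by (intro SUP_least) auto

text \<open>Serves for maps that are many-to-one with bounded multiplicity, such as passing from a
  walk to its core. A finite partial sum is grouped by the values of \<open>h\<close>, and each
  group has at most \<open>N\<close> members.\<close>

lemma infsum_ennreal_fibre_le:
  fixes f :: "'a \<Rightarrow> ennreal" and g :: "'b \<Rightarrow> ennreal"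
  assumes h: "\<And>a. a \<in> A \<Longrightarrow> h a \<in> B" and le: "\<And>a. a \<in> A \<Longrightarrow> f a \<le> c * g (h a)"
    and fib: "\<And>b. b \<in> B \<Longrightarrow> finite {a\<in>A. h a = b} \<and> card {a\<in>A. h a = b} \<le> N"
  shows "infsum f A \<le> c * of_nat N * infsum g B"
proof (rule infsum_ennreal_leI)
  fix F assume F: "finite F" "F \<subseteq> A"
  have "sum f F \<le> (\<Sum>a\<in>F. c * g (h a))" using F le by (intro sum_mono) auto
  also have "\<dots> = (\<Sum>b\<in>h ` F. \<Sum>a\<in>{a\<in>F. h a = b}. c * g (h a))"
    by (rule sum.image_gen[OF F(1)])
  also have "\<dots> \<le> (\<Sum>b\<in>h ` F. (c * of_nat N) * g b)"
  proof (rule sum_mono)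
    fix b assume b: "b \<in> h ` F"
    have "card {a\<in>F. h a = b} \<le> card {a\<in>A. h a = b}"
      using b F h fib by (intro card_mono) auto
    also have "\<dots> \<le> N" using b F h fib by auto
    finally have N: "card {a\<in>F. h a = b} \<le> N" .
    have "(\<Sum>a\<in>{a\<in>F. h a = b}. c * g (h a)) = (\<Sum>a\<in>{a\<in>F. h a = b}. c * g b)"
      by (intro sum.cong) auto
    also have "\<dots> = of_nat (card {a\<in>F. h a = b}) * (c * g b)" by simp
    also have "\<dots> \<le> of_nat N * (c * g b)" using N by (intro mult_right_mono) auto
    finally show "(\<Sum>a\<in>{a\<in>F. h a = b}. c * g (h a)) \<le> (c * of_nat N) * g b"
      by (simp add: mult_ac)
  qed
  also have "\<dots> = c * of_nat N * (\<Sum>b\<in>h ` F. g b)" by (simp add: sum_distrib_left)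
  also have "\<dots> \<le> c * of_nat N * infsum g B"
    using F h by (intro mult_left_mono sum_le_infsum_ennreal) auto
  finally show "sum f F \<le> c * of_nat N * infsum g B" .
qed

lemma infsum_ennreal_inj_le:
  fixes f :: "'a \<Rightarrow> ennreal" and g :: "'b \<Rightarrow> ennreal"
  assumes h: "\<And>a. a \<in> A \<Longrightarrow> h a \<in> B" and le: "\<And>a. a \<in> A \<Longrightarrow> f a \<le> c * g (h a)"
    and inj: "inj_on h A"
  shows "infsum f A \<le> c * infsum g B"
proof -
  have "finite {a\<in>A. h a = b} \<and> card {a\<in>A. h a = b} \<le> 1" for b
  proof (cases "{a\<in>A. h a = b} = {}")
    case False
    then obtain a where "a \<in> A" "h a = b" by auto
    with inj have "{a\<in>A. h a = b} = {a}" by (auto simp: inj_on_def)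
    then show ?thesis by simp
  qed (simp only: finite.emptyI card.empty, simp)
  from infsum_ennreal_fibre_le[where N = 1 and h = h and A = A and B = B and f = f and g = g and c = c, OF h le this]
  show ?thesis by simp
qed

text \<open>Finite fibres make the finite subsets of both sides cofinal: a finite set of bases has a
  finite preimage, and a finite set of pairs lies over finitely many bases. In use, the fibre over a
  walk is its set of boolean lists.\<close>

lemma infsum_ennreal_Sigma_finite:
  fixes f :: "'a \<times> 'b \<Rightarrow> ennreal"
  assumes fin: "\<And>a. a \<in> A \<Longrightarrow> finite (C a)"
  shows "(\<Sum>\<^sub>\<infinity>a\<in>A. \<Sum>c\<in>C a. f (a, c)) = infsum f (Sigma A C)"
proof (rule antisym)
  show "(\<Sum>\<^sub>\<infinity>a\<in>A. \<Sum>c\<in>C a. f (a, c)) \<le> infsum f (Sigma A C)"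
  proof (rule infsum_ennreal_leI)
    fix F assume F: "finite F" "F \<subseteq> A"
    then have "(\<Sum>a\<in>F. \<Sum>c\<in>C a. f (a, c)) = sum f (Sigma F C)"
      using fin by (subst sum.Sigma) auto
    also have "\<dots> \<le> infsum f (Sigma A C)"
      using F fin by (intro sum_le_infsum_ennreal finite_SigmaI) auto
    finally show "(\<Sum>a\<in>F. \<Sum>c\<in>C a. f (a, c)) \<le> infsum f (Sigma A C)" .
  qed
  show "infsum f (Sigma A C) \<le> (\<Sum>\<^sub>\<infinity>a\<in>A. \<Sum>c\<in>C a. f (a, c))"
  proof (rule infsum_ennreal_leI)
    fix F assume F: "finite F" "F \<subseteq> Sigma A C"
    have fs: "fst ` F \<subseteq> A" using F by auto
    have "sum f F \<le> sum f (Sigma (fst ` F) C)"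
      using F fin fs by (intro sum_mono2 finite_SigmaI) (force)+
    also have "\<dots> = (\<Sum>a\<in>fst ` F. \<Sum>c\<in>C a. f (a, c))"
      using F fin fs by (subst sum.Sigma) auto
    also have "\<dots> \<le> (\<Sum>\<^sub>\<infinity>a\<in>A. \<Sum>c\<in>C a. f (a, c))"
      using F fs by (intro sum_le_infsum_ennreal) auto
    finally show "sum f F \<le> (\<Sum>\<^sub>\<infinity>a\<in>A. \<Sum>c\<in>C a. f (a, c))" .
  qed
qed

lemma infsum_ennreal_mono_set:
  fixes f :: "'a \<Rightarrow> ennreal"
  assumes "A \<subseteq> B"
  shows "infsum f A \<le> infsum f B"
  by (rule infsum_ennreal_leI) (use assms in \<open>auto intro!: sum_le_infsum_ennreal\<close>)

lemma infsum_ennreal_finite_less_top: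
  assumes "finite A"
  shows "(\<Sum>\<^sub>\<infinity>a\<in>A. ennreal (f a)) < \<infinity>"
  using assms by (simp add: ennreal_less_top)

text \<open>Lets finitely many short walks be treated apart from the rest.\<close>

lemma infsum_ennreal_less_top_split:
  assumes "infsum f {a\<in>A. P a} < (\<infinity>::ennreal)" "infsum f {a\<in>A. \<not> P a} < \<infinity>"
  shows "infsum f A < \<infinity>"
proof -
  have "infsum f A \<le> infsum f {a\<in>A. P a} + infsum f {a\<in>A. \<not> P a}"
  proof (rule infsum_ennreal_leI)
    fix F assume F: "finite F" "F \<subseteq> A"
    have "sum f F = sum f ({a\<in>F. P a} \<union> {a\<in>F. \<not> P a})" by (rule arg_cong[where f = "sum f"]) auto
    also have "\<dots> = sum f {a\<in>F. P a} + sum f {a\<in>F. \<not> P a}"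
      using F by (intro sum.union_disjoint) auto
    also have "\<dots> \<le> infsum f {a\<in>A. P a} + infsum f {a\<in>A. \<not> P a}"
      using F by (intro add_mono sum_le_infsum_ennreal) auto
    finally show "sum f F \<le> infsum f {a\<in>A. P a} + infsum f {a\<in>A. \<not> P a}" .
  qed
  then show ?thesis using assms by (simp add: order_le_less_trans)
qed

section \<open>Walks as lists of steps\<close>

text \<open>A walk is its starting mid-edge \<open>e\<close>, kept outside the list, and steps
  consisting of the vertex passed and the mid-edge reached. In contrast to the two parallel lists of
  \<open>mid_path\<close>, this form allows recursion and concatenation. A step may return to the
  mid-edge it came from.\<close>

fun step_walk :: "'a ugraph \<Rightarrow> 'a set \<Rightarrow> ('a \<times> 'a set) list \<Rightarrow> bool" where
  "step_walk G e [] \<longleftrightarrow> True"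
| "step_walk G e ((v, f) # s) \<longleftrightarrow> v \<in> e \<and> v \<in> f \<and> f \<in> edges G \<and> step_walk G f s"

fun walk_end :: "'a set \<Rightarrow> ('a \<times> 'a set) list \<Rightarrow> 'a set" where
  "walk_end e [] = e"
| "walk_end e ((v, f) # s) = walk_end f s"

definition step_saw :: "'a ugraph \<Rightarrow> 'a set \<Rightarrow> ('a \<times> 'a set) list \<Rightarrow> bool" where
  "step_saw G e s \<longleftrightarrow> e \<in> edges G \<and> step_walk G e s \<and> distinct (e # map snd s) \<and>
     distinct (map fst s)"

definition mid_path_of :: "'a set \<times> ('a \<times> 'a set) list \<Rightarrow> 'a mid_path" where
  "mid_path_of p = (fst p # map snd (snd p), map fst (snd p))"

definition step_saws :: "'a ugraph \<Rightarrow> 'a set \<Rightarrow> ('a set \<times> ('a \<times> 'a set) list) set" where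
  "step_saws G W = {(e, s). e \<in> incident_edges G W \<and> step_saw G e s}"

lemma walk_end_last: "walk_end e s = last (e # map snd s)"
  by (induction e s rule: walk_end.induct) auto

lemma walk_end_append [simp]: "walk_end e (s @ t) = walk_end (walk_end e s) t"
  by (induction e s rule: walk_end.induct) auto

lemma step_walk_append [simp]:
  "step_walk G e (s @ t) \<longleftrightarrow> step_walk G e s \<and> step_walk G (walk_end e s) t"
  by (induction G e s rule: step_walk.induct) auto

lemma step_walk_edges: "step_walk G e s \<Longrightarrow> snd ` set s \<subseteq> edges G"
  by (induction G e s rule: step_walk.induct) auto

lemma walk_end_edges: "step_walk G e s \<Longrightarrow> e \<in> edges G \<Longrightarrow> walk_end e s \<in> edges G"
  by (induction G e s rule: step_walk.induct) auto

lemma step_walk_nth_iff: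
  "step_walk G e s \<longleftrightarrow> snd ` set s \<subseteq> edges G \<and>
     (\<forall>i<length s. map fst s ! i \<in> (e # map snd s) ! i \<and> map fst s ! i \<in> map snd s ! i)"
proof (induction G e s rule: step_walk.induct)
  case (2 G e v f s)
  show ?case unfolding step_walk.simps 2 length_Cons list.map All_less_Suc2 by auto
qed auto

lemma mid_walk_mid_path_of:
  "mid_walk G (mid_path_of (e, s)) \<longleftrightarrow> e \<in> edges G \<and> step_walk G e s"
  unfolding mid_walk_def mid_path_of_def step_walk_nth_iff by auto

lemma mid_saw_mid_path_of: "mid_saw G (mid_path_of (e, s)) \<longleftrightarrow> step_saw G e s"
  unfolding mid_saw_def mid_walk_mid_path_of step_saw_def by (auto simp: mid_path_of_def)

lemma mid_path_of_simps [simp]: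
  "path_length (mid_path_of p) = length (snd p)" "path_start (mid_path_of p) = fst p"
  "path_end (mid_path_of p) = walk_end (fst p) (snd p)"
  by (auto simp: mid_path_of_def path_length_def path_start_def path_end_def walk_end_last)

lemma inj_mid_path_of: "inj mid_path_of"
proof (rule injI)
  fix p q :: "'a set \<times> ('a \<times> 'a set) list"
  assume "mid_path_of p = mid_path_of q"
  then have "fst p = fst q" "map fst (snd p) = map fst (snd q)" "map snd (snd p) = map snd (snd q)"
    by (auto simp: mid_path_of_def)
  then show "p = q" by (metis prod_eqI zip_map_fst_snd)
qed

lemma mid_path_cases:
  assumes "mid_walk G \<pi>"
  obtains e s where "\<pi> = mid_path_of (e, s)"
proof -
  obtain es vs where \<pi>: "\<pi> = (es, vs)" by (cases \<pi>)
  with assms have l: "length es = Suc (length vs)" by (auto simp: mid_walk_def)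
  then obtain e es' where "es = e # es'" by (cases es) auto
  with l \<pi> have "\<pi> = mid_path_of (e, zip vs es')" by (auto simp: mid_path_of_def)
  then show ?thesis using that by blast
qed

lemma saws_conv_step_saws: "saws G W = mid_path_of ` step_saws G W"
proof -
  have "\<pi> \<in> mid_path_of ` step_saws G W" if "\<pi> \<in> saws G W" for \<pi>
  proof -
    from that have "mid_walk G \<pi>" by (auto simp: saws_def mid_saw_def)
    then obtain e s where "\<pi> = mid_path_of (e, s)" by (rule mid_path_cases)
    with that show ?thesis by (auto simp: saws_def step_saws_def mid_saw_mid_path_of)
  qed
  then show ?thesis by (auto simp: saws_def step_saws_def mid_saw_mid_path_of)
qed

lemma infsum_saws: "infsum f (saws G W) = (\<Sum>\<^sub>\<infinity>p\<in>step_saws G W. f (mid_path_of p))"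
  unfolding saws_conv_step_saws
  by (subst infsum_reindex) (auto intro: inj_on_subset[OF inj_mid_path_of] simp: o_def)

lemma mid_dist_conv:
  assumes "e \<in> edges G"
  shows "mid_dist G e f = (LEAST n. \<exists>s. step_walk G e s \<and> walk_end e s = f \<and> length s = n)"
proof -
  have "(\<exists>\<pi>. mid_walk G \<pi> \<and> path_start \<pi> = e \<and> path_end \<pi> = f \<and> path_length \<pi> = n) \<longleftrightarrow>
    (\<exists>s. step_walk G e s \<and> walk_end e s = f \<and> length s = n)" for n
  proof
    assume "\<exists>\<pi>. mid_walk G \<pi> \<and> path_start \<pi> = e \<and> path_end \<pi> = f \<and> path_length \<pi> = n"
    then obtain \<pi> where \<pi>: "mid_walk G \<pi>" "path_start \<pi> = e" "path_end \<pi> = f" "path_length \<pi> = n"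
      by auto
    obtain e' s where "\<pi> = mid_path_of (e', s)" using \<pi>(1) by (rule mid_path_cases)
    with \<pi> show "\<exists>s. step_walk G e s \<and> walk_end e s = f \<and> length s = n"
      by (auto simp: mid_walk_mid_path_of)
  next
    assume "\<exists>s. step_walk G e s \<and> walk_end e s = f \<and> length s = n"
    then obtain s where "step_walk G e s" "walk_end e s = f" "length s = n" by auto
    with assms show "\<exists>\<pi>. mid_walk G \<pi> \<and> path_start \<pi> = e \<and> path_end \<pi> = f \<and> path_length \<pi> = n"
      by (intro exI[of _ "mid_path_of (e, s)"]) (auto simp: mid_walk_mid_path_of)
  qed
  then show ?thesis unfolding mid_dist_def by simp
qed

lemma mid_dist_le:
  assumes "e \<in> edges G" "step_walk G e s" "walk_end e s = f"
  shows "mid_dist G e f \<le> length s"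
  unfolding mid_dist_conv[OF assms(1)] by (rule Least_le) (use assms in blast)

text \<open>Some walk has to be given because the \<open>LEAST\<close> defining the distance carries
  information only when a walk exists.\<close>

lemma mid_dist_walk:
  assumes "e \<in> edges G" "step_walk G e s" "walk_end e s = f"
  obtains t where "step_walk G e t" "walk_end e t = f" "length t = mid_dist G e f"
proof -
  have "\<exists>t. step_walk G e t \<and> walk_end e t = f \<and> length t = mid_dist G e f"
    unfolding mid_dist_conv[OF assms(1)] by (rule LeastI_ex) (use assms in blast)
  then show ?thesis using that by blast
qed

text \<open>Allows the additive constant in \<open>mid_dist_fisher_le\<close> to be absorbed into a
  multiplicative one. The final mid-edge differs from the first by self-avoidance, so no empty walk
  joins them.\<close>

lemma mid_dist_saw_pos:
  assumes "step_saw G e s" "s \<noteq> []"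
  shows "1 \<le> mid_dist G e (walk_end e s)"
proof -
  have e: "e \<in> edges G" "step_walk G e s" using assms by (auto simp: step_saw_def)
  obtain t where t: "step_walk G e t" "walk_end e t = walk_end e s"
    "length t = mid_dist G e (walk_end e s)" by (rule mid_dist_walk[OF e refl])
  have "walk_end e s \<in> set (map snd s)" using assms(2) by (auto simp: walk_end_last last_map)
  then have "walk_end e s \<noteq> e" using assms by (auto simp: step_saw_def)
  with t show ?thesis by (cases t) auto
qed

section \<open>Automorphisms\<close>

lemma adj_commute: "adj G u v \<longleftrightarrow> adj G v u"
  by (simp add: adj_def insert_commute)

lemma adj_verts:
  assumes "simple_graph G" "adj G u v"
  shows "u \<in> verts G" "v \<in> verts G" "u \<noteq> v"
  using assms by (force simp: simple_graph_def adj_def)+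

lemma edge_cases:
  assumes "simple_graph G" "e \<in> edges G" "v \<in> e"
  obtains u where "e = {v, u}" "u \<noteq> v" "adj G v u"
proof -
  have "card e = 2" using assms by (auto simp: simple_graph_def)
  then obtain a b where "e = {a, b}" "a \<noteq> b" by (auto simp: card_2_iff)
  with assms show ?thesis using that by (auto simp: adj_def insert_commute)
qed

lemma edge_cases':
  assumes "simple_graph G" "e \<in> edges G"
  obtains u v where "e = {v, u}" "u \<noteq> v" "adj G v u"
proof -
  have "card e = 2" using assms by (auto simp: simple_graph_def)
  then obtain a b where "e = {a, b}" "a \<noteq> b" by (auto simp: card_2_iff)
  with assms show ?thesis using that by (auto simp: adj_def insert_commute)
qed

lemma automorphism_edge:
  assumes "simple_graph G" "automorphism G \<alpha>" "e \<in> edges G"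
  shows "\<alpha> ` e \<in> edges G"
proof -
  obtain u v where e: "e = {v, u}" "adj G v u" by (rule edge_cases'[OF assms(1,3)])
  then have "adj G (\<alpha> v) (\<alpha> u)" using assms adj_verts[OF assms(1) e(2)]
    by (auto simp: automorphism_def)
  then show ?thesis using e by (simp add: adj_def)
qed

text \<open>An automorphism is constrained only on \<open>verts G\<close>, hence the inverse
  relative to that set.\<close>

lemma automorphism_inv:
  assumes "automorphism G \<alpha>"
  shows "automorphism G (inv_into (verts G) \<alpha>)"
proof -
  have b: "bij_betw \<alpha> (verts G) (verts G)" using assms by (simp add: automorphism_def)
  have b': "bij_betw (inv_into (verts G) \<alpha>) (verts G) (verts G)" using b by (rule bij_betw_inv_into)
  show ?thesis unfolding automorphism_def
  proof (intro conjI ballI b')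
    fix u v assume uv: "u \<in> verts G" "v \<in> verts G"
    have "inv_into (verts G) \<alpha> u \<in> verts G" "inv_into (verts G) \<alpha> v \<in> verts G"
      using b' uv by (auto simp: bij_betw_def)
    moreover have "\<alpha> (inv_into (verts G) \<alpha> u) = u" "\<alpha> (inv_into (verts G) \<alpha> v) = v"
      using b uv by (auto simp: bij_betw_inv_into_right)
    ultimately show "adj G (inv_into (verts G) \<alpha> u) (inv_into (verts G) \<alpha> v) \<longleftrightarrow> adj G u v"
      using assms by (metis automorphism_def)
  qed
qed

lemma automorphism_image_inv:
  assumes "automorphism G \<alpha>" "A \<subseteq> verts G"
  shows "\<alpha> ` inv_into (verts G) \<alpha> ` A = A" "inv_into (verts G) \<alpha> ` \<alpha> ` A = A"
  using assms by (auto simp: automorphism_def bij_betw_def image_image f_inv_into_f subset_iff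
      inv_into_f_f cong: image_cong)

lemma automorphism_inj_image:
  assumes "automorphism G \<alpha>" "A \<subseteq> verts G" "B \<subseteq> verts G" "\<alpha> ` A = \<alpha> ` B"
  shows "A = B"
  using assms automorphism_image_inv(2)[OF assms(1)] by metis

lemma automorphism_incident_edges:
  assumes "simple_graph G" "automorphism G \<alpha>" "W \<subseteq> verts G"
  shows "(\<lambda>e. \<alpha> ` e) ` incident_edges G W = incident_edges G (\<alpha> ` W)"
proof (intro subset_antisym subsetI)
  fix f assume "f \<in> (\<lambda>e. \<alpha> ` e) ` incident_edges G W"
  then show "f \<in> incident_edges G (\<alpha> ` W)" using automorphism_edge[OF assms(1,2)]
    by (auto simp: incident_edges_def)
next
  fix f assume f: "f \<in> incident_edges G (\<alpha> ` W)"
  let ?b = "inv_into (verts G) \<alpha>"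
  have fe: "f \<in> edges G" "f \<subseteq> verts G" using f assms by (auto simp: incident_edges_def simple_graph_def)
  have "?b ` f \<in> edges G" using automorphism_edge[OF assms(1) automorphism_inv[OF assms(2)] fe(1)] .
  moreover have "?b ` f \<inter> W \<noteq> {}"
    using f automorphism_image_inv(2)[OF assms(2,3)] by (auto simp: incident_edges_def)
  moreover have "f = \<alpha> ` ?b ` f" using automorphism_image_inv(1)[OF assms(2) fe(2)] by simp
  ultimately show "f \<in> (\<lambda>e. \<alpha> ` e) ` incident_edges G W"
    by (auto simp: incident_edges_def)
qed

definition map_steps :: "('a \<Rightarrow> 'a) \<Rightarrow> ('a \<times> 'a set) list \<Rightarrow> ('a \<times> 'a set) list" where
  "map_steps \<alpha> = map (\<lambda>(v, f). (\<alpha> v, \<alpha> ` f))"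

lemma map_steps_simps [simp]:
  "map_steps \<alpha> [] = []" "map_steps \<alpha> ((v, f) # s) = (\<alpha> v, \<alpha> ` f) # map_steps \<alpha> s"
  "length (map_steps \<alpha> s) = length s"
  "map fst (map_steps \<alpha> s) = map \<alpha> (map fst s)"
  "map snd (map_steps \<alpha> s) = map ((`) \<alpha>) (map snd s)"
  by (auto simp: map_steps_def case_prod_unfold)

lemma walk_end_map_steps: "walk_end (\<alpha> ` e) (map_steps \<alpha> s) = \<alpha> ` walk_end e s"
  by (induction e s rule: walk_end.induct) auto

lemma step_walk_map_steps:
  assumes "simple_graph G" "automorphism G \<alpha>"
  shows "step_walk G e s \<Longrightarrow> step_walk G (\<alpha> ` e) (map_steps \<alpha> s)"
  by (induction s arbitrary: e) (auto intro: automorphism_edge[OF assms])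

lemma step_walk_subset_verts:
  assumes "simple_graph G" "step_walk G e s"
  shows "fst ` set s \<subseteq> verts G" "\<And>f. f \<in> snd ` set s \<Longrightarrow> f \<subseteq> verts G"
proof -
  have *: "\<And>f. f \<in> snd ` set s \<Longrightarrow> f \<subseteq> verts G"
    using step_walk_edges[OF assms(2)] assms(1) by (auto simp: simple_graph_def)
  then show "\<And>f. f \<in> snd ` set s \<Longrightarrow> f \<subseteq> verts G" .
  have "v \<in> f" if "(v, f) \<in> set s" for v f
    using assms(2) that by (induction G e s rule: step_walk.induct) auto
  with * show "fst ` set s \<subseteq> verts G" by fastforce
qed

lemma step_saw_map_steps:
  assumes "simple_graph G" "automorphism G \<alpha>" "step_saw G e s"
  shows "step_saw G (\<alpha> ` e) (map_steps \<alpha> s)"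
proof -
  have e: "e \<in> edges G" "step_walk G e s" using assms by (auto simp: step_saw_def)
  have sub: "set (e # map snd s) \<subseteq> Pow (verts G)" "set (map fst s) \<subseteq> verts G"
    using step_walk_subset_verts[OF assms(1) e(2)] e(1) assms(1) by (auto simp: simple_graph_def)
  have inj: "inj_on \<alpha> (verts G)" using assms by (auto simp: automorphism_def bij_betw_def)
  have "inj_on ((`) \<alpha>) (Pow (verts G))"
    using automorphism_inj_image[OF assms(2)] by (auto simp: inj_on_def)
  from inj_on_subset[OF this sub(1)] have "distinct (map ((`) \<alpha>) (e # map snd s))"
    using assms(3) by (intro distinct_map[THEN iffD2]) (simp add: step_saw_def)
  moreover have "distinct (map \<alpha> (map fst s))"
    using assms(3) inj_on_subset[OF inj sub(2)]
    by (intro distinct_map[THEN iffD2]) (simp add: step_saw_def)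
  ultimately show ?thesis
    using e step_walk_map_steps[OF assms(1,2) e(2)] automorphism_edge[OF assms(1,2) e(1)]
    unfolding step_saw_def map_steps_simps by simp
qed

text \<open>Outside \<open>verts G\<close> the map may identify points, so injectivity is available
  only because the vertices and mid-edges of a walk stay inside.\<close>

lemma map_steps_inj:
  assumes "simple_graph G" "automorphism G \<alpha>" "step_walk G e s" "step_walk G e' s'"
    "map_steps \<alpha> s = map_steps \<alpha> s'"
  shows "s = s'"
proof -
  note sub = step_walk_subset_verts[OF assms(1,3)] step_walk_subset_verts[OF assms(1,4)]
  have inj: "inj_on \<alpha> (verts G)" using assms(2) by (auto simp: automorphism_def bij_betw_def)
  have inj': "inj_on ((`) \<alpha>) (Pow (verts G))"
    using automorphism_inj_image[OF assms(2)] by (auto simp: inj_on_def)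
  have "map \<alpha> (map fst s) = map \<alpha> (map fst s')"
    using assms(5) by (metis map_steps_simps(4))
  moreover have "inj_on \<alpha> (set (map fst s) \<union> set (map fst s'))"
    by (rule inj_on_subset[OF inj]) (use sub in auto)
  ultimately have 1: "map fst s = map fst s'" by (rule map_inj_on)
  have "map ((`) \<alpha>) (map snd s) = map ((`) \<alpha>) (map snd s')"
    using assms(5) by (metis map_steps_simps(5))
  moreover have "inj_on ((`) \<alpha>) (set (map snd s) \<union> set (map snd s'))"
  proof (rule inj_on_subset[OF inj'])
    have "edges G \<subseteq> Pow (verts G)" using assms(1) by (auto simp: simple_graph_def)
    with step_walk_edges[OF assms(3)] step_walk_edges[OF assms(4)]
    show "set (map snd s) \<union> set (map snd s') \<subseteq> Pow (verts G)" unfolding set_map by blast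
  qed
  ultimately have "map snd s = map snd s'" by (rule map_inj_on)
  with 1 show ?thesis by (metis zip_map_fst_snd)
qed

lemma mid_dist_automorphism_le:
  assumes "simple_graph G" "automorphism G \<alpha>" "e \<in> edges G" "step_walk G e s"
  shows "mid_dist G (\<alpha> ` e) (\<alpha> ` walk_end e s) \<le> mid_dist G e (walk_end e s)"
proof -
  obtain t where t: "step_walk G e t" "walk_end e t = walk_end e s"
    "length t = mid_dist G e (walk_end e s)" by (rule mid_dist_walk[OF assms(3,4) refl])
  have "mid_dist G (\<alpha> ` e) (\<alpha> ` walk_end e s) \<le> length (map_steps \<alpha> t)"
    using assms t by (intro mid_dist_le automorphism_edge step_walk_map_steps)
      (auto simp: walk_end_map_steps)
  then show ?thesis using t by simp
qed

lemma mid_dist_automorphism: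
  assumes "simple_graph G" "automorphism G \<alpha>" "e \<in> edges G" "step_walk G e s"
  shows "mid_dist G (\<alpha> ` e) (\<alpha> ` walk_end e s) = mid_dist G e (walk_end e s)"
proof (rule antisym)
  let ?b = "inv_into (verts G) \<alpha>"
  have sub: "e \<subseteq> verts G" "walk_end e s \<subseteq> verts G"
    using assms walk_end_edges[OF assms(4,3)] by (auto simp: simple_graph_def)
  have "mid_dist G (?b ` \<alpha> ` e) (?b ` walk_end (\<alpha> ` e) (map_steps \<alpha> s))
      \<le> mid_dist G (\<alpha> ` e) (walk_end (\<alpha> ` e) (map_steps \<alpha> s))"
    using assms by (intro mid_dist_automorphism_le automorphism_inv automorphism_edge
        step_walk_map_steps) auto
  then show "mid_dist G e (walk_end e s) \<le> mid_dist G (\<alpha> ` e) (\<alpha> ` walk_end e s)"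
    using sub by (simp add: automorphism_image_inv(2)[OF assms(2)] walk_end_map_steps)
qed (rule mid_dist_automorphism_le[OF assms])

section \<open>The connective constant exists\<close>

lemma vertex_saws_conv:
  "vertex_saws G n v = {p. length p = Suc n \<and> hd p = v \<and> set p \<subseteq> verts G \<and> distinct p \<and>
     successively (adj G) p}"
  unfolding vertex_saws_def successively_conv_nth by auto

lemma vertex_saws_Cons:
  "vertex_saws G (Suc n) v \<subseteq> (\<Union>u\<in>{u. adj G v u}. (#) v ` vertex_saws G n u)"
proof
  fix p assume p: "p \<in> vertex_saws G (Suc n) v"
  then obtain u q where "p = v # u # q"
    by (auto simp: vertex_saws_conv length_Suc_conv)
  with p show "p \<in> (\<Union>u\<in>{u. adj G v u}. (#) v ` vertex_saws G n u)"
    by (auto simp: vertex_saws_conv)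
qed

text \<open>The two pieces overlap in the vertex at position \<open>m\<close>, which ends the first
  and begins the second; this makes the numbers of steps add up.\<close>

lemma vertex_saws_split:
  assumes "p \<in> vertex_saws G (m + n) v"
  shows "take (Suc m) p \<in> vertex_saws G m v" "drop m p \<in> vertex_saws G n (last (take (Suc m) p))"
proof -
  have l: "length p = Suc (m + n)" using assms by (auto simp: vertex_saws_conv)
  have 1: "p = take (Suc m) p @ drop (Suc m) p" by simp
  have 2: "p = take m p @ drop m p" by simp
  have s: "successively (adj G) p" "distinct p" "set p \<subseteq> verts G"
    using assms by (auto simp: vertex_saws_conv)
  have "successively (adj G) (take (Suc m) p)" "successively (adj G) (drop m p)"
    using s(1) 1 2 by (metis successively_append_iff)+
  moreover have "hd (take (Suc m) p) = v" using assms by (auto simp: vertex_saws_conv)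
  moreover have "last (take (Suc m) p) = hd (drop m p)"
    using l by (simp add: take_Suc_conv_app_nth hd_drop_conv_nth)
  ultimately show "take (Suc m) p \<in> vertex_saws G m v"
    "drop m p \<in> vertex_saws G n (last (take (Suc m) p))"
    using l s set_take_subset[of "Suc m" p] set_drop_subset[of m p] by (auto simp: vertex_saws_conv)
qed

lemma map_vertex_saws:
  assumes "automorphism G \<alpha>" "p \<in> vertex_saws G n v"
  shows "map \<alpha> p \<in> vertex_saws G n (\<alpha> v)"
proof -
  have p: "set p \<subseteq> verts G" "p \<noteq> []" "length p = Suc n" "hd p = v" "distinct p"
    "successively (adj G) p" using assms by (auto simp: vertex_saws_conv)
  have "successively (\<lambda>x y. adj G (\<alpha> x) (\<alpha> y)) p"
    using p(6) by (rule successively_mono)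
      (use p(1) assms(1) in \<open>auto simp: automorphism_def\<close>)
  moreover have "inj_on \<alpha> (set p)"
    using assms(1) p(1) by (auto simp: automorphism_def bij_betw_def inj_on_subset)
  moreover have "\<alpha> ` set p \<subseteq> verts G"
    using assms(1) p(1) by (auto simp: automorphism_def bij_betw_def)
  ultimately show ?thesis using p
    by (auto simp: vertex_saws_conv distinct_map successively_map hd_map)
qed

text \<open>The Fisher graph satisfies the same assumptions (\<open>qt_cubic_fisher\<close>), so the
  results of the locale apply to both graphs.\<close>

locale qt_cubic_graph =
  fixes G :: "'a ugraph"
  assumes simple: "simple_graph G" and infinite_verts: "infinite (verts G)"
    and connected: "connected_graph G" and cubic: "cubic G" and quasi_transitive: "quasi_transitive G"
begin

lemma card_edges_at: "v \<in> verts G \<Longrightarrow> card {e\<in>edges G. v \<in> e} = 3"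
  using cubic by (auto simp: cubic_def)

lemma finite_edges_at: "v \<in> verts G \<Longrightarrow> finite {e\<in>edges G. v \<in> e}"
  using card_edges_at[of v] by (intro card_ge_0_finite) simp

lemma finite_nbrs: "v \<in> verts G \<Longrightarrow> finite {u. adj G v u}"
proof -
  assume v: "v \<in> verts G"
  have "(\<lambda>u. {v, u}) ` {u. adj G v u} \<subseteq> {e\<in>edges G. v \<in> e}" by (auto simp: adj_def)
  then have "finite ((\<lambda>u. {v, u}) ` {u. adj G v u})" using finite_edges_at[OF v] finite_subset by blast
  then show ?thesis by (rule finite_imageD) (auto simp: inj_on_def doubleton_eq_iff)
qed

lemma finite_incident_edges: "finite W \<Longrightarrow> W \<subseteq> verts G \<Longrightarrow> finite (incident_edges G W)"
proof -
  assume W: "finite W" "W \<subseteq> verts G"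
  have "incident_edges G W = (\<Union>v\<in>W. {e\<in>edges G. v \<in> e})" by (auto simp: incident_edges_def)
  then show ?thesis using W finite_edges_at by auto
qed

lemma finite_vertex_saws: "v \<in> verts G \<Longrightarrow> finite (vertex_saws G n v)"
proof (induction n arbitrary: v)
  case 0
  have "vertex_saws G 0 v \<subseteq> {[v]}" by (auto simp: vertex_saws_conv length_Suc_conv)
  then show ?case by (rule finite_subset) simp
next
  case (Suc n)
  show ?case
    by (rule finite_subset[OF vertex_saws_Cons])
      (use Suc finite_nbrs adj_verts[OF simple] in auto)
qed

lemma ex_vertex_saw_to:
  assumes "u \<in> verts G" "v \<in> verts G"
  shows "\<exists>n. \<exists>p\<in>vertex_saws G n v. last p = u"
proof -
  define P where "P u p \<longleftrightarrow> p \<noteq> [] \<and> hd p = v \<and> last p = u \<and> set p \<subseteq> verts G \<and> successively (adj G) p"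
    for u p
  have "(adj G)\<^sup>*\<^sup>* v u" using connected assms by (auto simp: connected_graph_def)
  then have "\<exists>p. P u p"
  proof (induction rule: rtranclp_induct)
    case base
    show ?case using assms by (intro exI[of _ "[v]"]) (auto simp: P_def)
  next
    case (step y z)
    then obtain p where "p \<noteq> []" "hd p = v" "last p = y" "set p \<subseteq> verts G" "successively (adj G) p"
      by (auto simp: P_def)
    then show ?case using step adj_verts[OF simple step(2)]
      by (intro exI[of _ "p @ [z]"]) (auto simp: P_def successively_append_iff)
  qed
  then obtain p0 where "P u p0" by auto
  \<comment> \<open>A shortest connecting list is self-avoiding, since a repeated vertex would allow
    the loop between its occurrences to be cut out.\<close>
  from ex_has_least_nat[of "P u", OF this, of length]
  obtain p where p: "P u p" and min: "\<And>q. P u q \<Longrightarrow> length p \<le> length q" by auto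
  have "distinct p"
  proof (rule ccontr)
    assume "\<not> distinct p"
    then obtain xs ys zs y where dec: "p = xs @ [y] @ ys @ [y] @ zs"
      using not_distinct_decomp by blast
    have "P u (xs @ [y] @ zs)" using p unfolding dec P_def
      by (auto simp: successively_append_iff successively_Cons hd_append split: if_splits)
    from min[OF this] show False unfolding dec by simp
  qed
  then have "p \<in> vertex_saws G (length p - 1) v" using p by (auto simp: vertex_saws_conv P_def)
  then show ?thesis using p by (auto simp: P_def)
qed

text \<open>Prefixes of self-avoiding walks are self-avoiding, so a missing length \<open>n\<close>
  bounds all lengths. Every vertex is the end of such a walk, and there would be only finitely many
  vertices.\<close>

lemma vertex_saws_nonempty:
  assumes "v \<in> verts G"
  shows "vertex_saws G n v \<noteq> {}"
proof
  assume e: "vertex_saws G n v = {}"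
  have "verts G \<subseteq> (\<Union>k<n. last ` vertex_saws G k v)"
  proof
    fix u assume "u \<in> verts G"
    from ex_vertex_saw_to[OF this assms] obtain k p where k: "p \<in> vertex_saws G k v" "last p = u" by auto
    have "k < n"
    proof (rule ccontr)
      assume "\<not> k < n"
      then have "p \<in> vertex_saws G (n + (k - n)) v" using k by simp
      from vertex_saws_split(1)[OF this] e show False by auto
    qed
    then show "u \<in> (\<Union>k<n. last ` vertex_saws G k v)" using k by blast
  qed
  then have "finite (verts G)" by (rule finite_subset) (use finite_vertex_saws[OF assms] in auto)
  then show False using infinite_verts by simp
qed

section \<open>Maximal counts and their growth rate\<close>

definition saw_count :: "nat \<Rightarrow> 'a \<Rightarrow> real" where
  "saw_count n v = real (card (vertex_saws G n v))"

definition some_domain :: "'a set" where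
  "some_domain = (SOME W. fundamental_domain G W)"

text \<open>Automorphisms carry any vertex into the domain, so this finite maximum bounds the counts
  at all vertices. Unlike the count at one vertex, it is submultiplicative.\<close>

definition max_count :: "nat \<Rightarrow> real" where
  "max_count n = Max (saw_count n ` some_domain)"

text \<open>The limit in Fekete's lemma. Length 0 is excluded because \<open>root 0\<close> is
  constantly 0.\<close>

definition growth :: real where
  "growth = (INF n\<in>{1..}. root n (max_count n))"

lemma some_domain: "fundamental_domain G some_domain"
  unfolding some_domain_def using quasi_transitive by (auto simp: quasi_transitive_def intro: someI)

lemma fundamental_domain_nonempty: "fundamental_domain G W \<Longrightarrow> W \<noteq> {}"
proof -
  assume W: "fundamental_domain G W"
  obtain v where "v \<in> verts G" using infinite_verts by fastforce
  with W show ?thesis by (auto simp: fundamental_domain_def)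
qed

lemma some_domain_props: "finite some_domain" "some_domain \<noteq> {}" "some_domain \<subseteq> verts G"
  using some_domain fundamental_domain_nonempty[OF some_domain] by (auto simp: fundamental_domain_def)

lemma saw_count_ge_1: "v \<in> verts G \<Longrightarrow> 1 \<le> saw_count n v"
  using finite_vertex_saws vertex_saws_nonempty
  by (simp add: saw_count_def Suc_leI card_gt_0_iff)

lemma saw_count_le_max:
  assumes "v \<in> verts G"
  shows "saw_count n v \<le> max_count n"
proof -
  obtain \<alpha> where \<alpha>: "automorphism G \<alpha>" "\<alpha> v \<in> some_domain"
    using some_domain assms by (auto simp: fundamental_domain_def)
  have inj: "inj_on \<alpha> (verts G)" using \<alpha> by (auto simp: automorphism_def bij_betw_def)
  have "card (vertex_saws G n v) \<le> card (vertex_saws G n (\<alpha> v))"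
  proof (rule card_inj_on_le)
    show "inj_on (map \<alpha>) (vertex_saws G n v)"
    proof (rule inj_onI)
      fix p q assume pq: "p \<in> vertex_saws G n v" "q \<in> vertex_saws G n v" "map \<alpha> p = map \<alpha> q"
      have "set p \<union> set q \<subseteq> verts G" using pq by (auto simp: vertex_saws_def)
      from map_inj_on[OF pq(3) inj_on_subset[OF inj this]] show "p = q" .
    qed
    show "finite (vertex_saws G n (\<alpha> v))"
      using \<alpha> some_domain_props by (intro finite_vertex_saws) auto
  qed (use map_vertex_saws[OF \<alpha>(1)] in auto)
  then have "saw_count n v \<le> saw_count n (\<alpha> v)" by (simp add: saw_count_def)
  also have "\<dots> \<le> max_count n" unfolding max_count_def using \<alpha> some_domain_props by auto
  finally show ?thesis .
qed

lemma max_count_attained: "\<exists>w\<in>some_domain. max_count n = saw_count n w"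
proof -
  have "max_count n \<in> saw_count n ` some_domain"
    unfolding max_count_def using some_domain_props by (intro Max_in) auto
  then show ?thesis by auto
qed

lemma max_count_ge_1: "1 \<le> max_count n"
  using max_count_attained[of n] some_domain_props saw_count_ge_1 by force

lemma saw_count_add:
  assumes v: "v \<in> verts G"
  shows "saw_count (m + n) v \<le> saw_count m v * max_count n"
proof -
  let ?S = "Sigma (vertex_saws G m v) (\<lambda>q. vertex_saws G n (last q))"
  have last: "last q \<in> verts G" if "q \<in> vertex_saws G m v" for q
  proof -
    have "q \<noteq> []" using that by (auto simp: vertex_saws_def)
    then show ?thesis using that last_in_set[of q] by (auto simp: vertex_saws_def)
  qed
  have "card (vertex_saws G (m + n) v) \<le> card ?S"
  proof (rule card_inj_on_le)
    show "inj_on (\<lambda>p. (take (Suc m) p, drop m p)) (vertex_saws G (m + n) v)"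
    proof (rule inj_onI)
      fix p q :: "'a list" assume "(take (Suc m) p, drop m p) = (take (Suc m) q, drop m q)"
      then have "take m (take (Suc m) p) = take m (take (Suc m) q)" "drop m p = drop m q" by simp_all
      then have "take m p = take m q" "drop m p = drop m q" by (simp_all add: min_def)
      then show "p = q" by (metis append_take_drop_id)
    qed
    show "finite ?S" using finite_vertex_saws v last by auto
  qed (use vertex_saws_split in fastforce)
  also have "card ?S = (\<Sum>q\<in>vertex_saws G m v. card (vertex_saws G n (last q)))"
    using finite_vertex_saws v last by simp
  finally have "saw_count (m + n) v \<le> (\<Sum>q\<in>vertex_saws G m v. saw_count n (last q))"
    by (simp add: saw_count_def flip: of_nat_sum)
  also have "\<dots> \<le> (\<Sum>q\<in>vertex_saws G m v. max_count n)"
    using last by (intro sum_mono saw_count_le_max)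
  finally show ?thesis by (simp add: saw_count_def)
qed

lemma max_count_add: "max_count (m + n) \<le> max_count m * max_count n"
proof -
  obtain w where w: "w \<in> some_domain" "max_count (m + n) = saw_count (m + n) w"
    using max_count_attained by blast
  have v: "w \<in> verts G" using w some_domain_props by auto
  have "max_count (m + n) \<le> saw_count m w * max_count n" using saw_count_add[OF v] w by simp
  also have "\<dots> \<le> max_count m * max_count n"
    using saw_count_le_max[OF v] max_count_ge_1[of n] by (intro mult_right_mono) auto
  finally show ?thesis .
qed

text \<open>The first term counts the walks that avoid \<open>v\<close>, prefixed by
  \<open>v\<close>. In the sum, \<open>k\<close> is the position of \<open>v\<close> on the walk:
  the reversed initial part and the remainder both start at \<open>v\<close>, and they are glued
  back by dropping one of the two copies of \<open>v\<close>.\<close>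

lemma saw_count_nbr:
  assumes uv: "adj G v u"
  shows "saw_count n u \<le> saw_count (Suc n) v + (\<Sum>k\<le>n. saw_count k v * saw_count (n - k) v)"
proof -
  have verts: "u \<in> verts G" "v \<in> verts G" using adj_verts[OF simple uv] by auto
  let ?A = "tl ` vertex_saws G (Suc n) v"
  let ?B = "\<lambda>k. (\<lambda>(a, b). rev (tl a) @ b) ` (vertex_saws G k v \<times> vertex_saws G (n - k) v)"
  have "vertex_saws G n u \<subseteq> ?A \<union> (\<Union>k\<le>n. ?B k)"
  proof
    fix p assume p: "p \<in> vertex_saws G n u"
    then have p': "successively (adj G) p" "p \<noteq> []" "hd p = u" "distinct p" "set p \<subseteq> verts G"
      "length p = Suc n" by (auto simp: vertex_saws_conv)
    show "p \<in> ?A \<union> (\<Union>k\<le>n. ?B k)"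
    proof (cases "v \<in> set p")
      case False
      then have "v # p \<in> vertex_saws G (Suc n) v"
        using p' verts uv by (auto simp: vertex_saws_conv successively_Cons)
      then show ?thesis by (intro UnI1 image_eqI[of _ tl "v # p"]) auto
    next
      case True
      then obtain xs ys where dec: "p = xs @ v # ys" by (meson split_list)
      have "length xs \<le> n" using p' dec by simp
      moreover have "v # rev xs \<in> vertex_saws G (length xs) v"
      proof -
        have "successively (adj G) (xs @ [v])"
          using p'(1) unfolding dec by (auto simp: successively_append_iff)
        then have "successively (\<lambda>x y. adj G y x) (rev (xs @ [v]))"
          by (simp only: successively_rev)
        then have "successively (adj G) (rev (xs @ [v]))"
          by (rule successively_mono) (simp only: adj_commute)
        then have "successively (adj G) (v # rev xs)" by simp
        then show ?thesis using p' dec by (auto simp: vertex_saws_conv)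
      qed
      moreover have "v # ys \<in> vertex_saws G (n - length xs) v"
        using p' dec by (auto simp: vertex_saws_conv successively_append_iff)
      moreover have "p = (\<lambda>(a, b). rev (tl a) @ b) (v # rev xs, v # ys)" using dec by simp
      ultimately have "p \<in> ?B (length xs)" by blast
      with \<open>length xs \<le> n\<close> show ?thesis by blast
    qed
  qed
  then have "card (vertex_saws G n u) \<le> card (?A \<union> (\<Union>k\<le>n. ?B k))"
    using finite_vertex_saws verts by (intro card_mono) auto
  also have "\<dots> \<le> card ?A + card (\<Union>k\<le>n. ?B k)" by (rule card_Un_le)
  also have "card (\<Union>k\<le>n. ?B k) \<le> (\<Sum>k\<le>n. card (?B k))" by (rule card_UN_le) simp
  also have "(\<Sum>k\<le>n. card (?B k)) \<le> (\<Sum>k\<le>n. card (vertex_saws G k v \<times> vertex_saws G (n - k) v))"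
    using finite_vertex_saws verts by (intro sum_mono card_image_le finite_cartesian_product) auto
  also have "card ?A \<le> card (vertex_saws G (Suc n) v)"
    using finite_vertex_saws verts by (intro card_image_le) auto
  finally have "card (vertex_saws G n u) \<le> card (vertex_saws G (Suc n) v) +
      (\<Sum>k\<le>n. card (vertex_saws G k v) * card (vertex_saws G (n - k) v))"
    by (simp add: card_cartesian_product)
  then have "real (card (vertex_saws G n u)) \<le> real (card (vertex_saws G (Suc n) v) +
      (\<Sum>k\<le>n. card (vertex_saws G k v) * card (vertex_saws G (n - k) v)))" by (rule of_nat_mono)
  then show ?thesis by (simp add: saw_count_def)
qed

lemma bdd_below_root: "bdd_below ((\<lambda>n. root n (max_count n)) ` {1..})"
  by (rule bdd_belowI[of _ 0]) (use max_count_ge_1 in \<open>force intro!: real_root_ge_zero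
    order_trans[OF zero_le_one]\<close>)

lemma growth_ge_1: "1 \<le> growth"
  unfolding growth_def using max_count_ge_1 by (intro cINF_greatest) auto

lemma growth_power_le: "growth ^ n \<le> max_count n"
proof (cases "n = 0")
  case True
  then show ?thesis using max_count_ge_1 by simp
next
  case False
  have "growth \<le> root n (max_count n)" unfolding growth_def
    using False by (intro cINF_lower bdd_below_root) auto
  then have "growth ^ n \<le> root n (max_count n) ^ n" using growth_ge_1 by (intro power_mono) auto
  then show ?thesis using False max_count_ge_1[of n] by simp
qed

text \<open>The upper half of Fekete's lemma. Fix a length \<open>r\<close> at which the root is
  already below \<open>b\<close> and divide \<open>n\<close> by \<open>r\<close>; \<open>C\<close>
  absorbs the remainder.\<close>

lemma max_count_le_power:
  assumes b: "growth < b"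
  obtains C where "1 \<le> C" "\<And>n. max_count n \<le> C * b ^ n"
proof -
  have b1: "1 \<le> b" using growth_ge_1 b by simp
  have "\<exists>r\<in>{1..}. root r (max_count r) < b"
    using b unfolding growth_def by (subst (asm) cINF_less_iff[OF _ bdd_below_root]) auto
  then obtain r where r: "r \<ge> 1" "root r (max_count r) < b" by auto
  have "root r (max_count r) ^ r \<le> b ^ r"
    using r max_count_ge_1[of r] by (intro power_mono) auto
  then have rb: "max_count r \<le> b ^ r" using r max_count_ge_1[of r] by simp
  define C where "C = Max (max_count ` {..r})"
  have C: "max_count t \<le> C" if "t \<le> r" for t using that by (auto simp: C_def)
  have C1: "1 \<le> C" using C[of 0] max_count_ge_1[of 0] by simp
  have q: "max_count (q * r + t) \<le> (b ^ r) ^ q * max_count t" for q t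
  proof (induction q)
    case (Suc q)
    have "max_count (Suc q * r + t) = max_count (r + (q * r + t))" by (simp add: algebra_simps)
    also have "\<dots> \<le> max_count r * max_count (q * r + t)" by (rule max_count_add)
    also have "\<dots> \<le> b ^ r * ((b ^ r) ^ q * max_count t)"
      using Suc rb max_count_ge_1[of "q * r + t"] b1 by (intro mult_mono) auto
    finally show ?case by (simp add: mult_ac)
  qed simp
  have "max_count n \<le> C * b ^ n" for n
  proof -
    have "max_count n = max_count (n div r * r + n mod r)" by simp
    also have "\<dots> \<le> (b ^ r) ^ (n div r) * max_count (n mod r)" by (rule q)
    also have "\<dots> \<le> b ^ n * C"
    proof (intro mult_mono)
      have "(b ^ r) ^ (n div r) = b ^ (n div r * r)" by (simp add: power_mult[symmetric] mult.commute)
      also have "\<dots> \<le> b ^ n" using b1 by (intro power_increasing) auto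
      finally show "(b ^ r) ^ (n div r) \<le> b ^ n" .
      show "max_count (n mod r) \<le> C" using r by (intro C) (simp add: less_imp_le)
    qed (use b1 max_count_ge_1[of "n mod r"] in auto)
    finally show ?thesis by (simp add: mult.commute)
  qed
  then show ?thesis using that C1 by blast
qed

text \<open>The same lengths \<open>n\<close> have to serve all of \<open>A\<close>: once
  \<open>A\<close> contains a fundamental domain, the maximum itself is at most
  \<open>a ^ n\<close>, which contradicts the infimum defining \<open>growth\<close>.\<close>

definition slow_growth :: "'a set \<Rightarrow> bool" where
  "slow_growth A \<longleftrightarrow> A \<subseteq> verts G \<and>
     (\<exists>a>0. a < growth \<and> (\<forall>N. \<exists>n\<ge>N. \<forall>v\<in>A. saw_count n v \<le> a ^ n))"

text \<open>A walk of length \<open>2 n\<close> from a neighbour \<open>u\<close> of \<open>v\<close> either avoids \<open>v\<close> and extends to a walk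
  from \<open>v\<close>, or \<open>v\<close> splits it into two walks from \<open>v\<close>, one of which has length at least \<open>n\<close>.
  Hence exponentially few walks of length \<open>n\<close> from \<open>v\<close> force exponentially few walks of length
  \<open>2 n\<close> from \<open>u\<close>.\<close>

lemma slow_growth_insert:
  assumes "slow_growth A" "v \<in> A" "adj G v u"
  shows "slow_growth (insert u A)"
proof -
  obtain a where a: "0 < a" "a < growth" and inf: "\<And>N. \<exists>n\<ge>N. \<forall>v\<in>A. saw_count n v \<le> a ^ n"
    using assms(1) unfolding slow_growth_def by blast
  have A: "A \<subseteq> verts G" using assms by (auto simp: slow_growth_def)
  have g1: "1 \<le> growth" by (rule growth_ge_1)
  \<comment> \<open>One stretch of \<open>n\<close> steps from a vertex of \<open>A\<close>
    contributes \<open>a ^ n\<close>, and the other \<open>n\<close> steps contribute at most a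
    constant times \<open>b ^ n\<close>. The rate per step is thus \<open>sqrt (a * b)\<close>;
    choosing \<open>b\<close> close to \<open>growth\<close> keeps it below \<open>growth\<close>,
    and \<open>a'\<close> leaves room for a factor linear in \<open>n\<close>.\<close>
  have "growth < growth * growth / a" using a g1 by (simp add: field_simps)
  then obtain b where b: "growth < b" "b < growth * growth / a" using dense by blast
  have ab: "a * b < growth\<^sup>2" using b a by (simp add: field_simps power2_eq_square)
  have b1: "1 \<le> b" using b g1 by simp
  have "sqrt (a * b) < growth" using ab g1 by (intro real_less_lsqrt) auto
  then obtain a' where a': "sqrt (a * b) < a'" "a' < growth" using dense by blast
  have pos: "0 < a * b" using a b1 by simp
  have a'0: "0 < a'" using a' real_sqrt_gt_zero[OF pos] by linarith
  have sq: "a * b < a'\<^sup>2"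
  proof -
    have "sqrt (a * b) < sqrt (a'\<^sup>2)" using a' a'0 by simp
    then show ?thesis by (simp only: real_sqrt_less_iff)
  qed
  define q where "q = a * b / a'\<^sup>2"
  have q: "0 < q" "q < 1" using sq a'0 pos by (auto simp: q_def)
  obtain C where C: "1 \<le> C" "\<And>n. max_count n \<le> C * b ^ n"
    using max_count_le_power[OF b(1)] by blast
  have "(\<lambda>n. (2 * (real n * q ^ n) + 2 * q ^ n) * (C\<^sup>2 * b)) \<longlonglongrightarrow> (2 * 0 + 2 * 0) * (C\<^sup>2 * b)"
    using q by (intro tendsto_intros powser_times_n_limit_0 LIMSEQ_power_zero) auto
  then have "(\<lambda>n. (2 * (real n * q ^ n) + 2 * q ^ n) * (C\<^sup>2 * b)) \<longlonglongrightarrow> 0" by simp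
  then have "eventually (\<lambda>n. (2 * (real n * q ^ n) + 2 * q ^ n) * (C\<^sup>2 * b) < 1) sequentially"
    by (rule order_tendstoD) simp
  then obtain N0 where N0: "\<And>n. n \<ge> N0 \<Longrightarrow> (2 * (real n * q ^ n) + 2 * q ^ n) * (C\<^sup>2 * b) < 1"
    by (auto simp: eventually_sequentially)
  have key: "\<forall>w\<in>insert u A. saw_count (2 * n) w \<le> a' ^ (2 * n)"
    if n: "n \<ge> N0" "\<forall>w\<in>A. saw_count n w \<le> a ^ n" for n
  proof -
    have qa: "(a * b) ^ n = q ^ n * a' ^ (2 * n)"
      using a'0 by (simp add: q_def power_divide power_mult)
    have long: "saw_count j w \<le> a ^ n * (C * b ^ (j - n))" if "w \<in> A" "n \<le> j" for w j
    proof -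
      have "saw_count j w \<le> saw_count n w * max_count (j - n)"
        using saw_count_add[of w n "j - n"] that A by auto
      also have "\<dots> \<le> a ^ n * (C * b ^ (j - n))"
        using that n C max_count_ge_1[of "j - n"] a by (intro mult_mono) auto
      finally show ?thesis .
    qed
    have any: "saw_count j w \<le> C * b ^ j" if "w \<in> A" for w j
      using saw_count_le_max[of w j] C(2)[of j] that A by force
    have nn: "0 \<le> saw_count j w" for j w by (simp add: saw_count_def)
    \<comment> \<open>There are 2n + 1 positions of \<open>v\<close> and one term for avoiding it.
      The square of \<open>C\<close> comes from bounding both pieces of a split walk, the single
      \<open>b\<close> from the extra step of the extended walk.\<close>
    let ?B = "(2 * real n + 2) * (C\<^sup>2 * b) * (a * b) ^ n"
    have "?B = (2 * (real n * q ^ n) + 2 * q ^ n) * (C\<^sup>2 * b) * a' ^ (2 * n)"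
      unfolding qa by (simp add: algebra_simps)
    also have "\<dots> \<le> 1 * a' ^ (2 * n)" using N0[OF n(1)] a'0 by (intro mult_right_mono) auto
    finally have B: "?B \<le> a' ^ (2 * n)" by simp
    have CC: "C \<le> C\<^sup>2" using C(1) by (simp add: power2_eq_square)
    have unit: "C * (a * b) ^ n \<le> (C\<^sup>2 * b) * (a * b) ^ n"
    proof (rule mult_right_mono)
      have "C * 1 \<le> C\<^sup>2 * b" using CC C(1) b1 by (intro mult_mono) auto
      then show "C \<le> C\<^sup>2 * b" by simp
    qed (use pos in auto)
    have unit2: "C\<^sup>2 * (a * b) ^ n \<le> (C\<^sup>2 * b) * (a * b) ^ n"
      using C(1) b1 pos by (intro mult_right_mono) (auto simp: mult_le_cancel_left1)
    have "saw_count (2 * n) w \<le> ?B" if "w \<in> A" for w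
    proof -
      have "saw_count (2 * n) w \<le> C * (a * b) ^ n"
        using long[OF that, of "2 * n"] by (simp add: power_mult_distrib mult_ac)
      also have "\<dots> \<le> 1 * ((C\<^sup>2 * b) * (a * b) ^ n)" using unit by simp
      also have "\<dots> \<le> (2 * real n + 2) * ((C\<^sup>2 * b) * (a * b) ^ n)"
        using C b1 pos by (intro mult_right_mono) auto
      finally show ?thesis by (simp add: mult_ac)
    qed
    moreover have "saw_count (2 * n) u \<le> ?B"
    proof -
      have 1: "saw_count (Suc (2 * n)) v \<le> (C\<^sup>2 * b) * (a * b) ^ n"
      proof -
        have "saw_count (Suc (2 * n)) v \<le> C * b * (a * b) ^ n"
          using long[OF assms(2), of "Suc (2 * n)"]
          by (simp add: power_mult_distrib mult_ac Suc_diff_le)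
        also have "\<dots> \<le> (C\<^sup>2 * b) * (a * b) ^ n" using CC b1 pos by (intro mult_right_mono) auto
        finally show ?thesis .
      qed
      have 2: "saw_count k v * saw_count (2 * n - k) v \<le> (C\<^sup>2 * b) * (a * b) ^ n" if "k \<le> 2 * n" for k
      proof (cases "n \<le> k")
        case True
        have "saw_count k v * saw_count (2 * n - k) v \<le> (a ^ n * (C * b ^ (k - n))) * (C * b ^ (2 * n - k))"
          using long[OF assms(2) True] any[OF assms(2)] nn a b1 C by (intro mult_mono) auto
        also have "\<dots> = C\<^sup>2 * (a ^ n * b ^ ((k - n) + (2 * n - k)))"
          by (simp add: power_add power2_eq_square mult_ac)
        also have "(k - n) + (2 * n - k) = n" using True that by simp
        finally show ?thesis using unit2 by (simp add: power_mult_distrib)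
      next
        case False
        then have ge: "n \<le> 2 * n - k" by simp
        have "saw_count k v * saw_count (2 * n - k) v \<le> (C * b ^ k) * (a ^ n * (C * b ^ (2 * n - k - n)))"
          using long[OF assms(2) ge] any[OF assms(2)] nn a b1 C by (intro mult_mono) auto
        also have "\<dots> = C\<^sup>2 * (a ^ n * b ^ (k + (2 * n - k - n)))"
          by (simp add: power_add power2_eq_square mult_ac)
        also have "k + (2 * n - k - n) = n" using False by simp
        finally show ?thesis using unit2 by (simp add: power_mult_distrib)
      qed
      have "saw_count (2 * n) u \<le> saw_count (Suc (2 * n)) v +
          (\<Sum>k\<le>2 * n. saw_count k v * saw_count (2 * n - k) v)"
        by (rule saw_count_nbr[OF assms(3)])
      also have "\<dots> \<le> (C\<^sup>2 * b) * (a * b) ^ n + (\<Sum>k\<le>2 * n. (C\<^sup>2 * b) * (a * b) ^ n)"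
        using 1 2 by (intro add_mono sum_mono) auto
      also have "\<dots> = ?B" by (simp add: algebra_simps)
      finally show ?thesis .
    qed
    ultimately show ?thesis using B by fastforce
  qed
  have "\<exists>n\<ge>N. \<forall>w\<in>insert u A. saw_count n w \<le> a' ^ n" for N
  proof -
    obtain n where "n \<ge> max N N0" "\<forall>w\<in>A. saw_count n w \<le> a ^ n" using inf by blast
    then show ?thesis using key[of n] by (intro exI[of _ "2 * n"]) auto
  qed
  then show ?thesis using A adj_verts[OF simple assms(3)] a'0 a' unfolding slow_growth_def by blast
qed

text \<open>By connectedness, slow growth spreads along edges from \<open>v\<close> to any finite
  set of vertices, in particular to a whole fundamental domain, where the maximal count is at least
  \<open>growth ^ n\<close>.\<close>

lemma not_slow_growth:
  assumes v: "v \<in> verts G"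
  shows "\<not> slow_growth {v}"
proof
  assume bad: "slow_growth {v}"
  have ext: "\<exists>B. slow_growth B \<and> A \<subseteq> B \<and> w \<in> B"
    if A: "slow_growth A" "v \<in> A" and w: "w \<in> verts G" for A w
  proof -
    have "(adj G)\<^sup>*\<^sup>* v w" using connected v w by (auto simp: connected_graph_def)
    then show ?thesis
    proof (induction rule: rtranclp_induct)
      case base
      show ?case using A by blast
    next
      case (step y z)
      then obtain B where "slow_growth B" "A \<subseteq> B" "y \<in> B" by blast
      with slow_growth_insert[of B y z] step show ?case by blast
    qed
  qed
  have "\<exists>B. slow_growth B \<and> v \<in> B \<and> D \<subseteq> B" if "finite D" "D \<subseteq> verts G" for D
    using that
  proof (induction D rule: finite_induct)
    case empty
    show ?case using bad by blast
  next
    case (insert w D)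
    then obtain B where B: "slow_growth B" "v \<in> B" "D \<subseteq> B" by auto
    with ext[of B w] insert show ?case by blast
  qed
  from this[OF some_domain_props(1,3)] obtain B where B: "slow_growth B" "some_domain \<subseteq> B" by blast
  then obtain a where a: "0 < a" "a < growth"
    and "\<And>N. \<exists>n\<ge>N. \<forall>v\<in>B. saw_count n v \<le> a ^ n"
    unfolding slow_growth_def by blast
  then obtain n where n: "n \<ge> 1" "\<forall>v\<in>B. saw_count n v \<le> a ^ n" by blast
  obtain w where w: "w \<in> some_domain" "max_count n = saw_count n w" using max_count_attained by blast
  have "growth ^ n \<le> a ^ n" using growth_power_le[of n] w n B by force
  moreover have "a ^ n < growth ^ n" using a n by (intro power_strict_mono) auto
  ultimately show False by simp
qed

text \<open>The upper bound at a single vertex is Fekete's; the lower bound is the absence of slow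
  growth at that vertex.\<close>

lemma saw_count_root_tendsto:
  assumes v: "v \<in> verts G"
  shows "(\<lambda>n. root n (saw_count n v)) \<longlonglongrightarrow> growth"
proof (rule order_tendstoI)
  fix a assume a: "a < growth"
  \<comment> \<open>Slow growth asks for a positive rate; 1/2 is admissible because
    \<open>growth\<close> is at least 1.\<close>
  define a' where "a' = max a (1/2)"
  have a': "0 < a'" "a' < growth" "a \<le> a'" using a growth_ge_1 by (auto simp: a'_def)
  have "\<exists>N. \<forall>n\<ge>N. a' ^ n < saw_count n v"
  proof (rule ccontr)
    assume "\<not> ?thesis"
    then have "\<forall>N. \<exists>n\<ge>N. saw_count n v \<le> a' ^ n" by (meson not_less)
    then have "slow_growth {v}" using v a' by (auto simp: slow_growth_def)
    then show False using not_slow_growth[OF v] by simp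
  qed
  then obtain N where N: "\<And>n. n \<ge> N \<Longrightarrow> a' ^ n < saw_count n v" by auto
  show "eventually (\<lambda>n. a < root n (saw_count n v)) sequentially"
    using eventually_ge_at_top[of "max N 1"]
  proof eventually_elim
    case (elim n)
    then have n: "n > 0" "n \<ge> N" by auto
    have "a' = root n (a' ^ n)" using n a' by (simp add: real_root_power_cancel)
    also have "\<dots> < root n (saw_count n v)" using n N[OF n(2)] by simp
    finally show ?case using a' by simp
  qed
next
  fix b assume "growth < b"
  then obtain b' where b': "growth < b'" "b' < b" using dense by blast
  obtain C where C: "1 \<le> C" "\<And>n. max_count n \<le> C * b' ^ n" using max_count_le_power[OF b'(1)] by blast
  have b'0: "0 < b'" using b' growth_ge_1 by simp
  have "(\<lambda>n. root n C * b') \<longlonglongrightarrow> 1 * b'" using C by (intro tendsto_intros LIMSEQ_root_const) auto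
  then have "eventually (\<lambda>n. root n C * b' < b) sequentially"
    using b' by (intro order_tendstoD(2)) auto
  then show "eventually (\<lambda>n. root n (saw_count n v) < b) sequentially"
    using eventually_gt_at_top[of 0]
  proof eventually_elim
    case (elim n)
    have "saw_count n v \<le> C * b' ^ n" using saw_count_le_max[OF v, of n] C(2)[of n] by simp
    then have "root n (saw_count n v) \<le> root n (C * b' ^ n)" using elim by simp
    also have "\<dots> = root n C * b'" using elim b'0 by (simp add: real_root_mult real_root_power_cancel)
    finally show ?case using elim by simp
  qed
qed

lemma connective_constant_eq: "connective_constant G = growth"
  unfolding connective_constant_def
proof (rule the_equality)
  show "\<forall>v\<in>verts G. (\<lambda>n. root n (real (card (vertex_saws G n v)))) \<longlonglongrightarrow> growth"
    using saw_count_root_tendsto by (simp add: saw_count_def)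
next
  fix \<mu> assume *: "\<forall>v\<in>verts G. (\<lambda>n. root n (real (card (vertex_saws G n v)))) \<longlonglongrightarrow> \<mu>"
  obtain v where v: "v \<in> verts G" using infinite_verts by fastforce
  from LIMSEQ_unique[OF saw_count_root_tendsto[OF v]] * v show "\<mu> = growth"
    by (auto simp: saw_count_def)
qed

end

section \<open>Self-avoiding walks through the Fisher triangles\<close>

text \<open>The edge of the Fisher graph that remains from \<open>e\<close>. Written as a preimage,
  it needs no orientation of \<open>e\<close>.\<close>

definition long_edge :: "'a set \<Rightarrow> ('a \<times> 'a) set" where
  "long_edge e = {p. {fst p, snd p} = e}"

text \<open>Names a corner of the triangle at \<open>v\<close> by the edge it carries rather than by
  the neighbour, as mid-edge walks run through edges.\<close>

definition dart :: "'a \<Rightarrow> 'a set \<Rightarrow> 'a \<times> 'a" where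
  "dart v e = (v, THE u. e = {v, u})"

definition short_edge :: "'a \<Rightarrow> 'a set \<Rightarrow> 'a set \<Rightarrow> ('a \<times> 'a) set" where
  "short_edge v e f = {dart v e, dart v f}"

definition third_edge :: "'a ugraph \<Rightarrow> 'a \<Rightarrow> 'a set \<Rightarrow> 'a set \<Rightarrow> 'a set" where
  "third_edge G v e f = (THE g. g \<in> edges G \<and> v \<in> g \<and> g \<noteq> e \<and> g \<noteq> f)"

text \<open>The two ways to cross a triangle are the source of the factor \<open>x\<^sup>2 + x\<^sup>3\<close>.\<close>

definition crossing ::
  "'a ugraph \<Rightarrow> 'a set \<Rightarrow> 'a \<Rightarrow> 'a set \<Rightarrow> bool \<Rightarrow> (('a \<times> 'a) \<times> ('a \<times> 'a) set) list" where
  "crossing G e v f b =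
     (if b then let g = third_edge G v e f in
        [(dart v e, short_edge v e g), (dart v g, short_edge v g f), (dart v f, long_edge f)]
      else [(dart v e, short_edge v e f), (dart v f, long_edge f)])"

text \<open>Each visited vertex consumes one boolean, which selects the way around its triangle. The
  last equation also truncates when one list is shorter, so the results below ask for equal
  lengths.\<close>

fun lift_steps :: "'a ugraph \<Rightarrow> 'a set \<Rightarrow> ('a \<times> 'a set) list \<Rightarrow> bool list \<Rightarrow>
    (('a \<times> 'a) \<times> ('a \<times> 'a) set) list" where
  "lift_steps G e ((v, f) # s) (b # c) = crossing G e v f b @ lift_steps G f s c"
| "lift_steps G e _ _ = []"

lemma dart_eq: "dart v {v, u} = (v, u)"
  by (auto simp: dart_def doubleton_eq_iff)

lemma fst_dart [simp]: "fst (dart v e) = v"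
  by (simp add: dart_def)

lemma long_edge_eq: "long_edge {v, u} = {(v, u), (u, v)}"
  by (auto simp: long_edge_def doubleton_eq_iff)

lemma fst_short_edge [simp]: "fst ` short_edge v e f = {v}"
  by (simp add: short_edge_def)

lemma short_edge_commute: "short_edge v e f = short_edge v f e"
  by (auto simp: short_edge_def)

lemma step_saw_Cons:
  "step_saw G e ((v, f) # s) \<longleftrightarrow> e \<in> edges G \<and> v \<in> e \<and> v \<in> f \<and> e \<noteq> f \<and> e \<notin> snd ` set s \<and>
     v \<notin> fst ` set s \<and> step_saw G f s"
  by (auto simp: step_saw_def)

lemma step_saw_Nil [simp]: "step_saw G e [] \<longleftrightarrow> e \<in> edges G"
  by (simp add: step_saw_def)

lemma step_saw_append:
  "step_saw G e (s @ t) \<Longrightarrow> step_saw G e s \<and> step_saw G (walk_end e s) t"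
  by (induction s arbitrary: e) (auto simp: step_saw_Cons, auto simp: step_saw_def)

context qt_cubic_graph
begin

section \<open>Corners, long edges and short edges\<close>

lemma dart_in_long: "e \<in> edges G \<Longrightarrow> v \<in> e \<Longrightarrow> dart v e \<in> long_edge e"
  by (erule (1) edge_cases[OF simple]) (auto simp: dart_eq long_edge_eq)

lemma in_long_edge: "p \<in> long_edge e \<Longrightarrow> fst p \<in> e \<and> p = dart (fst p) e"
  by (cases p) (auto simp: long_edge_def dart_eq)

lemma dart_inj:
  assumes "e \<in> edges G" "f \<in> edges G" "v \<in> e" "w \<in> f" "dart v e = dart w f"
  shows "e = f" "v = w"
proof -
  show "v = w" using assms(5) by (metis fst_dart)
  with assms show "e = f"
    by (metis dart_eq edge_cases[OF simple] prod.inject)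
qed

text \<open>Under \<open>fst\<close> a long edge becomes an edge, whereas a triangle side becomes a
  single vertex (\<open>fst_short_edge\<close>). This tells the two kinds apart and is the
  projection by which walks are compared.\<close>

lemma fst_long_edge: "e \<in> edges G \<Longrightarrow> fst ` long_edge e = e"
  using in_long_edge dart_in_long by force

lemma long_edge_inj: "e \<in> edges G \<Longrightarrow> f \<in> edges G \<Longrightarrow> long_edge e = long_edge f \<longleftrightarrow> e = f"
  using fst_long_edge by metis

lemma card_edge: "e \<in> edges G \<Longrightarrow> card e = 2"
  using simple by (auto simp: simple_graph_def)

lemma long_neq_short [simp]:
  "e \<in> edges G \<Longrightarrow> long_edge e \<noteq> short_edge v f g"
  "e \<in> edges G \<Longrightarrow> short_edge v f g \<noteq> long_edge e"
proof -
  assume e: "e \<in> edges G"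
  show "long_edge e \<noteq> short_edge v f g"
  proof
    assume "long_edge e = short_edge v f g"
    then have "e = {v}" using fst_long_edge[OF e] fst_short_edge by metis
    then show False using card_edge[OF e] by simp
  qed
  then show "short_edge v f g \<noteq> long_edge e" by simp
qed

lemma fisher_edges:
  "edges (fisher G) = {short_edge v e f | v e f. e \<in> edges G \<and> f \<in> edges G \<and> v \<in> e \<and> v \<in> f \<and> e \<noteq> f}
     \<union> long_edge ` edges G" (is "?L = ?S \<union> ?R")
proof -
  have "?S = {{(v, u), (v, u')} | v u u'. adj G v u \<and> adj G v u' \<and> u \<noteq> u'}" (is "_ = ?T")
  proof (intro subset_antisym subsetI)
    fix x assume "x \<in> ?S"
    then obtain v e f where x: "x = short_edge v e f" "e \<in> edges G" "f \<in> edges G" "v \<in> e" "v \<in> f" "e \<noteq> f"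
      by auto
    obtain u where u: "e = {v, u}" "adj G v u" using edge_cases[OF simple x(2,4)] by metis
    obtain w where w: "f = {v, w}" "adj G v w" using edge_cases[OF simple x(3,5)] by metis
    show "x \<in> ?T" using x u w by (auto simp: short_edge_def dart_eq)
  next
    fix x assume "x \<in> ?T"
    then obtain v u w where x: "x = {(v, u), (v, w)}" "adj G v u" "adj G v w" "u \<noteq> w" by auto
    then have "x = short_edge v {v, u} {v, w}" by (simp add: short_edge_def dart_eq)
    moreover have "{v, u} \<noteq> {v, w}" using x by (auto simp: doubleton_eq_iff)
    ultimately show "x \<in> ?S" using x unfolding adj_def by blast
  qed
  moreover have "?R = {{(v, u), (u, v)} | v u. adj G v u}"
  proof (intro subset_antisym subsetI)
    fix x assume "x \<in> ?R"
    then obtain e where e: "e \<in> edges G" "x = long_edge e" by auto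
    show "x \<in> {{(v, u), (u, v)} | v u. adj G v u}"
      by (rule edge_cases'[OF simple e(1)]) (use e in \<open>auto simp: long_edge_eq\<close>)
  next
    fix x assume "x \<in> {{(v, u), (u, v)} | v u. adj G v u}"
    then show "x \<in> ?R" by (auto simp: adj_def long_edge_eq[symmetric])
  qed
  ultimately show ?thesis by (simp add: fisher_def)
qed

lemma fisher_verts_eq: "fisher_verts G W = {dart v e | v e. v \<in> W \<and> e \<in> edges G \<and> v \<in> e}"
proof (intro subset_antisym subsetI)
  fix p assume "p \<in> fisher_verts G W"
  then obtain v u where p: "p = (v, u)" "v \<in> W" "adj G v u" by (auto simp: fisher_verts_def)
  then show "p \<in> {dart v e | v e. v \<in> W \<and> e \<in> edges G \<and> v \<in> e}"
    by (intro CollectI exI[of _ v] exI[of _ "{v, u}"]) (auto simp: dart_eq adj_def)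
next
  fix p assume "p \<in> {dart v e | v e. v \<in> W \<and> e \<in> edges G \<and> v \<in> e}"
  then obtain v e where p: "p = dart v e" "v \<in> W" "e \<in> edges G" "v \<in> e" by auto
  show "p \<in> fisher_verts G W"
    by (rule edge_cases[OF simple p(3,4)]) (use p in \<open>auto simp: fisher_verts_def dart_eq\<close>)
qed

lemma verts_fisher: "verts (fisher G) = fisher_verts G (verts G)"
  by (simp add: fisher_def)

lemma edge_verts: "e \<in> edges G \<Longrightarrow> v \<in> e \<Longrightarrow> v \<in> verts G"
  using simple by (auto simp: simple_graph_def)

lemma fisher_edge_at:
  assumes "x \<in> edges (fisher G)" "dart v g \<in> x" "g \<in> edges G" "v \<in> g"
  shows "x = long_edge g \<or> (\<exists>h\<in>edges G. v \<in> h \<and> h \<noteq> g \<and> x = short_edge v g h)"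
proof -
  consider (short) w e f where "x = short_edge w e f" "e \<in> edges G" "f \<in> edges G" "w \<in> e" "w \<in> f" "e \<noteq> f"
    | (long) e where "e \<in> edges G" "x = long_edge e" using assms(1) unfolding fisher_edges by blast
  then show ?thesis
  proof cases
    case short
    from assms(2) short(1) have "dart v g = dart w e \<or> dart v g = dart w f" by (auto simp: short_edge_def)
    then show ?thesis
    proof
      assume "dart v g = dart w e"
      with dart_inj[OF assms(3) short(2) assms(4) short(4)] have "g = e" "v = w" by auto
      with short show ?thesis by blast
    next
      assume "dart v g = dart w f"
      with dart_inj[OF assms(3) short(3) assms(4) short(5)] have "g = f" "v = w" by auto
      with short show ?thesis using short_edge_commute by metis
    qed
  next
    case long
    then have "v \<in> e" "dart v g = dart v e" using in_long_edge assms(2) fst_dart by metis+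
    then show ?thesis using dart_inj(1)[OF assms(3) long(1) assms(4)] long by auto
  qed
qed

text \<open>Used to refute four distinct edges at one vertex, that is, a fourth corner of a
  triangle.\<close>

lemma edges_at_le_3:
  assumes "A \<subseteq> {e\<in>edges G. v \<in> e}"
  shows "card A \<le> 3"
proof (cases "v \<in> verts G")
  case True
  then show ?thesis using card_mono[OF finite_edges_at[OF True] assms] card_edges_at[OF True] by simp
next
  case False
  then have "A = {}" using assms edge_verts by auto
  then show ?thesis by simp
qed

lemma ex1_third_edge:
  assumes "e \<in> edges G" "f \<in> edges G" "v \<in> e" "v \<in> f" "e \<noteq> f"
  shows "\<exists>!g. g \<in> edges G \<and> v \<in> g \<and> g \<noteq> e \<and> g \<noteq> f"
proof -
  have v: "v \<in> verts G" using edge_verts assms by blast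
  have "card ({e\<in>edges G. v \<in> e} - {e, f}) = 1"
    using card_edges_at[OF v] assms by (subst card_Diff_subset) auto
  then obtain g where "{e\<in>edges G. v \<in> e} - {e, f} = {g}" by (auto simp: card_1_singleton_iff)
  then show ?thesis by (intro ex1I[of _ g]) blast+
qed

lemma third_edge:
  assumes "e \<in> edges G" "f \<in> edges G" "v \<in> e" "v \<in> f" "e \<noteq> f"
  shows "third_edge G v e f \<in> edges G" "v \<in> third_edge G v e f" "third_edge G v e f \<noteq> e"
    "third_edge G v e f \<noteq> f"
  using theI'[OF ex1_third_edge[OF assms]] unfolding third_edge_def by auto

lemma third_edge_eqI:
  assumes "e \<in> edges G" "f \<in> edges G" "v \<in> e" "v \<in> f" "e \<noteq> f"
    "g \<in> edges G" "v \<in> g" "g \<noteq> e" "g \<noteq> f"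
  shows "third_edge G v e f = g"
  using ex1_third_edge[OF assms(1-5)] assms(6-) third_edge[OF assms(1-5)] by blast

lemma short_edge_eq_iff:
  assumes "e \<in> edges G" "f \<in> edges G" "v \<in> e" "v \<in> f" "e' \<in> edges G" "f' \<in> edges G" "v \<in> e'" "v \<in> f'"
  shows "short_edge v e f = short_edge v e' f' \<longleftrightarrow> {e, f} = {e', f'}"
proof
  assume "short_edge v e f = short_edge v e' f'"
  then show "{e, f} = {e', f'}" unfolding short_edge_def doubleton_eq_iff
    using dart_inj(1) assms by metis
qed (auto simp: short_edge_def doubleton_eq_iff)

text \<open>The clauses on projections locate a crossing over \<open>v\<close>, which keeps it
  disjoint from crossings at other vertices; the clauses on visited corners and on the long edge
  serve to show that parsed walks are self-avoiding.\<close>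

lemma crossing_saw:
  assumes "e \<in> edges G" "f \<in> edges G" "v \<in> e" "v \<in> f" "e \<noteq> f"
  shows "step_saw (fisher G) (long_edge e) (crossing G e v f b)"
    "walk_end (long_edge e) (crossing G e v f b) = long_edge f"
    "length (crossing G e v f b) = (if b then 3 else 2)"
    "fst ` fst ` set (crossing G e v f b) = {v}"
    "\<And>x. x \<in> snd ` set (crossing G e v f b) \<Longrightarrow> x = long_edge f \<or> fst ` x = {v}"
    "{dart v e, dart v f} \<subseteq> fst ` set (crossing G e v f b)"
    "long_edge f \<in> snd ` set (crossing G e v f b)"
proof -
  note t = third_edge[OF assms]
  have le: "long_edge e \<in> edges (fisher G)" "long_edge f \<in> edges (fisher G)"
    using assms by (auto simp: fisher_edges)
  have se: "short_edge v x y \<in> edges (fisher G)"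
    if "x \<in> edges G" "y \<in> edges G" "v \<in> x" "v \<in> y" "x \<noteq> y" for x y
    using that unfolding fisher_edges by blast
  have d: "dart v x = dart v y \<longleftrightarrow> x = y" if "x \<in> edges G" "y \<in> edges G" "v \<in> x" "v \<in> y" for x y
    using dart_inj(1)[of x y v v] that by blast
  show "step_saw (fisher G) (long_edge e) (crossing G e v f b)"
    using assms t le se
    by (auto simp: crossing_def Let_def step_saw_Cons dart_in_long long_edge_inj d short_edge_eq_iff
        doubleton_eq_iff) (auto simp: short_edge_def)
  show "x = long_edge f \<or> fst ` x = {v}" if "x \<in> snd ` set (crossing G e v f b)" for x
    using that by (cases b) (simp add: crossing_def Let_def, metis fst_short_edge)+
qed (cases b; auto simp: crossing_def Let_def)+

text \<open>A single induction, because prefixing a crossing to a lifted tail requires knowing where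
  the tail lies. The last two conjuncts are for the converse direction: repeating an edge of the
  original walk would repeat a long edge, and each visited triangle has at least two of its corners
  occupied.\<close>

lemma lift_steps_props:
  assumes "step_saw G e s" "length c = length s"
  shows "step_saw (fisher G) (long_edge e) (lift_steps G e s c) \<and>
    walk_end (long_edge e) (lift_steps G e s c) = long_edge (walk_end e s) \<and>
    length (lift_steps G e s c) = 2 * length s + length (filter (\<lambda>b. b) c) \<and>
    fst ` fst ` set (lift_steps G e s c) = fst ` set s \<and>
    (\<forall>x \<in> snd ` set (lift_steps G e s c). x \<in> long_edge ` snd ` set s \<or> (\<exists>v\<in>fst ` set s. fst ` x = {v})) \<and>
    long_edge ` snd ` set s \<subseteq> snd ` set (lift_steps G e s c) \<and>
    (\<forall>v\<in>fst ` set s. \<exists>g h. g \<noteq> h \<and> g \<in> edges G \<and> h \<in> edges G \<and> v \<in> g \<and> v \<in> h \<and>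
       {dart v g, dart v h} \<subseteq> fst ` set (lift_steps G e s c))"
  using assms
proof (induction s arbitrary: e c)
  case Nil
  then show ?case by (auto simp: fisher_edges)
next
  case (Cons a s)
  obtain v f where a: "a = (v, f)" by (cases a)
  obtain b c' where c: "c = b # c'" "length c' = length s" using Cons.prems by (cases c) auto
  have saw: "e \<in> edges G" "v \<in> e" "v \<in> f" "e \<noteq> f" "e \<notin> snd ` set s" "v \<notin> fst ` set s" "step_saw G f s"
    using Cons.prems by (auto simp: a step_saw_Cons)
  have f: "f \<in> edges G" using saw by (auto simp: step_saw_def)
  note x = crossing_saw[OF saw(1) f saw(2,3,4), where b = b]
  note IH = Cons.IH[OF saw(7) c(2)]
  note IH1 = IH[THEN conjunct1]
  note IH2 = IH[THEN conjunct2, THEN conjunct1]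
  note IH3 = IH[THEN conjunct2, THEN conjunct2, THEN conjunct1]
  note IH4 = IH[THEN conjunct2, THEN conjunct2, THEN conjunct2, THEN conjunct1]
  note IH5 = IH[THEN conjunct2, THEN conjunct2, THEN conjunct2, THEN conjunct2, THEN conjunct1, THEN bspec]
  note IH6 = IH[THEN conjunct2, THEN conjunct2, THEN conjunct2, THEN conjunct2, THEN conjunct2, THEN conjunct1]
  note IH7 = IH[THEN conjunct2, THEN conjunct2, THEN conjunct2, THEN conjunct2, THEN conjunct2, THEN conjunct2, THEN bspec]
  have sE: "snd ` set s \<subseteq> edges G" using saw(7) step_walk_edges[of G f s] by (simp add: step_saw_def)
  have fs: "f \<notin> snd ` set s" using saw(7) by (auto simp: step_saw_def)
  have nl: "fst ` long_edge g \<noteq> {w}" if "g \<in> edges G" for g w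
    using fst_long_edge[OF that] card_edge[OF that] by auto
  let ?X = "crossing G e v f b" and ?Y = "lift_steps G f s c'"
  have disj1: "set (map fst ?X) \<inter> set (map fst ?Y) = {}"
  proof -
    have "fst ` fst ` set ?X \<inter> fst ` fst ` set ?Y = {}" using x(4) IH4 saw(6) by simp
    then show ?thesis by auto
  qed
  \<comment> \<open>Long edges of the tail come from edges other than \<open>e\<close> and
    \<open>f\<close>, and its triangle sides lie over vertices other than \<open>v\<close>.\<close>
  have disj2: "y \<notin> snd ` set ?Y" if "y \<in> insert (long_edge e) (snd ` set ?X)" for y
  proof
    assume y: "y \<in> snd ` set ?Y"
    from IH5[OF y] show False
    proof
      assume "y \<in> long_edge ` snd ` set s"
      then obtain g where g: "g \<in> snd ` set s" "y = long_edge g" by blast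
      have gE: "g \<in> edges G" using g sE by blast
      have "y = long_edge e \<or> y = long_edge f" using that x(5)[of y] nl[OF gE] g(2) by blast
      then show False using g gE saw(1,5) f fs long_edge_inj by metis
    next
      assume "\<exists>w\<in>fst ` set s. fst ` y = {w}"
      then obtain w where w: "w \<in> fst ` set s" "fst ` y = {w}" by blast
      have "fst ` y = {v}" using that x(5)[of y] nl[OF saw(1)] nl[OF f] w(2) by blast
      then show False using w saw(6) by auto
    qed
  qed
  have r1: "step_saw (fisher G) (long_edge e) (?X @ ?Y)"
  proof -
    have "(insert (long_edge e) (snd ` set ?X)) \<inter> snd ` set ?Y = {}" using disj2 by blast
    then show ?thesis using x(1) IH1 x(2) disj1 unfolding step_saw_def by simp
  qed
  have r7: "\<exists>g h. g \<noteq> h \<and> g \<in> edges G \<and> h \<in> edges G \<and> w \<in> g \<and> w \<in> h \<and>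
       {dart w g, dart w h} \<subseteq> fst ` set (?X @ ?Y)" if "w \<in> insert v (fst ` set s)" for w
  proof (cases "w = v")
    case True
    show ?thesis unfolding True
      by (intro exI[of _ e] exI[of _ f]) (use saw f x(6) in auto)
  next
    case False
    then show ?thesis using IH7[of w] that by auto
  qed
  have r5: "y \<in> long_edge ` snd ` set (a # s) \<or> (\<exists>v\<in>fst ` set (a # s). fst ` y = {v})"
    if "y \<in> snd ` set (?X @ ?Y)" for y
    using that x(5)[of y] IH5[of y] by (auto simp: a)
  have r2: "walk_end (long_edge e) (?X @ ?Y) = long_edge (walk_end e (a # s))"
    using x(2) IH2 by (simp add: a)
  have r3: "length (?X @ ?Y) = 2 * length (a # s) + length (filter (\<lambda>b. b) c)"
    using x(3) IH3 by (simp add: c)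
  have r4: "fst ` fst ` set (?X @ ?Y) = fst ` set (a # s)"
    using x(4) IH4 by (simp add: a image_Un)
  have r6: "long_edge ` snd ` set (a # s) \<subseteq> snd ` set (?X @ ?Y)"
    unfolding a set_append image_Un list.set image_insert snd_conv using x(7) IH6 by blast
  have l: "lift_steps G e (a # s) c = ?X @ ?Y" by (simp add: a c)
  have i: "fst ` set (a # s) = insert v (fst ` set s)" by (simp add: a)
  show ?case unfolding l
  proof (intro conjI ballI)
    show "step_saw (fisher G) (long_edge e) (?X @ ?Y)" by (rule r1)
    show "\<exists>g h. g \<noteq> h \<and> g \<in> edges G \<and> h \<in> edges G \<and> w \<in> g \<and> w \<in> h \<and>
       {dart w g, dart w h} \<subseteq> fst ` set (?X @ ?Y)" if "w \<in> fst ` set (a # s)" for w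
      using that unfolding i by (rule r7)
  qed (rule r2 r3 r4 r5 r6; assumption?)+
qed

lemmas lift_steps_saw = lift_steps_props[THEN conjunct1]
  and walk_end_lift_steps = lift_steps_props[THEN conjunct2, THEN conjunct1]
  and length_lift_steps = lift_steps_props[THEN conjunct2, THEN conjunct2, THEN conjunct1]
  and lift_steps_long = lift_steps_props[THEN conjunct2, THEN conjunct2, THEN conjunct2, THEN conjunct2,
    THEN conjunct2, THEN conjunct1]
  and lift_steps_darts = lift_steps_props[THEN conjunct2, THEN conjunct2, THEN conjunct2, THEN conjunct2,
    THEN conjunct2, THEN conjunct2, THEN bspec]

text \<open>The lift is decoded from the left: the first corner names the vertex, the position of
  the first long edge gives the boolean, and that long edge gives the next mid-edge.\<close>

lemma lift_steps_inj:
  assumes "step_saw G e s" "step_saw G e s'" "length c = length s" "length c' = length s'"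
    "lift_steps G e s c = lift_steps G e s' c'"
  shows "s = s' \<and> c = c'"
  using assms
proof (induction s arbitrary: e c s' c')
  case Nil
  then have "length (lift_steps G e s' c') = 0" by auto
  then show ?case using Nil length_lift_steps[OF Nil(2,4)] by auto
next
  case (Cons a s)
  obtain v f where a: "a = (v, f)" by (cases a)
  obtain b d where c: "c = b # d" "length d = length s" using Cons.prems by (cases c) auto
  have saw: "e \<in> edges G" "v \<in> e" "v \<in> f" "e \<noteq> f" "step_saw G f s"
    using Cons.prems by (auto simp: a step_saw_Cons)
  have f: "f \<in> edges G" using saw by (auto simp: step_saw_def)
  have "length (lift_steps G e (a # s) c) > 0"
    using length_lift_steps[OF Cons.prems(1,3)] by auto
  then have "s' \<noteq> []" using Cons.prems by auto
  then obtain a' t' where s': "s' = a' # t'" by (cases s') auto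
  obtain v' f' where a': "a' = (v', f')" by (cases a')
  obtain b' d' where c': "c' = b' # d'" "length d' = length t'" using Cons.prems s' by (cases c') auto
  have saw': "v' \<in> e" "v' \<in> f'" "e \<noteq> f'" "step_saw G f' t'"
    using Cons.prems by (auto simp: a' s' step_saw_Cons)
  have f': "f' \<in> edges G" using saw' by (auto simp: step_saw_def)
  have eq: "crossing G e v f b @ lift_steps G f s d = crossing G e v' f' b' @ lift_steps G f' t' d'"
    using Cons.prems(5) by (simp add: a c a' c' s')
  have "dart v e = dart v' e"
    using eq by (auto simp: crossing_def Let_def split: if_splits)
  then have v: "v' = v" by (metis fst_dart)
  have "b = b' \<and> long_edge f = long_edge f'"
    using eq f f' unfolding v by (cases b; cases b') (auto simp: crossing_def Let_def)
  then have fb: "f' = f" "b' = b" using long_edge_inj f f' by auto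
  with eq v have "lift_steps G f s d = lift_steps G f t' d'" by simp
  from Cons.IH[OF saw(5) _ c(2) c'(2) this] saw' fb have "s = t'" "d = d'" by auto
  then show ?case using v fb by (simp add: a a' s' c c')
qed

text \<open>If \<open>e\<close> recurred on the parsed walk, its long edge would recur on the Fisher
  walk. If \<open>v\<close> recurred, the later visit would use two corners of the triangle at
  \<open>v\<close> besides those of \<open>e\<close> and \<open>f\<close>, but a triangle has only
  three.\<close>

lemma parse_crossing:
  assumes saw: "step_saw (fisher G) (long_edge e) (crossing G e v f b @ r)"
    and e: "e \<in> edges G" "f \<in> edges G" "v \<in> e" "v \<in> f" "e \<noteq> f"
    and s: "step_saw G f s" "length c = length s" "r = lift_steps G f s c @ fin"
  shows "step_saw G e ((v, f) # s)"
proof -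
  let ?X = "crossing G e v f b"
  have d: "distinct (long_edge e # map snd (?X @ r))" "distinct (map fst (?X @ r))"
    using saw unfolding step_saw_def by auto
  have "e \<notin> snd ` set s"
  proof
    assume "e \<in> snd ` set s"
    then have "long_edge e \<in> long_edge ` snd ` set s" by blast
    then have "long_edge e \<in> snd ` set (lift_steps G f s c)" using lift_steps_long[OF s(1,2)] by blast
    then have "long_edge e \<in> snd ` set r" unfolding s(3) by auto
    then show False using d(1) by auto
  qed
  moreover have "v \<notin> fst ` set s"
  proof
    assume "v \<in> fst ` set s"
    from lift_steps_darts[OF s(1,2) this] obtain g h where gh: "g \<noteq> h" "g \<in> edges G" "h \<in> edges G" "v \<in> g" "v \<in> h"
      "{dart v g, dart v h} \<subseteq> fst ` set (lift_steps G f s c)" by blast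
    have sub: "{dart v g, dart v h} \<subseteq> fst ` set r" using gh(6) unfolding s(3) by auto
    have "{dart v e, dart v f} \<subseteq> fst ` set ?X" using crossing_saw(6)[OF e] by simp
    moreover have "fst ` set ?X \<inter> fst ` set r = {}" using d(2) by auto
    ultimately have "dart v e \<noteq> dart v g" "dart v e \<noteq> dart v h" "dart v f \<noteq> dart v g" "dart v f \<noteq> dart v h"
      using sub by blast+
    then have "e \<noteq> g" "e \<noteq> h" "f \<noteq> g" "f \<noteq> h" by blast+
    then have "card {e, f, g, h} = 4" using gh(1) e(5) by simp
    moreover have "card {e, f, g, h} \<le> 3" using e gh by (intro edges_at_le_3[of _ v]) auto
    ultimately show False by simp
  qed
  ultimately show ?thesis using e s(1) by (simp add: step_saw_Cons)
qed

text \<open>From a long edge the walk enters a triangle and either leaves it by a long edge after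
  two or three corners, which is a crossing, or ends inside it, which gives \<open>fin\<close>. The
  inclusion of the projected end decides later where the walk on the original graph ends.\<close>

lemma parse_long:
  assumes "step_saw (fisher G) (long_edge e) t" "e \<in> edges G"
  shows "\<exists>s c fin. t = lift_steps G e s c @ fin \<and> step_saw G e s \<and> length c = length s \<and>
    length fin \<le> 3 \<and> fst ` walk_end (long_edge e) t \<subseteq> walk_end e s"
  using assms
proof (induction "length t" arbitrary: e t rule: less_induct)
  case less
  note saw = less.prems(1) and e = less.prems(2)
  have stop: ?case if "length t \<le> 3" "fst ` walk_end (long_edge e) t \<subseteq> e"
    by (intro exI[of _ "[]"] exI[of _ t]) (use that e in auto)
  have step: ?case
    if t: "t = crossing G e v f b @ r" and f: "f \<in> edges G" "v \<in> e" "v \<in> f" "e \<noteq> f" for v f b r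
  proof -
    note x = crossing_saw[OF e f, where b = b]
    have "step_saw (fisher G) (long_edge f) r" using step_saw_append[OF saw[unfolded t]] x(2) by simp
    moreover have "length r < length t" using t x(3) by simp
    ultimately obtain s c fin where s: "r = lift_steps G f s c @ fin" "step_saw G f s" "length c = length s"
      "length fin \<le> 3" "fst ` walk_end (long_edge f) r \<subseteq> walk_end f s" using less.hyps[of r f] f by blast
    have "step_saw G e ((v, f) # s)"
      by (rule parse_crossing[OF saw[unfolded t] e f s(2,3,1)])
    then show ?case
      by (intro exI[of _ "(v, f) # s"] exI[of _ "b # c"] exI[of _ fin]) (use s t x(2) in auto)
  qed
  show ?case
  proof (cases t)
    case Nil
    then show ?thesis using stop fst_long_edge[OF e] by simp
  next
    case (Cons a1 t1)
    obtain p1 x1 where a1: "a1 = (p1, x1)" by (cases a1)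
    have s1: "p1 \<in> long_edge e" "p1 \<in> x1" "x1 \<in> edges (fisher G)" "x1 \<noteq> long_edge e"
      "p1 \<notin> fst ` set t1" "step_saw (fisher G) x1 t1"
      using saw unfolding Cons a1 step_saw_Cons by (auto simp: step_saw_def)
    define v where "v = fst p1"
    have v: "v \<in> e" "p1 = dart v e" using in_long_edge[OF s1(1)] by (auto simp: v_def)
    obtain g where g: "g \<in> edges G" "v \<in> g" "g \<noteq> e" "x1 = short_edge v e g"
      using fisher_edge_at[OF s1(3) _ e v(1)] s1(2,4) v(2) by blast
    show ?thesis
    proof (cases t1)
      case Nil
      then show ?thesis using stop Cons a1 g v by simp
    next
      case Cons2: (Cons a2 t2)
      obtain p2 x2 where a2: "a2 = (p2, x2)" by (cases a2)
      have s2: "p2 \<in> x1" "p2 \<in> x2" "x2 \<in> edges (fisher G)" "x2 \<noteq> x1" "p2 \<noteq> p1" "p1 \<notin> fst ` set t2"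
        "p2 \<notin> fst ` set t2" "step_saw (fisher G) x2 t2"
        using s1(5,6) unfolding Cons2 a2 step_saw_Cons by (auto simp: step_saw_def)
      have p2: "p2 = dart v g" using s2(1,5) g(4) v(2) by (auto simp: short_edge_def)
      have "x2 = long_edge g \<or> (\<exists>h\<in>edges G. v \<in> h \<and> h \<noteq> g \<and> x2 = short_edge v g h)"
        using fisher_edge_at[OF s2(3) _ g(1,2)] s2(2) p2 by blast
      then show ?thesis
      proof
        assume "x2 = long_edge g"
        then have "t = crossing G e v g False @ t2"
          by (simp add: crossing_def Cons a1 Cons2 a2 v p2 g)
        then show ?thesis by (rule step) (use g v in auto)
      next
        assume "\<exists>h\<in>edges G. v \<in> h \<and> h \<noteq> g \<and> x2 = short_edge v g h"
        then obtain h where h: "h \<in> edges G" "v \<in> h" "h \<noteq> g" "x2 = short_edge v g h" by auto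
        have he: "h \<noteq> e" using s2(4) h(4) g(4) short_edge_commute by metis
        show ?thesis
        proof (cases t2)
          case Nil
          then show ?thesis using stop Cons Cons2 a1 a2 h v by simp
        next
          case Cons3: (Cons a3 t3)
          obtain p3 x3 where a3: "a3 = (p3, x3)" by (cases a3)
          have s3: "p3 \<in> x2" "p3 \<in> x3" "x3 \<in> edges (fisher G)" "x3 \<noteq> x2" "p3 \<noteq> p2" "p1 \<notin> fst ` set t3"
            "p3 \<notin> fst ` set t3" "step_saw (fisher G) x3 t3"
            using s2(6-8) unfolding Cons3 a3 step_saw_Cons by (auto simp: step_saw_def)
          have p3: "p3 = dart v h" using s3(1,5) h(4) p2 by (auto simp: short_edge_def)
          have "x3 = long_edge h \<or> (\<exists>k\<in>edges G. v \<in> k \<and> k \<noteq> h \<and> x3 = short_edge v h k)"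
            using fisher_edge_at[OF s3(3) _ h(1,2)] s3(2) p3 by blast
          then show ?thesis
          proof
            assume x3: "x3 = long_edge h"
            have "third_edge G v e h = g"
              by (rule third_edge_eqI) (use e v h g he in auto)
            then have "t = crossing G e v h True @ t3"
              by (simp add: crossing_def Cons a1 Cons2 a2 Cons3 a3 v p2 g h p3 x3)
            then show ?thesis by (rule step) (use h v he in auto)
          next
            assume "\<exists>k\<in>edges G. v \<in> k \<and> k \<noteq> h \<and> x3 = short_edge v h k"
            then obtain k where k: "k \<in> edges G" "v \<in> k" "k \<noteq> h" "x3 = short_edge v h k" by auto
            have kg: "k \<noteq> g" using s3(4) k(4) h(4) short_edge_commute by metis
            \<comment> \<open>After three corners the only triangle side left returns to the first
              corner. Both of its corners are then used, so the walk can only stop on it.\<close>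
            have ke: "k = e"
            proof (rule ccontr)
              assume "k \<noteq> e"
              then have "card {e, g, h, k} = 4" using g(3) h(3) he k(3) kg by auto
              moreover have "card {e, g, h, k} \<le> 3"
                using e v(1) g h k by (intro edges_at_le_3[of _ v]) auto
              ultimately show False by simp
            qed
            have "t3 = []"
            proof (rule ccontr)
              assume "t3 \<noteq> []"
              then obtain p4 x4 t4 where t3: "t3 = (p4, x4) # t4" by (cases t3) auto
              have "p4 \<in> x3" using s3(8) unfolding t3 step_saw_Cons by simp
              then have "p4 = p3 \<or> p4 = p1" using k(4) ke v p3 by (auto simp: short_edge_def)
              then show False using s3(6,7) t3 by auto
            qed
            then show ?thesis using stop Cons Cons2 Cons3 a1 a2 a3 k v by simp
          qed
        qed
      qed
    qed
  qed
qed

text \<open>\<open>ini\<close> runs up to the first arrival on a long edge, or to the end if there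
  is none. All its corners belong to the triangle at \<open>v\<close>, so a self-avoiding walk has
  at most three of them.\<close>

lemma parse_short:
  assumes "step_walk (fisher G) x t" "fst ` x = {v}"
  shows "\<exists>ini r. t = ini @ r \<and> (\<forall>p\<in>fst ` set ini. fst p = v \<and> p \<in> verts (fisher G)) \<and>
     ((r = [] \<and> fst ` walk_end x t = {v}) \<or> (\<exists>e\<in>edges G. v \<in> e \<and> walk_end x ini = long_edge e))"
  using assms
proof (induction t arbitrary: x)
  case Nil
  then show ?case by simp
next
  case (Cons a t)
  obtain p y where a: "a = (p, y)" by (cases a)
  have p: "p \<in> x" "p \<in> y" "y \<in> edges (fisher G)" "step_walk (fisher G) y t" using Cons.prems a by auto
  have fp: "fst p = v" using p(1) Cons.prems(2) by auto
  have pv: "p \<in> verts (fisher G)"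
  proof -
    from p(3) consider (short) w e f where "y = short_edge w e f" "e \<in> edges G" "f \<in> edges G" "w \<in> e" "w \<in> f"
      | (long) e where "e \<in> edges G" "y = long_edge e" unfolding fisher_edges by blast
    then show ?thesis
    proof cases
      case short
      then have "p = dart w e \<or> p = dart w f" using p(2) by (auto simp: short_edge_def)
      then show ?thesis using short edge_verts unfolding verts_fisher fisher_verts_eq by blast
    next
      case long
      then show ?thesis using in_long_edge[of p e] p(2) edge_verts unfolding verts_fisher fisher_verts_eq by blast
    qed
  qed
  from p(3) consider (short) w e f where "y = short_edge w e f" | (long) e where "e \<in> edges G" "y = long_edge e"
    unfolding fisher_edges by blast
  then show ?case
  proof cases
    case short
    then have "fst ` y = {w}" by simp
    moreover from this have "w = v" using imageI[OF p(2), of fst] fp by simp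
    ultimately have "fst ` y = {v}" by simp
    from Cons.IH[OF p(4) this] obtain ini r where "t = ini @ r" "\<forall>p\<in>fst ` set ini. fst p = v \<and> p \<in> verts (fisher G)"
      "(r = [] \<and> fst ` walk_end y t = {v}) \<or> (\<exists>e\<in>edges G. v \<in> e \<and> walk_end y ini = long_edge e)" by blast
    then show ?thesis by (intro exI[of _ "a # ini"] exI[of _ r]) (auto simp: a fp pv)
  next
    case long
    then have "v \<in> e" using in_long_edge[of p e] p(2) fp by auto
    then show ?thesis by (intro exI[of _ "[a]"] exI[of _ t]) (use long fp pv a in auto)
  qed
qed

text \<open>The first alternative is a walk that never meets a long edge and so stays in one
  triangle. Otherwise the stretch from the first long edge on is parsed, and both projected ends are
  retained in order to control incidence with the domains.\<close>

lemma parse_fisher_saw: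
  assumes "step_saw (fisher G) x t"
  shows "(length t \<le> 3 \<and> (\<exists>v. fst ` x = {v} \<and> fst ` walk_end x t = {v})) \<or>
    (\<exists>ini e s c fin. t = ini @ lift_steps G e s c @ fin \<and> walk_end x ini = long_edge e \<and> step_saw G e s \<and>
       length c = length s \<and> length ini \<le> 3 \<and> length fin \<le> 3 \<and> fst ` x \<subseteq> e \<and>
       fst ` walk_end x t \<subseteq> walk_end e s)"
proof -
  have x: "x \<in> edges (fisher G)" "step_walk (fisher G) x t" "distinct (map fst t)"
    using assms by (auto simp: step_saw_def)
  from x(1) consider (short) v e f where "x = short_edge v e f" | (long) e where "e \<in> edges G" "x = long_edge e"
    unfolding fisher_edges by blast
  then show ?thesis
  proof cases
    case long
    from parse_long[OF assms[unfolded long(2)] long(1)] obtain s c fin where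
      "t = lift_steps G e s c @ fin" "step_saw G e s" "length c = length s"
      "length fin \<le> 3" "fst ` walk_end (long_edge e) t \<subseteq> walk_end e s" by blast
    then show ?thesis using long fst_long_edge[OF long(1)]
      by (intro disjI2 exI[of _ "[]"] exI[of _ e] exI[of _ s] exI[of _ c] exI[of _ fin]) auto
  next
    case short
    have fx: "fst ` x = {v}" using short by simp
    from parse_short[OF x(2) fx] obtain ini r where ir: "t = ini @ r"
      "\<forall>p\<in>fst ` set ini. fst p = v \<and> p \<in> verts (fisher G)"
      "(r = [] \<and> fst ` walk_end x t = {v}) \<or> (\<exists>e\<in>edges G. v \<in> e \<and> walk_end x ini = long_edge e)" by blast
    have "fst ` set ini \<subseteq> dart v ` {e\<in>edges G. v \<in> e}"
      using ir(2) unfolding verts_fisher fisher_verts_eq by fastforce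
    moreover have fin: "finite {e\<in>edges G. v \<in> e}"
    proof (cases "v \<in> verts G")
      case False
      then have "{e\<in>edges G. v \<in> e} = {}" using edge_verts by blast
      then show ?thesis by (simp only: finite.emptyI)
    qed (rule finite_edges_at)
    ultimately have "card (fst ` set ini) \<le> card {e\<in>edges G. v \<in> e}"
      by (meson card_image_le card_mono finite_imageI le_trans)
    also have "\<dots> \<le> 3" by (rule edges_at_le_3) auto
    finally have "card (set (map fst ini)) \<le> 3" by simp
    then have len: "length ini \<le> 3" using x(3) ir(1) by (subst (asm) distinct_card) auto
    from ir(3) show ?thesis
    proof
      assume "r = [] \<and> fst ` walk_end x t = {v}"
      moreover from this have "t = ini" using ir(1) by simp
      ultimately show ?thesis using len fx by blast
    next
      assume "\<exists>e\<in>edges G. v \<in> e \<and> walk_end x ini = long_edge e"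
      then obtain e where e: "e \<in> edges G" "v \<in> e" "walk_end x ini = long_edge e" by auto
      have "step_saw (fisher G) (long_edge e) r" using step_saw_append[of _ x ini r] assms ir(1) e(3) by simp
      from parse_long[OF this e(1)] obtain s c fin where
        "r = lift_steps G e s c @ fin" "step_saw G e s" "length c = length s"
        "length fin \<le> 3" "fst ` walk_end (long_edge e) r \<subseteq> walk_end e s" by blast
      then show ?thesis using e ir fx len
        by (intro disjI2 exI[of _ ini] exI[of _ e] exI[of _ s] exI[of _ c] exI[of _ fin]) auto
    qed
  qed
qed

end

section \<open>Graph distances\<close>

lemma relpowp_automorphism:
  assumes "simple_graph G" "automorphism G \<alpha>"
  shows "(adj G ^^ n) u v \<Longrightarrow> (adj G ^^ n) (\<alpha> u) (\<alpha> v)"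
proof (induction n arbitrary: v)
  case (Suc n)
  then obtain w where w: "(adj G ^^ n) u w" "adj G w v" by auto
  then have "adj G (\<alpha> w) (\<alpha> v)" using assms(2) adj_verts[OF assms(1) w(2)] by (simp add: automorphism_def)
  then show ?case using Suc.IH[OF w(1)] by auto
qed simp

lemma set_graph_dist_le:
  assumes "u \<in> A" "v \<in> B" "(adj G ^^ n) u v"
  shows "set_graph_dist G A B \<le> n"
proof -
  have "set_graph_dist G A B \<le> (\<lambda>(u, v). graph_dist G u v) (u, v)"
    unfolding set_graph_dist_def by (rule cINF_lower) (use assms in auto)
  also have "\<dots> = graph_dist G u v" by simp
  also have "\<dots> \<le> n" unfolding graph_dist_def using assms(3) by (rule Least_le)
  finally show ?thesis .
qed

text \<open>Connectedness guarantees that each \<open>graph_dist\<close> is the length of an actual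
  path rather than a \<open>LEAST\<close> over an empty set.\<close>

lemma set_graph_dist_attained:
  assumes "connected_graph G" "A \<noteq> {}" "B \<noteq> {}" "A \<subseteq> verts G" "B \<subseteq> verts G"
  obtains u v where "u \<in> A" "v \<in> B" "(adj G ^^ set_graph_dist G A B) u v"
proof -
  have "set_graph_dist G A B \<in> (\<lambda>(u, v). graph_dist G u v) ` (A \<times> B)"
    unfolding set_graph_dist_def using assms by (intro Inf_nat_def1) auto
  then obtain u v where uv: "u \<in> A" "v \<in> B" "set_graph_dist G A B = graph_dist G u v" by auto
  have "(adj G)\<^sup>*\<^sup>* u v" using assms uv by (auto simp: connected_graph_def)
  then have "\<exists>n. (adj G ^^ n) u v" by (simp add: rtranclp_power)
  then have "(adj G ^^ graph_dist G u v) u v" unfolding graph_dist_def by (rule LeastI_ex)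
  then show ?thesis using uv that by simp
qed

context qt_cubic_graph
begin

lemma finite_ball: "v \<in> verts G \<Longrightarrow> finite {u. (adj G ^^ n) v u}"
proof (induction n)
  case (Suc n)
  have "{u. (adj G ^^ Suc n) v u} \<subseteq> (\<Union>w\<in>{w. (adj G ^^ n) v w \<and> w \<in> verts G}. {u. adj G w u})"
    using adj_verts[OF simple] by auto
  moreover have "finite \<dots>" using Suc finite_nbrs by auto
  ultimately show ?case by (rule finite_subset)
qed simp

text \<open>Without far translates the condition defining \<eta> would be vacuous and \<eta> not
  unique. A vertex far from \<open>W\<close> is carried into \<open>W\<close> by an automorphism,
  whose inverse moves \<open>W\<close> next to that vertex.\<close>

lemma ex_far_automorphism:
  assumes W: "fundamental_domain G W"
  shows "\<exists>\<alpha>. automorphism G \<alpha> \<and> k \<le> set_graph_dist G W (\<alpha> ` W)"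
proof -
  have Wp: "finite W" "W \<subseteq> verts G" "W \<noteq> {}"
    using W fundamental_domain_nonempty by (auto simp: fundamental_domain_def)
  have "\<exists>n. (adj G ^^ n) u v" if "u \<in> W" "v \<in> W" for u v
    using connected that Wp by (auto simp: connected_graph_def rtranclp_power subset_iff)
  then have gd: "(adj G ^^ graph_dist G u v) u v" if "u \<in> W" "v \<in> W" for u v
    unfolding graph_dist_def using that by (metis (mono_tags, lifting) LeastI_ex)
  define D where "D = Max ((\<lambda>(u, v). graph_dist G u v) ` (W \<times> W))"
  have D: "graph_dist G u v \<le> D" if "u \<in> W" "v \<in> W" for u v
  proof -
    have "graph_dist G u v \<in> (\<lambda>(u, v). graph_dist G u v) ` (W \<times> W)" using that by force
    then show ?thesis unfolding D_def using Wp by (intro Max_ge) auto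
  qed
  \<comment> \<open>Points of the translate are within \<open>D\<close> of \<open>v\<close>, so a
    vertex \<open>v\<close> outside the balls of radius \<open>k + D\<close> leaves distance greater
    than \<open>k\<close>.\<close>
  have "finite (\<Union>w\<in>W. \<Union>n\<le>k + D. {u. (adj G ^^ n) w u})"
    using Wp finite_ball by blast
  then obtain v where v: "v \<in> verts G" "v \<notin> (\<Union>w\<in>W. \<Union>n\<le>k + D. {u. (adj G ^^ n) w u})"
    using infinite_verts by (meson finite_subset subsetI)
  obtain \<beta> where \<beta>: "automorphism G \<beta>" "\<beta> v \<in> W" using W v(1) by (auto simp: fundamental_domain_def)
  define \<alpha> where "\<alpha> = inv_into (verts G) \<beta>"
  have \<alpha>: "automorphism G \<alpha>" unfolding \<alpha>_def by (rule automorphism_inv[OF \<beta>(1)])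
  have \<alpha>v: "\<alpha> (\<beta> v) = v" unfolding \<alpha>_def using \<beta>(1) v(1)
    by (intro inv_into_f_f) (auto simp: automorphism_def bij_betw_def)
  have aW: "\<alpha> ` W \<subseteq> verts G" using \<alpha> Wp(2) by (auto simp: automorphism_def bij_betw_def)
  obtain w y where wy: "w \<in> W" "y \<in> \<alpha> ` W" "(adj G ^^ set_graph_dist G W (\<alpha> ` W)) w y"
    by (rule set_graph_dist_attained[OF connected Wp(3) _ Wp(2) aW]) (use Wp in auto)
  obtain w' where w': "w' \<in> W" "y = \<alpha> w'" using wy by auto
  have "k \<le> set_graph_dist G W (\<alpha> ` W)"
  proof (rule ccontr)
    assume c: "\<not> ?thesis"
    have "(adj G ^^ graph_dist G w' (\<beta> v)) y v"
      using relpowp_automorphism[OF simple \<alpha> gd[OF w'(1) \<beta>(2)]] \<alpha>v w' by simp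
    with wy(3) have "(adj G ^^ (set_graph_dist G W (\<alpha> ` W) + graph_dist G w' (\<beta> v))) w v"
      unfolding relpowp_add by blast
    moreover have "set_graph_dist G W (\<alpha> ` W) + graph_dist G w' (\<beta> v) \<le> k + D"
      using c D[OF w'(1) \<beta>(2)] by simp
    ultimately show False using v(2) wy(1) by blast
  qed
  with \<alpha> show ?thesis by blast
qed

end

section \<open>The Fisher graph\<close>

lemma adj_fisher:
  "adj (fisher G) (v, u) (v', u') \<longleftrightarrow>
     (v = v' \<and> u \<noteq> u' \<and> adj G v u \<and> adj G v u') \<or> (v' = u \<and> u' = v \<and> adj G v u)"
proof -
  have "adj (fisher G) (v, u) (v', u') \<longleftrightarrow>
      (\<exists>x a b. {(v, u), (v', u')} = {(x, a), (x, b)} \<and> adj G x a \<and> adj G x b \<and> a \<noteq> b) \<or>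
      (\<exists>x a. {(v, u), (v', u')} = {(x, a), (a, x)} \<and> adj G x a)"
    unfolding adj_def[of "fisher G"] by (auto simp: fisher_def)
  also have "\<dots> \<longleftrightarrow> (v = v' \<and> u \<noteq> u' \<and> adj G v u \<and> adj G v u') \<or> (v' = u \<and> u' = v \<and> adj G v u)"
    unfolding doubleton_eq_iff prod.inject using adj_commute[of G] by blast
  finally show ?thesis .
qed

lemma fisher_verts_iff: "(v, u) \<in> fisher_verts G W \<longleftrightarrow> v \<in> W \<and> adj G v u"
  by (simp add: fisher_verts_def)

lemma automorphism_fisher:
  assumes "simple_graph G" "automorphism G \<alpha>"
  shows "automorphism (fisher G) (map_prod \<alpha> \<alpha>)"
proof -
  have a: "\<And>u v. adj G u v \<Longrightarrow> adj G (\<alpha> u) (\<alpha> v)"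
    using assms adj_verts[OF assms(1)] by (auto simp: automorphism_def)
  have inj: "inj_on \<alpha> (verts G)" and im: "\<alpha> ` verts G = verts G"
    using assms by (auto simp: automorphism_def bij_betw_def)
  have ia: "\<alpha> u = \<alpha> v \<longleftrightarrow> u = v" if "u \<in> verts G" "v \<in> verts G" for u v
    using inj that by (auto simp: inj_on_def)
  have ad: "adj G (\<alpha> u) (\<alpha> v) \<longleftrightarrow> adj G u v" if "u \<in> verts G" "v \<in> verts G" for u v
    using assms that by (auto simp: automorphism_def)
  have V: "verts (fisher G) = {(v, u). adj G v u}"
    using adj_verts[OF assms(1)] by (auto simp: fisher_def fisher_verts_def)
  show ?thesis unfolding automorphism_def bij_betw_def V
  proof (intro conjI ballI)
    show "inj_on (map_prod \<alpha> \<alpha>) {(v, u). adj G v u}"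
      using ia adj_verts[OF assms(1)] by (auto simp: inj_on_def)
    show "map_prod \<alpha> \<alpha> ` {(v, u). adj G v u} = {(v, u). adj G v u}"
    proof (intro subset_antisym subsetI)
      fix p assume "p \<in> {(v, u). adj G v u}"
      then obtain v u where p: "p = (v, u)" "adj G v u" by auto
      then obtain v' u' where "v = \<alpha> v'" "u = \<alpha> u'" "v' \<in> verts G" "u' \<in> verts G"
        using im adj_verts[OF assms(1) p(2)] by (metis imageE)
      then have "p = map_prod \<alpha> \<alpha> (v', u')" "adj G v' u'" using p ad by auto
      then show "p \<in> map_prod \<alpha> \<alpha> ` {(v, u). adj G v u}" by blast
    qed (use a in auto)
    fix p q assume "p \<in> {(v, u). adj G v u}" "q \<in> {(v, u). adj G v u}"
    then obtain v u v' u' where pq: "p = (v, u)" "adj G v u" "q = (v', u')" "adj G v' u'" by auto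
    note [simp] = adj_verts[OF assms(1) pq(2)] adj_verts[OF assms(1) pq(4)]
    show "adj (fisher G) (map_prod \<alpha> \<alpha> p) (map_prod \<alpha> \<alpha> q) \<longleftrightarrow> adj (fisher G) p q"
      by (simp add: pq adj_fisher ia ad)
  qed
qed

lemma fisher_verts_image:
  assumes "simple_graph G" "automorphism G \<alpha>" "W \<subseteq> verts G"
  shows "map_prod \<alpha> \<alpha> ` fisher_verts G W = fisher_verts G (\<alpha> ` W)"
proof (intro subset_antisym subsetI)
  fix p assume "p \<in> map_prod \<alpha> \<alpha> ` fisher_verts G W"
  then show "p \<in> fisher_verts G (\<alpha> ` W)"
    using assms(2) adj_verts[OF assms(1)] by (auto simp: fisher_verts_def automorphism_def)
next
  fix p assume "p \<in> fisher_verts G (\<alpha> ` W)"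
  then obtain v u where p: "p = (\<alpha> v, u)" "v \<in> W" "adj G (\<alpha> v) u" by (auto simp: fisher_verts_def)
  have "u \<in> \<alpha> ` verts G" using adj_verts[OF assms(1) p(3)] assms(2)
    by (simp add: automorphism_def bij_betw_def)
  then obtain u' where u: "u' \<in> verts G" "u = \<alpha> u'" by auto
  then have "adj G v u'" using p assms by (auto simp: automorphism_def subset_iff)
  then have "(v, u') \<in> fisher_verts G W" using p by (simp add: fisher_verts_def)
  then show "p \<in> map_prod \<alpha> \<alpha> ` fisher_verts G W" using p u by force
qed

context qt_cubic_graph
begin

section \<open>Quasi-transitivity, connectedness and degree of the Fisher graph\<close>

lemma fundamental_domain_fisher:
  assumes "fundamental_domain G W"
  shows "fundamental_domain (fisher G) (fisher_verts G W)"
proof -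
  have W: "finite W" "W \<subseteq> verts G" using assms by (auto simp: fundamental_domain_def)
  have "fisher_verts G W = Sigma W (\<lambda>v. {u. adj G v u})" by (auto simp: fisher_verts_def)
  then have "finite (fisher_verts G W)" using W finite_nbrs by auto
  moreover have "fisher_verts G W \<subseteq> verts (fisher G)" using W by (auto simp: verts_fisher fisher_verts_def)
  moreover have "\<exists>\<beta>. automorphism (fisher G) \<beta> \<and> \<beta> p \<in> fisher_verts G W" if pv: "p \<in> verts (fisher G)" for p
  proof -
    obtain v u where p: "p = (v, u)" "v \<in> verts G" "adj G v u"
      using pv by (auto simp: verts_fisher fisher_verts_def)
    obtain \<alpha> where \<alpha>: "automorphism G \<alpha>" "\<alpha> v \<in> W" using assms p by (auto simp: fundamental_domain_def)
    have "adj G (\<alpha> v) (\<alpha> u)" using \<alpha> p adj_verts[OF simple p(3)] by (simp add: automorphism_def)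
    then show ?thesis using automorphism_fisher[OF simple \<alpha>(1)] \<alpha> p
      by (intro exI[of _ "map_prod \<alpha> \<alpha>"]) (auto simp: fisher_verts_def)
  qed
  ultimately show ?thesis by (simp add: fundamental_domain_def)
qed

lemma simple_fisher: "simple_graph (fisher G)"
  unfolding simple_graph_def
proof
  fix x assume "x \<in> edges (fisher G)"
  then consider (short) v u u' where "x = {(v, u), (v, u')}" "adj G v u" "adj G v u'" "u \<noteq> u'"
    | (long) v u where "x = {(v, u), (u, v)}" "adj G v u" by (auto simp: fisher_def)
  then show "x \<subseteq> verts (fisher G) \<and> card x = 2"
  proof cases
    case short
    then show ?thesis using adj_verts[OF simple] by (auto simp: verts_fisher fisher_verts_iff)
  next
    case long
    then show ?thesis using adj_verts[OF simple long(2)] adj_commute[of G u v]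
      by (auto simp: verts_fisher fisher_verts_iff)
  qed
qed

lemma ex_nbr: "v \<in> verts G \<Longrightarrow> \<exists>u. adj G v u"
proof -
  assume v: "v \<in> verts G"
  then have "{e\<in>edges G. v \<in> e} \<noteq> {}" using card_edges_at[OF v] by (metis card.empty zero_neq_numeral)
  then obtain e where "e \<in> edges G" "v \<in> e" by auto
  then show ?thesis using edge_cases[OF simple] by metis
qed

lemma infinite_fisher: "infinite (verts (fisher G))"
proof
  assume "finite (verts (fisher G))"
  then have "finite (fst ` verts (fisher G))" by simp
  moreover have "verts G \<subseteq> fst ` verts (fisher G)"
    using ex_nbr by (force simp: verts_fisher fisher_verts_def)
  ultimately show False using infinite_verts finite_subset by blast
qed

lemma connected_fisher: "connected_graph (fisher G)"
proof -
  have tri: "(adj (fisher G))\<^sup>*\<^sup>* (v, u) (v, u')" if "adj G v u" "adj G v u'" for v u u'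
    using that by (cases "u = u'") (auto simp: adj_fisher intro: r_into_rtranclp)
  have "(adj (fisher G))\<^sup>*\<^sup>* (v, u) (w, z)" if vu: "adj G v u" and path: "(adj G)\<^sup>*\<^sup>* v w" and wz: "adj G w z"
    for v u w z
    using path wz
  proof (induction arbitrary: z rule: rtranclp_induct)
    case base
    then show ?case using tri vu by blast
  next
    case (step y x)
    have "(adj (fisher G))\<^sup>*\<^sup>* (v, u) (y, x)" using step by blast
    also have "adj (fisher G) (y, x) (x, y)" using step by (simp add: adj_fisher)
    also have "(adj (fisher G))\<^sup>*\<^sup>* (x, y) (x, z)"
      using step tri adj_commute[of G x y] by blast
    finally show ?case .
  qed
  then show ?thesis using connected
    by (auto simp: connected_graph_def verts_fisher fisher_verts_iff)
qed

lemma cubic_fisher: "cubic (fisher G)"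
  unfolding cubic_def
proof
  fix p assume "p \<in> verts (fisher G)"
  then obtain v e where p: "p = dart v e" "v \<in> verts G" "e \<in> edges G" "v \<in> e"
    unfolding verts_fisher fisher_verts_eq by auto
  let ?R = "{f\<in>edges G. v \<in> f} - {e}"
  have "{x\<in>edges (fisher G). p \<in> x} = insert (long_edge e) (short_edge v e ` ?R)"
  proof (intro subset_antisym subsetI)
    fix x assume "x \<in> {x\<in>edges (fisher G). p \<in> x}"
    then show "x \<in> insert (long_edge e) (short_edge v e ` ?R)"
      using fisher_edge_at[of x v e] p by auto
  next
    fix x assume "x \<in> insert (long_edge e) (short_edge v e ` ?R)"
    then consider "x = long_edge e" | f where "f \<in> ?R" "x = short_edge v e f" by blast
    then show "x \<in> {x\<in>edges (fisher G). p \<in> x}"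
    proof cases
      case 1
      then show ?thesis using p dart_in_long by (auto simp: fisher_edges)
    next
      case 2
      then have "x \<in> edges (fisher G)" using p unfolding fisher_edges by blast
      then show ?thesis using 2 p by (auto simp: short_edge_def)
    qed
  qed
  moreover have "inj_on (short_edge v e) ?R"
    using p short_edge_eq_iff[of e _ v e] by (auto simp: inj_on_def doubleton_eq_iff)
  then have "card (short_edge v e ` ?R) = 2"
    using card_edges_at[OF p(2)] p by (simp add: card_image)
  moreover have "long_edge e \<notin> short_edge v e ` ?R" using p by auto
  moreover have "finite (short_edge v e ` ?R)" using finite_edges_at[OF p(2)] by simp
  ultimately show "card {x\<in>edges (fisher G). p \<in> x} = 3" by simp
qed

lemma qt_cubic_fisher: "qt_cubic_graph (fisher G)"
proof
  show "quasi_transitive (fisher G)"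
    using quasi_transitive fundamental_domain_fisher unfolding quasi_transitive_def by blast
qed (rule simple_fisher infinite_fisher connected_fisher cubic_fisher)+

section \<open>Incident edges and distances on the two graphs\<close>

lemma incident_edges_fisher:
  "incident_edges (fisher G) (fisher_verts G W) = {x\<in>edges (fisher G). fst ` x \<inter> W \<noteq> {}}"
proof -
  have "p \<in> fisher_verts G W \<longleftrightarrow> fst p \<in> W" if "x \<in> edges (fisher G)" "p \<in> x" for x p
  proof -
    have "p \<in> verts (fisher G)" using that simple_fisher by (auto simp: simple_graph_def)
    then show ?thesis by (cases p) (auto simp: verts_fisher fisher_verts_def)
  qed
  then show ?thesis unfolding incident_edges_def by blast
qed

lemma long_edge_incident:
  "e \<in> edges G \<Longrightarrow> long_edge e \<in> incident_edges (fisher G) (fisher_verts G W) \<longleftrightarrow> e \<in> incident_edges G W"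
  unfolding incident_edges_fisher by (simp add: fst_long_edge fisher_edges incident_edges_def)

text \<open>A step onto a triangle side projects to a step from the current mid-edge back to itself,
  which a walk may take; this is why no length is lost or gained.\<close>

lemma project_walk:
  assumes "step_walk (fisher G) x t" "e \<in> edges G" "fst ` x \<subseteq> e"
  shows "\<exists>s. step_walk G e s \<and> length s = length t \<and> fst ` walk_end x t \<subseteq> walk_end e s"
  using assms
proof (induction t arbitrary: x e)
  case Nil
  then show ?case by (intro exI[of _ "[]"]) auto
next
  case (Cons a t)
  obtain p y where a: "a = (p, y)" by (cases a)
  have p: "p \<in> x" "p \<in> y" "y \<in> edges (fisher G)" "step_walk (fisher G) y t" using Cons.prems a by auto
  have pe: "fst p \<in> e" using p(1) Cons.prems(3) by auto
  have "\<exists>f\<in>edges G. fst p \<in> f \<and> fst ` y \<subseteq> f"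
  proof -
    from p(3) consider (short) w g h where "y = short_edge w g h" | (long) f where "f \<in> edges G" "y = long_edge f"
      unfolding fisher_edges by blast
    then show ?thesis
    proof cases
      case short
      then have "fst ` y = {w}" by simp
      then have "fst ` y \<subseteq> e" using imageI[OF p(2), of fst] pe by simp
      then show ?thesis using pe Cons.prems(2) by blast
    next
      case long
      then show ?thesis using fst_long_edge[OF long(1)] imageI[OF p(2), of fst] by auto
    qed
  qed
  then obtain f where f: "f \<in> edges G" "fst p \<in> f" "fst ` y \<subseteq> f" by blast
  from Cons.IH[OF p(4) f(1,3)] obtain s where "step_walk G f s" "length s = length t"
    "fst ` walk_end y t \<subseteq> walk_end f s" by blast
  then show ?case using f pe a by (intro exI[of _ "(fst p, f) # s"]) auto
qed

text \<open>The projection of a shortest walk ends on a mid-edge containing \<open>f\<close>; both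
  have two elements, so they agree.\<close>

lemma mid_dist_fisher_ge:
  assumes "e \<in> edges G" "f \<in> edges G" "step_walk (fisher G) (long_edge e) t" "walk_end (long_edge e) t = long_edge f"
  shows "mid_dist G e f \<le> mid_dist (fisher G) (long_edge e) (long_edge f)"
proof -
  have le: "long_edge e \<in> edges (fisher G)" using assms(1) by (auto simp: fisher_edges)
  obtain t' where t': "step_walk (fisher G) (long_edge e) t'" "walk_end (long_edge e) t' = long_edge f"
    "length t' = mid_dist (fisher G) (long_edge e) (long_edge f)"
    by (rule mid_dist_walk[OF le assms(3,4)])
  from project_walk[OF t'(1) assms(1)] obtain s where s: "step_walk G e s" "length s = length t'"
    "fst ` walk_end (long_edge e) t' \<subseteq> walk_end e s" using fst_long_edge[OF assms(1)] by auto
  have "f \<subseteq> walk_end e s" using s(3) t'(2) fst_long_edge[OF assms(2)] by simp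
  moreover have "card (walk_end e s) = 2" "card f = 2"
    using walk_end_edges[OF s(1) assms(1)] assms(2) card_edge by auto
  ultimately have "f = walk_end e s" by (intro card_subset_eq) (auto intro: card_ge_0_finite)
  then show ?thesis using mid_dist_le[OF assms(1) s(1)] s(2) t'(3) by auto
qed

text \<open>A step that returns to its own mid-edge is dropped, any other is lifted to the short
  crossing.\<close>

lemma lift_walk:
  assumes "step_walk G e s" "e \<in> edges G"
  shows "\<exists>t. step_walk (fisher G) (long_edge e) t \<and> walk_end (long_edge e) t = long_edge (walk_end e s) \<and>
    length t \<le> 2 * length s"
  using assms
proof (induction s arbitrary: e)
  case Nil
  then show ?case by (intro exI[of _ "[]"]) auto
next
  case (Cons a s)
  obtain v f where a: "a = (v, f)" by (cases a)
  have f: "v \<in> e" "v \<in> f" "f \<in> edges G" "step_walk G f s" using Cons.prems a by auto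
  from Cons.IH[OF f(4,3)] obtain t where t: "step_walk (fisher G) (long_edge f) t"
    "walk_end (long_edge f) t = long_edge (walk_end f s)" "length t \<le> 2 * length s" by blast
  show ?case
  proof (cases "e = f")
    case True
    then show ?thesis using t a by (intro exI[of _ t]) auto
  next
    case False
    note x = crossing_saw[OF Cons.prems(2) f(3,1,2) False, where b = False]
    have "step_walk (fisher G) (long_edge e) (crossing G e v f False)" using x(1) by (simp add: step_saw_def)
    then show ?thesis using t a x(2,3) by (intro exI[of _ "crossing G e v f False @ t"]) auto
  qed
qed

text \<open>Keep the two ends of the walk and replace its core by the lift of a shortest walk; the
  ends contribute the 6.\<close>

lemma mid_dist_fisher_le:
  assumes t: "step_saw (fisher G) x (ini @ lift_steps G e s c @ fin)"
    and e: "walk_end x ini = long_edge e" "step_saw G e s" "length c = length s"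
    and len: "length ini \<le> 3" "length fin \<le> 3"
  shows "mid_dist (fisher G) x (walk_end x (ini @ lift_steps G e s c @ fin))
    \<le> 6 + 2 * mid_dist G e (walk_end e s)"
proof -
  have eE: "e \<in> edges G" "step_walk G e s" using e(2) by (auto simp: step_saw_def)
  obtain s' where s': "step_walk G e s'" "walk_end e s' = walk_end e s" "length s' = mid_dist G e (walk_end e s)"
    by (rule mid_dist_walk[OF eE refl])
  obtain t' where t': "step_walk (fisher G) (long_edge e) t'" "walk_end (long_edge e) t' = long_edge (walk_end e s)"
    "length t' \<le> 2 * mid_dist G e (walk_end e s)" using lift_walk[OF s'(1) eE(1)] s' by auto
  have w: "x \<in> edges (fisher G)" "step_walk (fisher G) x ini"
    "step_walk (fisher G) (long_edge (walk_end e s)) fin"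
    using t e walk_end_lift_steps[OF e(2,3)] by (auto simp: step_saw_def)
  have "mid_dist (fisher G) x (walk_end x (ini @ lift_steps G e s c @ fin)) \<le> length (ini @ t' @ fin)"
    using w t' e walk_end_lift_steps[OF e(2,3)] by (intro mid_dist_le) auto
  then show ?thesis using t'(3) len by simp
qed

lemma relpowp_project:
  "(adj (fisher G) ^^ n) p q \<Longrightarrow> \<exists>k\<le>n. (adj G ^^ k) (fst p) (fst q)"
proof (induction n arbitrary: q)
  case (Suc n)
  then obtain r where r: "(adj (fisher G) ^^ n) p r" "adj (fisher G) r q" by auto
  from Suc.IH[OF r(1)] obtain k where k: "k \<le> n" "(adj G ^^ k) (fst p) (fst r)" by blast
  obtain v u v' u' where rq: "r = (v, u)" "q = (v', u')" by (cases r, cases q)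
  from r(2) have "v = v' \<or> adj G v v'" unfolding rq adj_fisher by auto
  then show ?case
  proof
    assume "v = v'"
    then show ?thesis using k rq by (intro exI[of _ k]) auto
  next
    assume "adj G v v'"
    then show ?thesis using k rq by (intro exI[of _ "Suc k"]) auto
  qed
qed auto

text \<open>A path of n + 1 edges lifts to n + 1 long edges with at most one triangle side at each
  of the n inner vertices. The terminal corners are left open because the sets compared contain
  whole triangles.\<close>

lemma relpowp_lift:
  "(adj G ^^ Suc n) v w \<Longrightarrow>
     \<exists>k\<le>2 * n + 1. \<exists>u z. adj G v u \<and> adj G w z \<and> (adj (fisher G) ^^ k) (v, u) (w, z)"
proof (induction n arbitrary: w)
  case 0
  then have "adj G v w" by auto
  then have "adj G w v" "(adj (fisher G) ^^ 1) (v, w) (w, v)"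
    unfolding relpowp_1 adj_fisher using adj_commute[of G] by auto
  then show ?case using \<open>adj G v w\<close> by (intro exI[of _ 1] conjI exI[of _ w] exI[of _ v]) simp_all
next
  case (Suc n)
  then obtain y where y: "(adj G ^^ Suc n) v y" "adj G y w" by auto
  from Suc.IH[OF y(1)] obtain k u z where k: "k \<le> 2 * n + 1" "adj G v u" "adj G y z"
    "(adj (fisher G) ^^ k) (v, u) (y, z)" by blast
  have last: "adj (fisher G) (y, w) (w, y)" using y by (simp add: adj_fisher)
  show ?case
  proof (cases "z = w")
    case True
    then have "(adj (fisher G) ^^ Suc k) (v, u) (w, y)" using k(4) last by auto
    then show ?thesis using k y adj_commute[of G w y]
      by (intro exI[of _ "Suc k"] conjI exI[of _ u] exI[of _ y]) auto
  next
    case False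
    then have "adj (fisher G) (y, z) (y, w)" using k y by (simp add: adj_fisher)
    then have "(adj (fisher G) ^^ Suc (Suc k)) (v, u) (w, y)" using k(4) last by auto
    then show ?thesis using k y adj_commute[of G w y]
      by (intro exI[of _ "Suc (Suc k)"] conjI exI[of _ u] exI[of _ y]) auto
  qed
qed

lemma set_graph_dist_fisher:
  assumes "A \<noteq> {}" "B \<noteq> {}" "A \<subseteq> verts G" "B \<subseteq> verts G"
  shows "set_graph_dist G A B \<le> set_graph_dist (fisher G) (fisher_verts G A) (fisher_verts G B)"
    and "1 \<le> set_graph_dist G A B \<Longrightarrow>
      set_graph_dist (fisher G) (fisher_verts G A) (fisher_verts G B) \<le> 2 * set_graph_dist G A B"
proof -
  have ne: "fisher_verts G C \<noteq> {}" "fisher_verts G C \<subseteq> verts (fisher G)" if "C \<noteq> {}" "C \<subseteq> verts G" for C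
    using that ex_nbr by (auto simp: verts_fisher fisher_verts_def)
  obtain p q where pq: "p \<in> fisher_verts G A" "q \<in> fisher_verts G B"
    "(adj (fisher G) ^^ set_graph_dist (fisher G) (fisher_verts G A) (fisher_verts G B)) p q"
    by (rule set_graph_dist_attained[OF connected_fisher ne(1)[OF assms(1,3)] ne(1)[OF assms(2,4)]
          ne(2)[OF assms(1,3)] ne(2)[OF assms(2,4)]])
  from relpowp_project[OF pq(3)] obtain k where
    k: "k \<le> set_graph_dist (fisher G) (fisher_verts G A) (fisher_verts G B)" "(adj G ^^ k) (fst p) (fst q)" by blast
  have "set_graph_dist G A B \<le> k"
    by (rule set_graph_dist_le[OF _ _ k(2)]) (use pq in \<open>auto simp: fisher_verts_def\<close>)
  with k show "set_graph_dist G A B \<le> set_graph_dist (fisher G) (fisher_verts G A) (fisher_verts G B)" by simp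
next
  assume d: "1 \<le> set_graph_dist G A B"
  obtain v w where vw: "v \<in> A" "w \<in> B" "(adj G ^^ set_graph_dist G A B) v w"
    by (rule set_graph_dist_attained[OF connected assms])
  obtain n where n: "set_graph_dist G A B = Suc n" using d by (cases "set_graph_dist G A B") auto
  obtain k u z where k: "k \<le> 2 * n + 1" "adj G v u" "adj G w z" "(adj (fisher G) ^^ k) (v, u) (w, z)"
    using relpowp_lift[OF vw(3)[unfolded n]] by blast
  have "set_graph_dist (fisher G) (fisher_verts G A) (fisher_verts G B) \<le> k"
    by (rule set_graph_dist_le[OF _ _ k(4)]) (use k vw in \<open>auto simp: fisher_verts_def\<close>)
  then show "set_graph_dist (fisher G) (fisher_verts G A) (fisher_verts G B) \<le> 2 * set_graph_dist G A B"
    using k(1) n by simp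
qed

end

section \<open>Slowly varying functions\<close>

text \<open>The uniform convergence theorem in additive form. If the oscillation of \<open>h\<close> over
  \<open>[U k, U k + s k]\<close> exceeds 1, then for every \<open>s\<close> one of the increments of \<open>h\<close> from \<open>U k\<close> and
  from \<open>U k + s k\<close> to \<open>U k + s\<close> exceeds 1/2, whereas both are small in mean.\<close>

lemma additive_slow_variation_bounded:
  fixes h :: "real \<Rightarrow> real"
  assumes [measurable]: "h \<in> borel_measurable borel"
    and lim: "\<And>s. ((\<lambda>u. h (u + s) - h u) \<longlongrightarrow> 0) at_top" and A: "0 < A"
  shows "\<exists>X. \<forall>u\<ge>X. \<forall>s\<in>{0..A}. \<bar>h (u + s) - h u\<bar> \<le> 1"
proof (rule ccontr)
  assume "\<not> ?thesis"
  then have "\<forall>k::nat. \<exists>u s. u \<ge> real k \<and> s \<in> {0..A} \<and> 1 < \<bar>h (u + s) - h u\<bar>"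
    by (meson not_le)
  then obtain U S where US: "\<And>k. U k \<ge> real k" "\<And>k. S k \<in> {0..A}" "\<And>k. 1 < \<bar>h (U k + S k) - h (U k)\<bar>"
    by metis
  \<comment> \<open>Truncation at 1 provides the integrable majorant for dominated convergence along
    any sequence tending to infinity.\<close>
  have conv: "(\<lambda>k. LINT s|lborel. indicator {0..2 * A} s * min 1 \<bar>h (V k + s) - h (V k)\<bar>) \<longlonglongrightarrow> 0 \<and>
      (\<forall>k. integrable lborel (\<lambda>s. indicator {0..2 * A} s * min 1 \<bar>h (V k + s) - h (V k)\<bar>))"
    if V: "\<And>k. V k \<ge> real k" for V :: "nat \<Rightarrow> real"
  proof -
    have Vt: "filterlim V at_top sequentially"
      by (rule filterlim_at_top_mono[OF filterlim_real_sequentially]) (use V in auto)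
    have pt: "(\<lambda>k. indicator {0..2 * A} s * min 1 \<bar>h (V k + s) - h (V k)\<bar>) \<longlonglongrightarrow> 0" for s
    proof -
      have "(\<lambda>k. h (V k + s) - h (V k)) \<longlonglongrightarrow> 0" by (rule filterlim_compose[OF lim Vt])
      then have "(\<lambda>k. indicator {0..2 * A} s * min 1 \<bar>h (V k + s) - h (V k)\<bar>) \<longlonglongrightarrow>
          indicator {0..2 * A} s * min 1 \<bar>0\<bar>" by (intro tendsto_intros)
      then show ?thesis by simp
    qed
    have w: "integrable lborel (indicator {0..2 * A} :: real \<Rightarrow> real)"
      by (intro integrable_real_indicator) (auto simp: emeasure_lborel_Icc_eq)
    have bd: "norm (indicator {0..2 * A} s * min 1 \<bar>h (V k + s) - h (V k)\<bar>) \<le> indicator {0..2 * A} s"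
      for s k by (auto simp: indicator_def)
    have "(\<lambda>k. LINT s|lborel. indicator {0..2 * A} s * min 1 \<bar>h (V k + s) - h (V k)\<bar>) \<longlonglongrightarrow>
        (LINT s|(lborel :: real measure). 0)"
      by (rule integral_dominated_convergence[where w = "indicator {0..2 * A}"]) (use pt bd w in auto)
    moreover have "integrable lborel (\<lambda>s. indicator {0..2 * A} s * min 1 \<bar>h (V k + s) - h (V k)\<bar>)" for k
      by (rule Bochner_Integration.integrable_bound[OF w]) (use bd in auto)
    ultimately show ?thesis by simp
  qed
  define f where "f k s = indicator {0..2 * A} s * min 1 \<bar>h (U k + s) - h (U k)\<bar>" for k s
  define g where "g k s = indicator {0..2 * A} s * min 1 \<bar>h (U k + S k + s) - h (U k + S k)\<bar>" for k s
  have f: "(\<lambda>k. LINT s|lborel. f k s) \<longlonglongrightarrow> 0" "\<And>k. integrable lborel (f k)"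
    using conv[of U] US(1) unfolding f_def by auto
  have "U k + S k \<ge> real k" for k using US(1,2)[of k] by auto
  then have g: "(\<lambda>k. LINT s|lborel. g k s) \<longlonglongrightarrow> 0" "\<And>k. integrable lborel (g k)"
    using conv[of "\<lambda>k. U k + S k"] unfolding g_def by auto
  \<comment> \<open>For s in [A, 2A] both s and s - S k lie in [0, 2A]. The two increments have
    total size more than 1, which survives truncation, and shifting the second integral by S k does
    not change it.\<close>
  have "A \<le> (LINT s|lborel. f k s) + (LINT s|lborel. g k s)" for k
  proof -
    have gi: "integrable lborel (\<lambda>s. g k (- S k + 1 * s))"
      by (rule lborel_integrable_real_affine[OF g(2)]) simp
    have "A = (LINT s|lborel. indicator {A..2 * A} s)" using A by simp
    also have "\<dots> \<le> (LINT s|lborel. f k s + g k (- S k + 1 * s))"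
    proof (rule integral_mono)
      show "integrable lborel (indicator {A..2 * A} :: real \<Rightarrow> real)" using A by simp
      show "integrable lborel (\<lambda>s. f k s + g k (- S k + 1 * s))" using f(2) gi by auto
      fix s :: real
      show "indicator {A..2 * A} s \<le> f k s + g k (- S k + 1 * s)"
      proof (cases "s \<in> {A..2 * A}")
        case True
        then have "s \<in> {0..2 * A}" "- S k + s \<in> {0..2 * A}" using US(2)[of k] A by auto
        then have "f k s + g k (- S k + 1 * s) =
            min 1 \<bar>h (U k + s) - h (U k)\<bar> + min 1 \<bar>h (U k + s) - h (U k + S k)\<bar>"
          by (simp add: f_def g_def)
        moreover have "1 < \<bar>h (U k + s) - h (U k)\<bar> + \<bar>h (U k + s) - h (U k + S k)\<bar>"
          using US(3)[of k] by linarith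
        ultimately show ?thesis using True by (simp add: min_def)
      next
        case False
        then show ?thesis by (simp add: f_def g_def)
      qed
    qed
    also have "\<dots> = (LINT s|lborel. f k s) + (LINT s|lborel. g k (- S k + 1 * s))"
      using f(2) gi by (intro Bochner_Integration.integral_add) auto
    also have "(LINT s|lborel. g k (- S k + 1 * s)) = (LINT s|lborel. g k s)"
      using lborel_integral_real_affine[of 1 "g k" "- S k"] by simp
    finally show ?thesis .
  qed
  moreover have "(\<lambda>k. (LINT s|lborel. f k s) + (LINT s|lborel. g k s)) \<longlonglongrightarrow> 0 + 0"
    using f(1) g(1) by (rule tendsto_add)
  ultimately have "A \<le> 0 + 0" by (intro LIMSEQ_le_const) auto
  then show False using A by simp
qed

lemma slowly_varying_bounded:
  assumes L: "slowly_varying L" and T: "1 < T"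
  shows "\<exists>X>0. \<forall>x\<ge>X. \<forall>t\<in>{1..T}. L (t * x) \<le> exp 1 * L x \<and> L x \<le> exp 1 * L (t * x)"
proof -
  obtain a where pos: "\<And>x. x \<ge> a \<Longrightarrow> L x > 0"
    and meas: "(\<lambda>x. indicator {a..} x *\<^sub>R L x) \<in> borel_measurable borel"
    using L unfolding slowly_varying_def set_borel_measurable_def by blast
  have lim: "((\<lambda>x. L (t * x) / L x) \<longlongrightarrow> 1) at_top" if "t > 0" for t
    using L that by (auto simp: slowly_varying_def)
  \<comment> \<open>Passing to exponentials turns ratios into differences. \<open>L\<close> is
    measurable only on a half-line, so the indicator makes \<open>h\<close> measurable everywhere;
    its values are used only where \<open>exp u\<close> is at least \<open>a\<close>.\<close>
  define h where "h u = ln (indicator {a..} (exp u) *\<^sub>R L (exp u))" for u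
  have "(\<lambda>u. indicator {a..} (exp u) *\<^sub>R L (exp u)) \<in> borel_measurable borel"
    by (rule measurable_compose[OF _ meas]) simp
  then have hm: "h \<in> borel_measurable borel" unfolding h_def by (rule borel_measurable_ln)
  have h: "h u = ln (L (exp u))" if "exp u \<ge> a" for u using that by (simp add: h_def)
  have exp_ge: "exp u \<ge> a" if "u \<ge> a" for u using that exp_ge_add_one_self[of u] by linarith
  have hl: "((\<lambda>u. h (u + s) - h u) \<longlongrightarrow> 0) at_top" for s
  proof -
    have "((\<lambda>u. L (exp s * exp u) / L (exp u)) \<longlongrightarrow> 1) at_top"
      by (rule filterlim_compose[OF lim exp_at_top]) simp
    then have "((\<lambda>u. ln (L (exp s * exp u) / L (exp u))) \<longlongrightarrow> ln 1) at_top"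
      by (intro tendsto_ln) auto
    moreover have "eventually (\<lambda>u. ln (L (exp s * exp u) / L (exp u)) = h (u + s) - h u) at_top"
      using eventually_ge_at_top[of "max a (a - s)"]
    proof eventually_elim
      case (elim u)
      have 1: "exp u \<ge> a" "exp (u + s) \<ge> a" using elim by (auto intro!: exp_ge)
      then show ?case using pos[OF 1(1)] pos[OF 1(2)]
        by (simp add: h exp_add mult.commute ln_div)
    qed
    ultimately show ?thesis by (simp add: tendsto_cong)
  qed
  have "0 < ln T" using T by simp
  from additive_slow_variation_bounded[OF hm hl this] obtain X where
    X: "\<And>u s. u \<ge> X \<Longrightarrow> s \<in> {0..ln T} \<Longrightarrow> \<bar>h (u + s) - h u\<bar> \<le> 1" by blast
  define Y where "Y = max (exp X) (max a 1)"
  have "L (t * x) \<le> exp 1 * L x \<and> L x \<le> exp 1 * L (t * x)" if x: "x \<ge> Y" and t: "t \<in> {1..T}" for x t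
  proof -
    have x0: "x > 0" "x \<ge> a" "x \<ge> exp X" "x \<ge> 1" using x by (auto simp: Y_def)
    have tx: "t * x \<ge> x" using t x0 by simp
    have atx: "a \<le> t * x" using x0 tx by linarith
    have p: "L x > 0" "L (t * x) > 0" using pos[of x] pos[of "t * x"] x0 tx by linarith+
    have "ln x \<ge> X" using x0 by (simp add: ln_ge_iff)
    moreover have "ln t \<in> {0..ln T}" using t by auto
    ultimately have "\<bar>h (ln x + ln t) - h (ln x)\<bar> \<le> 1" by (rule X)
    moreover have "h (ln x) = ln (L x)" using h[of "ln x"] x0 by simp
    moreover have "h (ln x + ln t) = ln (L (t * x))"
      using h[of "ln x + ln t"] x0 t atx by (simp add: exp_add mult.commute)
    ultimately have "ln (L (t * x)) \<le> 1 + ln (L x)" "ln (L x) \<le> 1 + ln (L (t * x))" by auto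
    then have "exp (ln (L (t * x))) \<le> exp (1 + ln (L x))" "exp (ln (L x)) \<le> exp (1 + ln (L (t * x)))"
      by simp_all
    then show ?thesis using p by (simp add: exp_add)
  qed
  moreover have "Y > 0" by (simp add: Y_def)
  ultimately show ?thesis by blast
qed

text \<open>Slow variation is asymptotic, while short walks need a bound too: large \<open>n\<close>
  come from \<open>slowly_varying_bounded\<close>, and the finitely many remaining ratios are summed
  into \<open>K\<close>.\<close>

lemma slowly_varying_nat_bounded:
  assumes L: "slowly_varying L" and pos: "\<And>n::nat. n \<ge> 1 \<Longrightarrow> L (real n) > 0"
  shows "\<exists>K>0. \<forall>n m::nat. 1 \<le> n \<longrightarrow> n \<le> m \<longrightarrow> m \<le> 9 * n \<longrightarrow>
    L (real m) \<le> K * L (real n) \<and> L (real n) \<le> K * L (real m)"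
proof -
  obtain X where X: "X > 0"
    "\<And>x t. x \<ge> X \<Longrightarrow> t \<in> {1..9} \<Longrightarrow> L (t * x) \<le> exp 1 * L x \<and> L x \<le> exp 1 * L (t * x)"
    using slowly_varying_bounded[OF L, of 9] by auto
  obtain N where N: "X \<le> real N" using real_arch_simple by blast
  \<comment> \<open>If \<open>n\<close> is below \<open>N\<close>, then \<open>m\<close>, being at
    most \<open>9 * n\<close>, stays below this bound.\<close>
  define M where "M = 9 * N"
  define K where "K = exp 1 + (\<Sum>i\<in>{1..M}. \<Sum>j\<in>{1..M}. L (real i) / L (real j))"
  have nn: "0 \<le> (\<Sum>j\<in>{1..M}. L (real i) / L (real j))" if "i \<ge> 1" for i
    using pos that by (intro sum_nonneg) (auto intro: divide_nonneg_nonneg less_imp_le)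
  have Ke: "exp 1 \<le> K" unfolding K_def using sum_nonneg[OF nn, of "{1..M}"] by simp
  have K: "L (real i) / L (real j) \<le> K" if "i \<in> {1..M}" "j \<in> {1..M}" for i j
  proof -
    have "L (real i) / L (real j) \<le> (\<Sum>j\<in>{1..M}. L (real i) / L (real j))"
      using that pos by (intro member_le_sum) (auto intro: divide_nonneg_nonneg less_imp_le)
    also have "\<dots> \<le> (\<Sum>i\<in>{1..M}. \<Sum>j\<in>{1..M}. L (real i) / L (real j))"
      using that nn by (intro member_le_sum) auto
    also have "\<dots> \<le> K" by (simp add: K_def)
    finally show ?thesis .
  qed
  have "L (real m) \<le> K * L (real n) \<and> L (real n) \<le> K * L (real m)"
    if nm: "1 \<le> n" "n \<le> m" "m \<le> 9 * n" for n m :: nat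
  proof -
    have p: "L (real n) > 0" "L (real m) > 0" using pos nm by auto
    show ?thesis
    proof (cases "N \<le> n")
      case True
      have "real m / real n \<in> {1..9}" using nm by (auto simp: field_simps)
      moreover have "real n \<ge> X" using True N by simp
      ultimately have "L (real m / real n * real n) \<le> exp 1 * L (real n) \<and>
          L (real n) \<le> exp 1 * L (real m / real n * real n)" by (rule X(2)[rotated])
      then have "L (real m) \<le> exp 1 * L (real n)" "L (real n) \<le> exp 1 * L (real m)" using nm by auto
      moreover have "exp 1 * L (real n) \<le> K * L (real n)" "exp 1 * L (real m) \<le> K * L (real m)"
        using Ke p by (auto intro: mult_right_mono)
      ultimately show ?thesis by linarith
    next
      case False
      then have "n \<in> {1..M}" "m \<in> {1..M}" using nm by (auto simp: M_def)
      then have "L (real m) / L (real n) \<le> K" "L (real n) / L (real m) \<le> K" using K by blast+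
      then show ?thesis using p by (simp add: divide_le_eq)
    qed
  qed
  moreover have "K > 0" using Ke exp_gt_zero[of "1::real"] by linarith
  ultimately show ?thesis by blast
qed

section \<open>Sums over self-avoiding walks\<close>

lemma infsum_ennreal_by_nat:
  fixes f :: "'a \<Rightarrow> ennreal" and len :: "'a \<Rightarrow> nat"
  assumes fin: "\<And>n. finite {a\<in>A. len a = n}" and N: "len ` A \<subseteq> N"
  shows "infsum f A = (\<Sum>\<^sub>\<infinity>n\<in>N. \<Sum>a\<in>{a\<in>A. len a = n}. f a)"
proof -
  have inj: "inj_on snd (Sigma N (\<lambda>n. {a\<in>A. len a = n}))" by (auto simp: inj_on_def)
  have im: "snd ` Sigma N (\<lambda>n. {a\<in>A. len a = n}) = A" using N by force
  have "(\<Sum>\<^sub>\<infinity>n\<in>N. \<Sum>a\<in>{a\<in>A. len a = n}. f a) =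
      (\<Sum>\<^sub>\<infinity>n\<in>N. \<Sum>a\<in>{a\<in>A. len a = n}. (f \<circ> snd) (n, a))" by simp
  also have "\<dots> = infsum (f \<circ> snd) (Sigma N (\<lambda>n. {a\<in>A. len a = n}))"
    by (rule infsum_ennreal_Sigma_finite) (rule fin)
  also have "\<dots> = infsum f (snd ` Sigma N (\<lambda>n. {a\<in>A. len a = n}))"
    by (rule infsum_reindex[OF inj, symmetric])
  finally show ?thesis by (simp only: im)
qed

lemma infsum_ennreal_less_top_mono:
  assumes fin: "(\<Sum>\<^sub>\<infinity>a\<in>A. ennreal (g a)) < \<infinity>" and C: "0 \<le> C"
    and le: "\<And>a. a \<in> A \<Longrightarrow> f a \<le> C * g a"
  shows "(\<Sum>\<^sub>\<infinity>a\<in>A. ennreal (f a)) < \<infinity>"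
proof -
  have "(\<Sum>\<^sub>\<infinity>a\<in>A. ennreal (f a)) \<le> ennreal C * (\<Sum>\<^sub>\<infinity>a\<in>A. ennreal (g a))"
  proof (rule infsum_ennreal_inj_le[where h = "\<lambda>a. a"])
    fix a assume "a \<in> A"
    have "ennreal (f a) \<le> ennreal (C * g a)" using le[OF \<open>a \<in> A\<close>] by (rule ennreal_leI)
    also have "\<dots> = ennreal C * ennreal (g a)" using C by (rule ennreal_mult')
    finally show "ennreal (f a) \<le> ennreal C * ennreal (g a)" .
  qed auto
  also have "\<dots> < \<infinity>" using fin by (simp add: ennreal_mult_less_top)
  finally show ?thesis .
qed

lemma infsum_nat_less_top:
  assumes "summable h" "\<And>n. 0 \<le> h n" "\<And>n. f n \<le> h n"
  shows "(\<Sum>\<^sub>\<infinity>n\<in>N. ennreal (f n)) < \<infinity>"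
proof -
  have "(\<Sum>\<^sub>\<infinity>n\<in>N. ennreal (f n)) \<le> ennreal (suminf h)"
  proof (rule infsum_ennreal_leI)
    fix F assume F: "finite F" "F \<subseteq> N"
    have "(\<Sum>n\<in>F. ennreal (f n)) \<le> (\<Sum>n\<in>F. ennreal (h n))" by (intro sum_mono ennreal_leI assms)
    also have "\<dots> = ennreal (\<Sum>n\<in>F. h n)" using assms by (simp add: sum_ennreal)
    also have "\<dots> \<le> ennreal (suminf h)" using assms F by (intro ennreal_leI sum_le_suminf) auto
    finally show "(\<Sum>n\<in>F. ennreal (f n)) \<le> ennreal (suminf h)" .
  qed
  then show ?thesis by (simp add: order_le_less_trans)
qed

abbreviation saws_len :: "'a ugraph \<Rightarrow> 'a set \<Rightarrow> nat \<Rightarrow> ('a set \<times> ('a \<times> 'a set) list) set" where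
  "saws_len G W n \<equiv> {p\<in>step_saws G W. length (snd p) = n}"

lemma saws_n_conv: "saws_n G W n = mid_path_of ` saws_len G W n"
  unfolding saws_n_def saws_conv_step_saws by auto

lemma card_saws_n: "card (saws_n G W n) = card (saws_len G W n)"
  unfolding saws_n_conv by (rule card_image[OF inj_on_subset[OF inj_mid_path_of subset_UNIV]])

context qt_cubic_graph
begin

text \<open>The 6 is two ends of the current mid-edge times three edges at each of them. Summing the
  powers up to the third gives the 259 of \<open>short_walks_bound\<close>.\<close>

lemma step_walks_bound:
  assumes "e \<in> edges G"
  shows "finite {s. step_walk G e s \<and> length s = n} \<and> card {s. step_walk G e s \<and> length s = n} \<le> 6 ^ n"
  using assms
proof (induction n arbitrary: e)
  case 0
  have "{s. step_walk G e s \<and> length s = 0} = {[]}" by auto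
  then show ?case by simp
next
  case (Suc n)
  let ?N = "Sigma e (\<lambda>v. {f\<in>edges G. v \<in> f})"
  let ?S = "\<lambda>f. {s. step_walk G f s \<and> length s = n}"
  have c2: "card e = 2" by (rule card_edge[OF Suc.prems])
  have fe: "finite e" using c2 by (intro card_ge_0_finite) simp
  have fN: "finite ?N" using fe finite_edges_at edge_verts[OF Suc.prems] by auto
  have "card ?N = (\<Sum>v\<in>e. card {f\<in>edges G. v \<in> f})"
    using fe finite_edges_at edge_verts[OF Suc.prems] by (intro card_SigmaI) auto
  also have "\<dots> = (\<Sum>v\<in>e. 3)" using card_edges_at edge_verts[OF Suc.prems] by (intro sum.cong) auto
  finally have cN: "card ?N = 6" using c2 by simp
  have eq: "{s. step_walk G e s \<and> length s = Suc n} = (\<Union>a\<in>?N. (#) a ` ?S (snd a))"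
  proof (intro subset_antisym subsetI)
    fix t assume "t \<in> {s. step_walk G e s \<and> length s = Suc n}"
    then obtain v f s where t: "t = (v, f) # s" "step_walk G e ((v, f) # s)" "length s = n"
      by (auto simp: length_Suc_conv)
    then have "(v, f) \<in> ?N" "s \<in> ?S (snd (v, f))" by auto
    then show "t \<in> (\<Union>a\<in>?N. (#) a ` ?S (snd a))" unfolding t(1) by blast
  qed auto
  have fS: "finite (?S (snd a))" "card (?S (snd a)) \<le> 6 ^ n" if "a \<in> ?N" for a
    using Suc.IH[of "snd a"] that by auto
  have "finite (\<Union>a\<in>?N. (#) a ` ?S (snd a))" using fN fS by blast
  moreover have "card (\<Union>a\<in>?N. (#) a ` ?S (snd a)) \<le> 6 ^ Suc n"
  proof -
    have "card (\<Union>a\<in>?N. (#) a ` ?S (snd a)) \<le> (\<Sum>a\<in>?N. card ((#) a ` ?S (snd a)))"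
      by (rule card_UN_le[OF fN])
    also have "\<dots> \<le> (\<Sum>a\<in>?N. 6 ^ n)"
      using fS by (intro sum_mono order_trans[OF card_image_le]) auto
    finally show ?thesis using cN by simp
  qed
  ultimately show ?case unfolding eq by simp
qed

lemma short_walks_bound:
  assumes "e \<in> edges G"
  shows "finite {s. step_walk G e s \<and> length s \<le> 3}" "card {s. step_walk G e s \<and> length s \<le> 3} \<le> 259"
proof -
  have eq: "{s. step_walk G e s \<and> length s \<le> 3} = (\<Union>n\<le>3. {s. step_walk G e s \<and> length s = n})" by auto
  show "finite {s. step_walk G e s \<and> length s \<le> 3}" unfolding eq using step_walks_bound[OF assms] by auto
  have "card {s. step_walk G e s \<and> length s \<le> 3} \<le> (\<Sum>n\<le>3. card {s. step_walk G e s \<and> length s = n})"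
    unfolding eq by (rule card_UN_le) simp
  also have "\<dots> \<le> (\<Sum>n\<le>3. 6 ^ n)" using step_walks_bound[OF assms] by (intro sum_mono) auto
  also have "\<dots> = 259" by (simp add: numeral_eq_Suc)
  finally show "card {s. step_walk G e s \<and> length s \<le> 3} \<le> 259" .
qed

lemma fundamental_domainD:
  assumes "fundamental_domain G W"
  shows "finite W" "W \<subseteq> verts G" "W \<noteq> {}" "finite (incident_edges G W)"
  using assms fundamental_domain_nonempty finite_incident_edges by (auto simp: fundamental_domain_def)

lemma finite_saws_len:
  assumes "fundamental_domain G W"
  shows "finite (saws_len G W n)"
proof (rule finite_subset)
  show "saws_len G W n \<subseteq> Sigma (incident_edges G W) (\<lambda>e. {s. step_walk G e s \<and> length s = n})"
    by (auto simp: step_saws_def step_saw_def)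
  show "finite (Sigma (incident_edges G W) (\<lambda>e. {s. step_walk G e s \<and> length s = n}))"
    using fundamental_domainD[OF assms] step_walks_bound
    by (intro finite_SigmaI) (auto simp: incident_edges_def)
qed

lemma finite_saws_le:
  assumes "fundamental_domain G W"
  shows "finite {p\<in>step_saws G W. length (snd p) \<le> n}"
proof -
  have "{p\<in>step_saws G W. length (snd p) \<le> n} = (\<Union>k\<le>n. saws_len G W k)" by auto
  then show ?thesis using finite_saws_len[OF assms] by simp
qed

subsection \<open>Independence of the fundamental domain\<close>

text \<open>Each starting edge over \<open>W'\<close> is moved into the other domain by an
  automorphism chosen for that edge. The image together with the original starting edge determines
  the walk, so the fibres are no larger than the set of starting edges.\<close>

lemma infsum_change_domain:
  fixes F :: "'a set \<times> ('a \<times> 'a set) list \<Rightarrow> ennreal"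
  assumes W: "fundamental_domain G W" "fundamental_domain G W'"
    and inv: "\<And>\<alpha> e s. automorphism G \<alpha> \<Longrightarrow> step_saw G e s \<Longrightarrow> F (\<alpha> ` e, map_steps \<alpha> s) = F (e, s)"
  shows "infsum F (step_saws G W') \<le> of_nat (card (incident_edges G W')) * infsum F (step_saws G W)"
proof -
  note Wp = fundamental_domainD[OF W(1)] and Wp' = fundamental_domainD[OF W(2)]
  have "\<exists>\<alpha>. automorphism G \<alpha> \<and> \<alpha> ` e \<in> incident_edges G W" if e: "e \<in> incident_edges G W'" for e
  proof -
    obtain v where v: "v \<in> e" "v \<in> W'" using e by (auto simp: incident_edges_def)
    have "v \<in> verts G" using v Wp'(2) by blast
    then obtain \<alpha> where \<alpha>: "automorphism G \<alpha>" "\<alpha> v \<in> W"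
      using W(1) unfolding fundamental_domain_def by blast
    have "\<alpha> ` e \<in> edges G" using automorphism_edge[OF simple \<alpha>(1)] e by (auto simp: incident_edges_def)
    then show ?thesis using \<alpha> v by (intro exI[of _ \<alpha>]) (auto simp: incident_edges_def)
  qed
  then obtain A where A: "\<And>e. e \<in> incident_edges G W' \<Longrightarrow> automorphism G (A e)"
    "\<And>e. e \<in> incident_edges G W' \<Longrightarrow> A e ` e \<in> incident_edges G W" by metis
  define h where "h p = (A (fst p) ` fst p, map_steps (A (fst p)) (snd p))" for p
  have "infsum F (step_saws G W') \<le> 1 * of_nat (card (incident_edges G W')) * infsum F (step_saws G W)"
  proof (rule infsum_ennreal_fibre_le[where h = h])
    fix p assume p: "p \<in> step_saws G W'"
    then have fp: "fst p \<in> incident_edges G W'" "step_saw G (fst p) (snd p)" by (auto simp: step_saws_def)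
    show "h p \<in> step_saws G W"
      using step_saw_map_steps[OF simple A(1)[OF fp(1)] fp(2)] A(2)[OF fp(1)] by (auto simp: h_def step_saws_def)
    show "F p \<le> 1 * F (h p)" using inv[OF A(1)[OF fp(1)] fp(2)] by (simp add: h_def)
  next
    fix q assume "q \<in> step_saws G W"
    let ?R = "{p \<in> step_saws G W'. h p = q}"
    have inj: "inj_on fst ?R"
    proof (rule inj_onI)
      fix p p' assume pp: "p \<in> ?R" "p' \<in> ?R" "fst p = fst p'"
      then have "fst p \<in> incident_edges G W'" "step_walk G (fst p) (snd p)" "step_walk G (fst p') (snd p')"
        by (auto simp: step_saws_def step_saw_def)
      moreover have "map_steps (A (fst p)) (snd p) = map_steps (A (fst p)) (snd p')"
        using pp by (auto simp: h_def)
      ultimately have "snd p = snd p'" using map_steps_inj[OF simple A(1)] by blast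
      then show "p = p'" using pp(3) by (simp add: prod_eq_iff)
    qed
    have sub: "fst ` ?R \<subseteq> incident_edges G W'" by (auto simp: step_saws_def)
    show "finite ?R \<and> card ?R \<le> card (incident_edges G W')"
      using finite_imageD[OF finite_subset[OF sub Wp'(4)] inj] card_inj_on_le[OF inj sub Wp'(4)] by blast
  qed
  then show ?thesis by simp
qed

lemma infsum_change_domain_iff:
  fixes F :: "'a set \<times> ('a \<times> 'a set) list \<Rightarrow> ennreal"
  assumes W: "fundamental_domain G W" "fundamental_domain G W'"
    and inv: "\<And>\<alpha> e s. automorphism G \<alpha> \<Longrightarrow> step_saw G e s \<Longrightarrow> F (\<alpha> ` e, map_steps \<alpha> s) = F (e, s)"
  shows "infsum F (step_saws G W') < \<infinity> \<longleftrightarrow> infsum F (step_saws G W) < \<infinity>"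
proof -
  have "infsum F (step_saws G V') < \<infinity>"
    if V: "fundamental_domain G V" "fundamental_domain G V'" and fin: "infsum F (step_saws G V) < \<infinity>" for V V'
  proof -
    note infsum_change_domain[OF V inv]
    also have "of_nat (card (incident_edges G V')) * infsum F (step_saws G V) < \<infinity>"
      using fin by (simp add: ennreal_mult_less_top of_nat_less_top)
    finally show ?thesis .
  qed
  then show ?thesis using W by blast
qed

subsection \<open>Walks between mid-edges and walks between vertices\<close>

lemma map_fst_vertex_saw:
  assumes "step_saw G e s" "s \<noteq> []"
  shows "map fst s \<in> vertex_saws G (length s - 1) (hd (map fst s))"
proof -
  have w: "step_walk G e s" "distinct (map fst s)" using assms by (auto simp: step_saw_def)
  have "successively (adj G) (map fst s)" using w
  proof (induction s arbitrary: e)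
    case (Cons a s)
    obtain v f where a: "a = (v, f)" by (cases a)
    show ?case
    proof (cases s)
      case Nil
      then show ?thesis by (simp add: a)
    next
      case (Cons b t)
      obtain u g where b: "b = (u, g)" by (cases b)
      have f: "v \<in> f" "u \<in> f" "f \<in> edges G" "v \<noteq> u" using Cons.prems by (auto simp: a b Cons)
      then obtain z where "f = {v, z}" using edge_cases[OF simple] by metis
      then have "adj G v u" using f by (auto simp: adj_def)
      moreover have "successively (adj G) (map fst s)"
        using Cons.IH[of f] Cons.prems by (auto simp: a)
      ultimately show ?thesis by (simp add: a b Cons)
    qed
  qed simp
  then show ?thesis using assms w step_walk_subset_verts(1)[OF simple w(1)]
    by (auto simp: vertex_saws_conv)
qed

text \<open>The mid-edge between consecutive vertices is forced, so beyond the starting one only the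
  last is free.\<close>

lemma step_saw_eqI:
  assumes "step_saw G e s" "step_saw G e' s'" "map fst s = map fst s'" "walk_end e s = walk_end e' s'"
    "s \<noteq> []"
  shows "s = s'"
  using assms
proof (induction s arbitrary: e e' s')
  case (Cons a s)
  obtain v f where a: "a = (v, f)" by (cases a)
  obtain f' t where s': "s' = (v, f') # t" "map fst s = map fst t" using Cons.prems(3) by (cases s') (auto simp: a)
  have saw: "step_saw G f s" "step_saw G f' t" "v \<in> f" "v \<in> f'" "v \<notin> fst ` set s"
    using Cons.prems by (auto simp: a s' step_saw_Cons)
  show ?case
  proof (cases s)
    case Nil
    then show ?thesis using Cons.prems s' by (auto simp: a)
  next
    case sCons: (Cons b s2)
    obtain u g where b: "b = (u, g)" by (cases b)
    obtain g' t2 where t: "t = (u, g') # t2" using s'(2) sCons b by (cases t) auto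
    have u: "u \<in> f" "u \<in> f'" "u \<noteq> v" "f \<in> edges G" "f' \<in> edges G"
      using saw by (auto simp: sCons b t step_saw_Cons)
    have "f = {v, u}" "f' = {v, u}" using edge_cases[OF simple u(4) saw(3)] edge_cases[OF simple u(5) saw(4)] u
      by (metis insertE singletonD)+
    then have "f = f'" by simp
    moreover have "s = t" using Cons.IH[OF saw(1,2) s'(2)] Cons.prems(4) sCons by (simp add: a s')
    ultimately show ?thesis by (simp add: a s')
  qed
qed simp

text \<open>A mid-edge walk visiting m + 1 vertices is a vertex walk of m steps from an end of the
  starting edge, together with that edge and one of three final edges.\<close>

lemma card_saws_len_le:
  assumes W: "fundamental_domain G W"
  shows "\<exists>N. \<forall>m. real (card (saws_len G W (Suc m))) \<le> real N * max_count m"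
proof -
  note Wp = fundamental_domainD[OF W]
  let ?X = "incident_edges G W" and ?U = "\<Union> (incident_edges G W)"
  have U: "?U \<subseteq> verts G" using edge_verts by (auto simp: incident_edges_def)
  have fU: "finite ?U"
    using Wp(4) card_edge by (intro finite_Union) (auto simp: incident_edges_def intro!: card_ge_0_finite)
  have "real (card (saws_len G W (Suc m))) \<le> real (card ?X * card ?U * 3) * max_count m" for m
  proof -
    let ?V = "\<Union>v\<in>?U. vertex_saws G m v"
    let ?T = "?X \<times> Sigma ?V (\<lambda>p. {f\<in>edges G. last p \<in> f})"
    have lastv: "last p \<in> verts G" if "p \<in> ?V" for p
    proof -
      have "p \<noteq> []" "set p \<subseteq> verts G" using that by (auto simp: vertex_saws_def)
      then show ?thesis using last_in_set by blast
    qed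
    have fV: "finite ?V" using fU finite_vertex_saws U by blast
    have fT: "finite ?T" using Wp(4) fV finite_edges_at lastv by (intro finite_cartesian_product finite_SigmaI) auto
    have "card (saws_len G W (Suc m)) \<le> card ?T"
    proof (rule card_inj_on_le[OF _ _ fT])
      let ?h = "\<lambda>p. (fst p, map fst (snd p), walk_end (fst p) (snd p))"
      show "inj_on ?h (saws_len G W (Suc m))"
      proof (rule inj_onI)
        fix p q assume "p \<in> saws_len G W (Suc m)" "q \<in> saws_len G W (Suc m)" "?h p = ?h q"
        then have "step_saw G (fst p) (snd p)" "step_saw G (fst q) (snd q)" "map fst (snd p) = map fst (snd q)"
          "walk_end (fst p) (snd p) = walk_end (fst q) (snd q)" "snd p \<noteq> []" "fst p = fst q"
          by (auto simp: step_saws_def)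
        then show "p = q"
          using step_saw_eqI[of "fst p" "snd p" "fst q" "snd q"] by (simp add: prod_eq_iff)
      qed
      show "?h ` saws_len G W (Suc m) \<subseteq> ?T"
      proof (rule image_subsetI)
        fix q assume p: "q \<in> saws_len G W (Suc m)"
        obtain e s where q: "q = (e, s)" by (cases q)
        from p have s: "step_saw G e s" "s \<noteq> []" "e \<in> ?X" "length s = Suc m" by (auto simp: step_saws_def q)
        have "map fst s \<in> vertex_saws G m (hd (map fst s))" using map_fst_vertex_saw[OF s(1,2)] s(4) by simp
        moreover have "hd (map fst s) \<in> e" using s(1,2) by (cases s) (auto simp: step_saw_def)
        ultimately have "map fst s \<in> ?V" using s(3) by blast
        moreover have "walk_end e s \<in> edges G" using s(1) walk_end_edges by (auto simp: step_saw_def)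
        moreover have "last (map fst s) \<in> walk_end e s"
          using s(1,2) by (cases s rule: rev_cases) (auto simp: step_saw_def)
        ultimately show "?h q \<in> ?T" using s(3) unfolding q by (simp only: fst_conv snd_conv mem_Sigma_iff) simp
      qed
    qed
    also have "card ?T = card ?X * (\<Sum>p\<in>?V. card {f\<in>edges G. last p \<in> f})"
    proof -
      have "card (Sigma ?V (\<lambda>p. {f\<in>edges G. last p \<in> f})) = (\<Sum>p\<in>?V. card {f\<in>edges G. last p \<in> f})"
        using fV finite_edges_at lastv by (intro card_SigmaI) blast+
      then show ?thesis by (simp only: card_cartesian_product)
    qed
    also have "(\<Sum>p\<in>?V. card {f\<in>edges G. last p \<in> f}) = card ?V * 3"
      using lastv card_edges_at by simp
    finally have "card (saws_len G W (Suc m)) \<le> card ?X * (card ?V * 3)" .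
    then have "real (card (saws_len G W (Suc m))) \<le> real (card ?X * (card ?V * 3))"
      by (rule of_nat_mono)
    also have "\<dots> = real (card ?X) * (real (card ?V) * 3)" by (simp only: of_nat_mult of_nat_numeral)
    also have "\<dots> \<le> real (card ?X) * ((real (card ?U) * max_count m) * 3)"
    proof (intro mult_left_mono mult_right_mono)
      have "real (card ?V) \<le> real (\<Sum>v\<in>?U. card (vertex_saws G m v))"
        using card_UN_le[OF fU] by (rule of_nat_mono)
      also have "\<dots> = (\<Sum>v\<in>?U. saw_count m v)" by (simp add: saw_count_def)
      also have "\<dots> \<le> (\<Sum>v\<in>?U. max_count m)" using U by (intro sum_mono saw_count_le_max) auto
      finally show "real (card ?V) \<le> real (card ?U) * max_count m" by simp
    qed auto
    finally show ?thesis by (simp add: algebra_simps)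
  qed
  then show ?thesis by blast
qed

lemma ex_other_edge:
  assumes "v \<in> verts G"
  shows "\<exists>f\<in>edges G. v \<in> f \<and> f \<noteq> g \<and> f \<noteq> h"
proof (rule ccontr)
  assume "\<not> ?thesis"
  then have "{e\<in>edges G. v \<in> e} \<subseteq> {g, h}" by auto
  then have "card {e\<in>edges G. v \<in> e} \<le> card {g, h}" by (rule card_mono[rotated]) simp
  also have "\<dots> \<le> 2" by (simp add: card_insert_if)
  finally show False using card_edges_at[OF assms] by simp
qed

text \<open>The inner mid-edges are forced; only the last has to be chosen, and it could collide
  with the initial one if that edge returns to the last vertex. \<open>g\<close> remembers the
  initial edge through the induction, where the current edge is either \<open>g\<close> itself or
  avoids all later vertices.\<close>

lemma ex_saw_through:
  assumes "p \<noteq> []" "distinct p" "successively (adj G) p" "set p \<subseteq> verts G" "e \<in> edges G" "hd p \<in> e"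
    "e = g \<or> e \<inter> set (tl p) = {}" "tl p \<noteq> [] \<Longrightarrow> e \<noteq> {hd p, hd (tl p)}"
  shows "\<exists>s. step_saw G e s \<and> map fst s = p \<and> walk_end e s \<noteq> g \<and>
    (\<forall>x\<in>snd ` set s. x = walk_end e s \<or> x \<subseteq> set p)"
  using assms
proof (induction p arbitrary: e)
  case (Cons v q)
  show ?case
  proof (cases q)
    case Nil
    obtain f where f: "f \<in> edges G" "v \<in> f" "f \<noteq> e" "f \<noteq> g"
      using ex_other_edge[of v e g] Cons.prems by auto
    then show ?thesis using Cons.prems Nil
      by (intro exI[of _ "[(v, f)]"]) (auto simp: step_saw_Cons)
  next
    case q: (Cons u r)
    let ?f = "{v, u}"
    have vu: "adj G v u" "successively (adj G) q" "distinct q" "v \<notin> set q" using Cons.prems q by auto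
    have "\<exists>s. step_saw G ?f s \<and> map fst s = q \<and> walk_end ?f s \<noteq> g \<and>
      (\<forall>x\<in>snd ` set s. x = walk_end ?f s \<or> x \<subseteq> set q)"
    proof (rule Cons.IH)
      show "?f = g \<or> ?f \<inter> set (tl q) = {}" using vu q by auto
      show "?f \<noteq> {hd q, hd (tl q)}" if "tl q \<noteq> []"
      proof
        assume "?f = {hd q, hd (tl q)}"
        then have "v \<in> {hd q, hd (tl q)}" by blast
        then show False using that vu(4) q by (cases r) auto
      qed
    qed (use vu q Cons.prems in \<open>auto simp: adj_def\<close>)
    then obtain s where s: "step_saw G ?f s" "map fst s = q" "walk_end ?f s \<noteq> g"
      "\<forall>x\<in>snd ` set s. x = walk_end ?f s \<or> x \<subseteq> set q" by blast
    have fs: "fst ` set s = set q" using s(2) by (metis set_map)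
    have "e \<notin> snd ` set s"
    proof
      assume e: "e \<in> snd ` set s"
      have "v \<in> e" using Cons.prems by simp
      then have "\<not> e \<subseteq> set q" using vu(4) by blast
      then have we: "e = walk_end ?f s" using s(4) e by blast
      then have "e \<noteq> g" using s(3) by simp
      then have "e \<inter> set q = {}" using Cons.prems(7) by simp
      moreover have "\<exists>w\<in>fst ` set s. w \<in> e"
      proof -
        have "step_walk G ?f s" using s(1) by (simp add: step_saw_def)
        then have "\<And>w x. (w, x) \<in> set s \<Longrightarrow> w \<in> x"
          by (induction s arbitrary: rule: step_walk.induct) auto
        then show ?thesis using e by force
      qed
      ultimately show False using fs by blast
    qed
    moreover have "e \<noteq> ?f" using Cons.prems(8) q by simp
    ultimately have "step_saw G e ((v, ?f) # s)"
      using Cons.prems s(1) fs vu(4) by (auto simp: step_saw_Cons)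
    then show ?thesis using s q by (intro exI[of _ "(v, ?f) # s"]) auto
  qed
qed simp

text \<open>Degree 3 leaves a starting edge at \<open>v\<close> different from the first edge
  traversed, so every vertex walk is the vertex list of some mid-edge walk.\<close>

lemma saw_count_le_card:
  assumes W: "fundamental_domain G W" and v: "v \<in> W"
  shows "saw_count m v \<le> real (card (saws_len G W (Suc m)))"
proof -
  have vv: "v \<in> verts G" using fundamental_domainD[OF W] v by auto
  have "vertex_saws G m v \<subseteq> (\<lambda>p. map fst (snd p)) ` saws_len G W (Suc m)"
  proof
    fix p assume p: "p \<in> vertex_saws G m v"
    then have p': "p \<noteq> []" "distinct p" "successively (adj G) p" "set p \<subseteq> verts G" "hd p = v" "length p = Suc m"
      by (auto simp: vertex_saws_conv)
    obtain e where e: "e \<in> edges G" "v \<in> e" "e \<noteq> {hd p, hd (tl p)}" using ex_other_edge[OF vv] by blast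
    obtain s where s: "step_saw G e s" "map fst s = p"
      using ex_saw_through[OF p'(1-4) e(1), of e] e p'(5) by blast
    have "(e, s) \<in> saws_len G W (Suc m)"
    proof -
      have "length s = Suc m" using s(2) p'(6) by (metis length_map)
      then show ?thesis using s(1) e v by (auto simp: step_saws_def incident_edges_def)
    qed
    then show "p \<in> (\<lambda>p. map fst (snd p)) ` saws_len G W (Suc m)" using s(2) by force
  qed
  then have "card (vertex_saws G m v) \<le> card (saws_len G W (Suc m))"
    using finite_saws_len[OF W] by (rule surj_card_le[rotated])
  then show ?thesis by (simp add: saw_count_def)
qed

section \<open>Generating functions away from the critical point\<close>

lemma infsum_saws_power:
  assumes W: "fundamental_domain G W" and x: "0 \<le> x"
  shows "(\<Sum>\<^sub>\<infinity>p\<in>step_saws G W. ennreal (x ^ length (snd p))) =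
    (\<Sum>\<^sub>\<infinity>n\<in>UNIV. ennreal (real (card (saws_len G W n)) * x ^ n))"
proof -
  have "(\<Sum>\<^sub>\<infinity>p\<in>step_saws G W. ennreal (x ^ length (snd p))) =
      (\<Sum>\<^sub>\<infinity>n\<in>UNIV. \<Sum>p\<in>saws_len G W n. ennreal (x ^ length (snd p)))"
    by (rule infsum_ennreal_by_nat) (use finite_saws_len[OF W] in auto)
  also have "\<dots> = (\<Sum>\<^sub>\<infinity>n\<in>UNIV. ennreal (real (card (saws_len G W n)) * x ^ n))"
    by (rule infsum_cong) (use x in \<open>simp add: ennreal_mult' ennreal_of_nat_eq_real_of_nat\<close>)
  finally show ?thesis .
qed

lemma saw_sum_subcritical:
  assumes W: "fundamental_domain G W" and x: "0 < x" "x < inverse growth"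
  shows "(\<Sum>\<^sub>\<infinity>p\<in>step_saws G W. ennreal (x ^ length (snd p))) < \<infinity>"
proof -
  have g: "1 \<le> growth" by (rule growth_ge_1)
  have "growth < 1 / x" using x g by (simp add: field_simps)
  then obtain b where b: "growth < b" "b < 1 / x" using dense by blast
  have bx: "0 < b * x" "b * x < 1" using b x g by (auto simp: field_simps)
  obtain C where C: "1 \<le> C" "\<And>n. max_count n \<le> C * b ^ n" using max_count_le_power[OF b(1)] by blast
  obtain N where N: "\<And>m. real (card (saws_len G W (Suc m))) \<le> real N * max_count m"
    using card_saws_len_le[OF W] by blast
  \<comment> \<open>The first entry covers length 0; the division in the second corrects the shift
    from \<open>m\<close> steps between vertices to a mid-edge length of
    \<open>m + 1\<close>.\<close>
  define K where "K = max (real (card (saws_len G W 0))) (real N * C * x / (b * x))"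
  have le: "real (card (saws_len G W n)) * x ^ n \<le> K * (b * x) ^ n" for n
  proof (cases n)
    case 0
    then show ?thesis by (simp add: K_def)
  next
    case (Suc m)
    have "real (card (saws_len G W n)) * x ^ n \<le> (real N * (C * b ^ m)) * x ^ n"
      unfolding Suc using N[of m] C(2)[of m] x
      by (intro mult_right_mono order_trans[OF N] mult_left_mono) auto
    also have "\<dots> = (real N * C * x / (b * x)) * (b * x) ^ n"
    proof -
      have "b \<noteq> 0" "x \<noteq> 0" using bx by auto
      then show ?thesis unfolding Suc by (simp add: power_mult_distrib)
    qed
    also have "\<dots> \<le> K * (b * x) ^ n" unfolding K_def using bx by (intro mult_right_mono) auto
    finally show ?thesis .
  qed
  have "summable (\<lambda>n. K * (b * x) ^ n)" using bx by (intro summable_mult summable_geometric) auto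
  moreover have "0 \<le> K" by (simp add: K_def)
  ultimately show ?thesis unfolding infsum_saws_power[OF W less_imp_le[OF x(1)]]
    using le bx by (intro infsum_nat_less_top[where h = "\<lambda>n. K * (b * x) ^ n"]) auto
qed

lemma saw_sum_supercritical:
  assumes W: "fundamental_domain G W" and x: "inverse growth < x"
  shows "(\<Sum>\<^sub>\<infinity>p\<in>step_saws G W. ennreal (x ^ length (snd p))) = \<infinity>"
proof -
  have g: "1 \<le> growth" by (rule growth_ge_1)
  have x0: "0 < x" using x g by (meson le_less_trans inverse_nonnegative_iff_nonnegative zero_le_one order_trans)
  have "1 / x < growth" using x x0 g by (simp add: field_simps)
  obtain v where v: "v \<in> W" using fundamental_domainD[OF W] by auto
  have vv: "v \<in> verts G" using fundamental_domainD[OF W] v by auto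
  have "eventually (\<lambda>n. 1 / x < root n (saw_count n v)) sequentially"
    by (rule order_tendstoD(1)[OF saw_count_root_tendsto[OF vv] \<open>1 / x < growth\<close>])
  then obtain N where N: "\<And>n. n \<ge> N \<Longrightarrow> 1 / x < root n (saw_count n v)"
    by (auto simp: eventually_sequentially)
  \<comment> \<open>The root criterion gives at least \<open>(1 / x) ^ n\<close> walks, and the
    shift by one leaves a factor \<open>x\<close>; terms bounded below by a positive constant force
    divergence.\<close>
  have ge: "x \<le> real (card (saws_len G W (Suc n))) * x ^ Suc n" if n: "n \<ge> max N 1" for n
  proof -
    have "(1 / x) ^ n \<le> root n (saw_count n v) ^ n" using N[of n] n x0 by (intro power_mono) auto
    also have "\<dots> = saw_count n v" using n saw_count_ge_1[OF vv, of n] by simp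
    also have "\<dots> \<le> real (card (saws_len G W (Suc n)))" by (rule saw_count_le_card[OF W v])
    finally have "(1 / x) ^ n * x ^ Suc n \<le> real (card (saws_len G W (Suc n))) * x ^ Suc n"
      using x0 by (intro mult_right_mono) auto
    moreover have "(1 / x) ^ n * x ^ Suc n = x" using x0 by (simp add: power_divide)
    ultimately show ?thesis by (simp only:)
  qed
  have "(\<Sum>\<^sub>\<infinity>n\<in>{Suc (max N 1)..}. ennreal (real (card (saws_len G W n)) * x ^ n)) = \<infinity>"
  proof (rule infsum_superconst_infinite_ennreal[where b = "ennreal x"])
    fix n assume "n \<in> {Suc (max N 1)..}"
    then obtain m where "n = Suc m" "m \<ge> max N 1" by (cases n) auto
    then show "ennreal x \<le> ennreal (real (card (saws_len G W n)) * x ^ n)" using ge by (intro ennreal_leI) auto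
  qed (use x0 infinite_Ici in auto)
  moreover have "(\<Sum>\<^sub>\<infinity>n\<in>{Suc (max N 1)..}. ennreal (real (card (saws_len G W n)) * x ^ n))
      \<le> (\<Sum>\<^sub>\<infinity>n\<in>UNIV. ennreal (real (card (saws_len G W n)) * x ^ n))"
    by (rule infsum_ennreal_mono_set) simp
  ultimately show ?thesis unfolding infsum_saws_power[OF W less_imp_le[OF x0]] by (simp add: top_unique)
qed

end

section \<open>Comparing sums on the two graphs\<close>

lemma sum_bool_lists_power:
  fixes x :: real
  shows "(\<Sum>c\<in>{c. length c = n}. x ^ (2 * n + length (filter (\<lambda>b. b) c))) = (x\<^sup>2 + x ^ 3) ^ n"
proof (induction n)
  case (Suc n)
  let ?C = "\<lambda>n. {c :: bool list. length c = n}"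
  have fin: "finite (?C n)" using finite_lists_length_eq[of "UNIV :: bool set" n] by simp
  have eq: "?C (Suc n) = (#) True ` ?C n \<union> (#) False ` ?C n"
    by (auto simp: length_Suc_conv image_iff)
  have "(\<Sum>c\<in>?C (Suc n). x ^ (2 * Suc n + length (filter (\<lambda>b. b) c))) =
      (\<Sum>c\<in>(#) True ` ?C n. x ^ (2 * Suc n + length (filter (\<lambda>b. b) c))) +
      (\<Sum>c\<in>(#) False ` ?C n. x ^ (2 * Suc n + length (filter (\<lambda>b. b) c)))"
    unfolding eq using fin by (intro sum.union_disjoint) auto
  also have "\<dots> = (\<Sum>c\<in>?C n. x ^ 3 * x ^ (2 * n + length (filter (\<lambda>b. b) c))) +
      (\<Sum>c\<in>?C n. x\<^sup>2 * x ^ (2 * n + length (filter (\<lambda>b. b) c)))"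
    by (simp add: sum.reindex power_add power2_eq_square power3_eq_cube mult_ac)
  also have "\<dots> = (x\<^sup>2 + x ^ 3) ^ Suc n"
    unfolding sum_distrib_left[symmetric] Suc by (simp add: algebra_simps)
  finally show ?case .
qed simp

context qt_cubic_graph
begin

text \<open>\<open>(e, s)\<close> is the trace on \<open>G\<close> of the part of \<open>q\<close> between its first and its last long edge, and
  \<open>c\<close> records how that part crosses each triangle.\<close>

definition fisher_core ::
  "('a \<times> 'a) set \<times> (('a \<times> 'a) \<times> ('a \<times> 'a) set) list \<Rightarrow> 'a set \<Rightarrow> ('a \<times> 'a set) list \<Rightarrow> bool list \<Rightarrow> bool"
  where "fisher_core q e s c \<longleftrightarrow> (\<exists>ini fin. snd q = ini @ lift_steps G e s c @ fin \<and>
     walk_end (fst q) ini = long_edge e \<and> step_saw G e s \<and> length c = length s \<and>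
     length ini \<le> 3 \<and> length fin \<le> 3)"

lemma fisher_core_length:
  assumes "fisher_core q e s c"
  shows "2 * length s + length (filter (\<lambda>b. b) c) \<le> length (snd q)"
    "length (snd q) \<le> 2 * length s + length (filter (\<lambda>b. b) c) + 6"
    "length (snd q) \<le> 3 * length s + 6"
proof -
  obtain ini fin where q: "snd q = ini @ lift_steps G e s c @ fin" "step_saw G e s" "length c = length s"
    "length ini \<le> 3" "length fin \<le> 3" using assms by (auto simp: fisher_core_def)
  have "length (filter (\<lambda>b. b) c) \<le> length s" using q(3) by (metis length_filter_le)
  then show "2 * length s + length (filter (\<lambda>b. b) c) \<le> length (snd q)"
    "length (snd q) \<le> 2 * length s + length (filter (\<lambda>b. b) c) + 6"
    "length (snd q) \<le> 3 * length s + 6"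
    using q length_lift_steps[OF q(2,3)] by auto
qed

lemma fisher_core_cases:
  assumes "q \<in> step_saws (fisher G) (fisher_verts G W)"
  shows "(length (snd q) \<le> 3 \<and> (\<exists>v\<in>W. fst ` walk_end (fst q) (snd q) = {v})) \<or>
    (\<exists>e s c. fisher_core q e s c \<and> (e, s) \<in> step_saws G W \<and>
       fst ` walk_end (fst q) (snd q) \<subseteq> walk_end e s)"
proof -
  have q: "fst ` fst q \<inter> W \<noteq> {}" "step_saw (fisher G) (fst q) (snd q)"
    using assms unfolding step_saws_def incident_edges_fisher by (simp_all add: case_prod_unfold)
  from parse_fisher_saw[OF q(2)] show ?thesis
  proof
    assume "length (snd q) \<le> 3 \<and> (\<exists>v. fst ` fst q = {v} \<and> fst ` walk_end (fst q) (snd q) = {v})"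
    then obtain v where v: "length (snd q) \<le> 3" "fst ` fst q = {v}" "fst ` walk_end (fst q) (snd q) = {v}" by blast
    then have "v \<in> W" using q(1) by simp
    with v(1,3) show ?thesis by blast
  next
    assume "\<exists>ini e s c fin. snd q = ini @ lift_steps G e s c @ fin \<and> walk_end (fst q) ini = long_edge e \<and>
       step_saw G e s \<and> length c = length s \<and> length ini \<le> 3 \<and> length fin \<le> 3 \<and> fst ` fst q \<subseteq> e \<and>
       fst ` walk_end (fst q) (snd q) \<subseteq> walk_end e s"
    then show ?thesis
    proof (elim exE conjE)
      fix ini e s c fin
      assume x: "snd q = ini @ lift_steps G e s c @ fin" "walk_end (fst q) ini = long_edge e"
       "step_saw G e s" "length c = length s" "length ini \<le> 3" "length fin \<le> 3" "fst ` fst q \<subseteq> e"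
       "fst ` walk_end (fst q) (snd q) \<subseteq> walk_end e s"
      have "e \<in> edges G" using x(3) by (simp add: step_saw_def)
      moreover have "e \<inter> W \<noteq> {}" using q(1) x(7) by blast
      ultimately have "(e, s) \<in> step_saws G W" using x(3) by (simp add: step_saws_def incident_edges_def)
      moreover have "fisher_core q e s c" unfolding fisher_core_def
        by (rule exI[of _ ini], rule exI[of _ fin]) (intro conjI x)
      ultimately show ?thesis using x(8) by (intro disjI2 exI[of _ e] exI[of _ s] exI[of _ c] conjI)
    qed
  qed
qed

lemma lift_in_step_saws:
  assumes "(e, s) \<in> step_saws G W" "length c = length s"
  shows "(long_edge e, lift_steps G e s c) \<in> step_saws (fisher G) (fisher_verts G W)"
proof -
  have "step_saw G e s" "e \<in> incident_edges G W" "e \<in> edges G"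
    using assms by (auto simp: step_saws_def incident_edges_def)
  then show ?thesis using lift_steps_saw[of e s c] assms(2) long_edge_incident by (simp add: step_saws_def)
qed

text \<open>Summing \<open>x\<close> to the length of the lift over all boolean lists of a walk
  produces the power of x^2 + x^3. Distinct pairs of a walk and a list have distinct lifts, so the
  result is dominated by the sum over \<open>B\<close>.\<close>

lemma infsum_lift_le:
  fixes a0 :: "'a set \<times> ('a \<times> 'a set) list \<Rightarrow> real"
    and a1 :: "('a \<times> 'a) set \<times> (('a \<times> 'a) \<times> ('a \<times> 'a) set) list \<Rightarrow> real"
  assumes A: "A \<subseteq> step_saws G W" and x: "0 \<le> x" and K: "0 \<le> K" and a0: "\<And>p. p \<in> A \<Longrightarrow> 0 \<le> a0 p"
    and lift: "\<And>e s c. (e, s) \<in> A \<Longrightarrow> length c = length s \<Longrightarrow>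
      (long_edge e, lift_steps G e s c) \<in> B \<and> a0 (e, s) \<le> K * a1 (long_edge e, lift_steps G e s c)"
  shows "(\<Sum>\<^sub>\<infinity>p\<in>A. ennreal (a0 p * (x\<^sup>2 + x ^ 3) ^ length (snd p)))
    \<le> ennreal K * (\<Sum>\<^sub>\<infinity>q\<in>B. ennreal (a1 q * x ^ length (snd q)))"
proof -
  let ?C = "\<lambda>p. {c :: bool list. length c = length (snd p)}"
  let ?w = "\<lambda>(p, c). ennreal (a0 p * x ^ (2 * length (snd p) + length (filter (\<lambda>b. b) c)))"
  have fin: "finite {c :: bool list. length c = n}" for n
    using finite_lists_length_eq[of "UNIV :: bool set" n] by simp
  have "(\<Sum>\<^sub>\<infinity>p\<in>A. ennreal (a0 p * (x\<^sup>2 + x ^ 3) ^ length (snd p))) = (\<Sum>\<^sub>\<infinity>p\<in>A. \<Sum>c\<in>?C p. ?w (p, c))"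
  proof (rule infsum_cong)
    fix p assume p: "p \<in> A"
    have "ennreal (a0 p * (x\<^sup>2 + x ^ 3) ^ length (snd p)) =
        ennreal (\<Sum>c\<in>?C p. a0 p * x ^ (2 * length (snd p) + length (filter (\<lambda>b. b) c)))"
      unfolding sum_bool_lists_power[symmetric] sum_distrib_left ..
    also have "\<dots> = (\<Sum>c\<in>?C p. ?w (p, c))"
      using x a0[OF p] by (simp add: sum_ennreal)
    finally show "ennreal (a0 p * (x\<^sup>2 + x ^ 3) ^ length (snd p)) = (\<Sum>c\<in>?C p. ?w (p, c))" .
  qed
  also have "\<dots> = infsum ?w (Sigma A ?C)"
    by (rule infsum_ennreal_Sigma_finite) (rule fin)
  also have "\<dots> \<le> ennreal K * (\<Sum>\<^sub>\<infinity>q\<in>B. ennreal (a1 q * x ^ length (snd q)))"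
  proof (rule infsum_ennreal_inj_le[where h = "\<lambda>((e, s), c). (long_edge e, lift_steps G e s c)"])
    fix z assume z: "z \<in> Sigma A ?C"
    obtain e s c where zz: "z = ((e, s), c)" by (metis prod.exhaust)
    have es: "(e, s) \<in> A" "length c = length s" using z zz by auto
    then have saw: "step_saw G e s" using A by (auto simp: step_saws_def)
    show "(case z of (xa, c) \<Rightarrow> (case xa of (e, s) \<Rightarrow> \<lambda>c. (long_edge e, lift_steps G e s c)) c) \<in> B"
      using lift[OF es] zz by simp
    have "ennreal (a0 (e, s) * x ^ (2 * length s + length (filter (\<lambda>b. b) c)))
        \<le> ennreal (K * (a1 (long_edge e, lift_steps G e s c) * x ^ length (lift_steps G e s c)))"
      using lift[OF es] x length_lift_steps[OF saw es(2)]
      by (intro ennreal_leI) (simp add: mult.assoc[symmetric] mult_right_mono)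
    also have "\<dots> = ennreal K * ennreal (a1 (long_edge e, lift_steps G e s c) * x ^ length (lift_steps G e s c))"
      using K by (rule ennreal_mult')
    finally show "?w z \<le> ennreal K * ennreal
         (a1 (case z of (xa, c) \<Rightarrow> (case xa of (e, s) \<Rightarrow> \<lambda>c. (long_edge e, lift_steps G e s c)) c) *
          x ^ length (snd (case z of (xa, c) \<Rightarrow> (case xa of (e, s) \<Rightarrow> \<lambda>c. (long_edge e, lift_steps G e s c)) c)))"
      using zz by simp
  next
    show "inj_on (\<lambda>((e, s), c). (long_edge e, lift_steps G e s c)) (Sigma A ?C)"
    proof (rule inj_onI)
      fix z z' assume z: "z \<in> Sigma A ?C" "z' \<in> Sigma A ?C"
        and eq: "(\<lambda>((e, s), c). (long_edge e, lift_steps G e s c)) z = (\<lambda>((e, s), c). (long_edge e, lift_steps G e s c)) z'"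
      obtain e s c where zz: "z = ((e, s), c)" by (metis prod.exhaust)
      obtain e' s' c' where zz': "z' = ((e', s'), c')" by (metis prod.exhaust)
      have es: "step_saw G e s" "length c = length s" "step_saw G e' s'" "length c' = length s'"
        using z zz zz' A by (auto simp: step_saws_def)
      have "e = e'" using eq es(1,3) long_edge_inj by (auto simp: zz zz' step_saw_def)
      moreover from this have "s = s' \<and> c = c'"
        using lift_steps_inj[of e s s' c c'] es eq by (simp add: zz zz')
      ultimately show "z = z'" by (simp add: zz zz')
    qed
  qed
  finally show ?thesis .
qed

text \<open>Bounds the walks with a given core: a starting edge, an initial part from it and a final
  part from the end of the core, the parts having at most three steps each.\<close>

definition core_mult :: "'a set \<Rightarrow> nat" where
  "core_mult W = card (incident_edges (fisher G) (fisher_verts G W)) * 259 * 259"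

text \<open>The converse comparison. A walk exceeds its core by up to six steps, and the factor
  \<open>(1 + x) ^ 6\<close> covers them whether \<open>x\<close> is below or above 1.\<close>

lemma infsum_core_le:
  fixes a0 :: "'a set \<times> ('a \<times> 'a set) list \<Rightarrow> real"
    and a1 :: "('a \<times> 'a) set \<times> (('a \<times> 'a) \<times> ('a \<times> 'a) set) list \<Rightarrow> real"
  assumes W: "fundamental_domain G W" and B: "B \<subseteq> step_saws (fisher G) (fisher_verts G W)"
    and x: "0 \<le> x" and K: "0 \<le> K" and a0: "\<And>p. p \<in> A \<Longrightarrow> 0 \<le> a0 p"
    and core: "\<And>q. q \<in> B \<Longrightarrow> \<exists>e s c. fisher_core q e s c \<and> (e, s) \<in> A \<and> a1 q \<le> K * a0 (e, s)"
  shows "(\<Sum>\<^sub>\<infinity>q\<in>B. ennreal (a1 q * x ^ length (snd q)))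
    \<le> ennreal (K * (1 + x) ^ 6) * of_nat (core_mult W) *
      (\<Sum>\<^sub>\<infinity>p\<in>A. ennreal (a0 p * (x\<^sup>2 + x ^ 3) ^ length (snd p)))"
proof -
  interpret F: qt_cubic_graph "fisher G" by (rule qt_cubic_fisher)
  have W1: "fundamental_domain (fisher G) (fisher_verts G W)" by (rule fundamental_domain_fisher[OF W])
  let ?C = "\<lambda>p. {c :: bool list. length c = length (snd p)}"
  let ?X = "incident_edges (fisher G) (fisher_verts G W)"
  let ?w = "\<lambda>(p, c). ennreal (a0 p * x ^ (2 * length (snd p) + length (filter (\<lambda>b. b) c)))"
  have fin: "finite {c :: bool list. length c = n}" for n
    using finite_lists_length_eq[of "UNIV :: bool set" n] by simp
  obtain he hs hc where h: "\<And>q. q \<in> B \<Longrightarrow> fisher_core q (he q) (hs q) (hc q) \<and> (he q, hs q) \<in> A \<and>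
      a1 q \<le> K * a0 (he q, hs q)" using core by metis
  define H where "H q = ((he q, hs q), hc q)" for q
  have "(\<Sum>\<^sub>\<infinity>q\<in>B. ennreal (a1 q * x ^ length (snd q)))
      \<le> ennreal (K * (1 + x) ^ 6) * of_nat (core_mult W) * infsum ?w (Sigma A ?C)"
  proof (rule infsum_ennreal_fibre_le[where h = H])
    fix q assume q: "q \<in> B"
    have "length (hc q) = length (hs q)" using h[OF q] by (auto simp: fisher_core_def)
    then show "H q \<in> Sigma A ?C" using h[OF q] by (simp add: H_def)
    let ?k = "2 * length (hs q) + length (filter (\<lambda>b. b) (hc q))"
    have len: "?k \<le> length (snd q)" "length (snd q) \<le> ?k + 6"
      using fisher_core_length[of q "he q" "hs q" "hc q"] h[OF q] by auto
    have "x ^ length (snd q) = x ^ ?k * x ^ (length (snd q) - ?k)"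
      using len by (simp flip: power_add)
    also have "x ^ (length (snd q) - ?k) \<le> (1 + x) ^ (length (snd q) - ?k)"
      using x by (intro power_mono) auto
    also have "(1 + x) ^ (length (snd q) - ?k) \<le> (1 + x) ^ 6"
      using x len by (intro power_increasing) auto
    finally have xle: "x ^ length (snd q) \<le> x ^ ?k * (1 + x) ^ 6" using x by (simp add: mult_left_mono)
    have "a1 q * x ^ length (snd q) \<le> (K * a0 (he q, hs q)) * x ^ length (snd q)"
      using h[OF q] x by (intro mult_right_mono) auto
    also have "\<dots> \<le> (K * a0 (he q, hs q)) * (x ^ ?k * (1 + x) ^ 6)"
      using h[OF q] a0 K xle by (intro mult_left_mono) auto
    finally have "ennreal (a1 q * x ^ length (snd q)) \<le> ennreal ((K * (1 + x) ^ 6) * (a0 (he q, hs q) * x ^ ?k))"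
      by (intro ennreal_leI) (simp add: mult_ac)
    also have "\<dots> = ennreal (K * (1 + x) ^ 6) * ennreal (a0 (he q, hs q) * x ^ ?k)"
      using K x by (intro ennreal_mult') auto
    finally show "ennreal (a1 q * x ^ length (snd q)) \<le> ennreal (K * (1 + x) ^ 6) * ?w (H q)"
      by (simp add: H_def)
  next
    fix z assume z: "z \<in> Sigma A ?C"
    obtain e s c where zz: "z = ((e, s), c)" by (metis prod.exhaust)
    let ?R = "{q\<in>B. H q = z}"
    let ?I = "\<lambda>y. {t. step_walk (fisher G) y t \<and> length t \<le> 3}"
    let ?T = "Sigma ?X (\<lambda>y. ?I y) \<times> ?I (long_edge (walk_end e s))"
    let ?f = "\<lambda>((y, ini), fin). (y, ini @ lift_steps G e s c @ fin)"
    show "finite ?R \<and> card ?R \<le> core_mult W"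
    proof (cases "?R = {}")
      case False
      then obtain q0 where "q0 \<in> B" "H q0 = z" by auto
      with h[of q0] have saw: "step_saw G e s" "length c = length s" by (auto simp: H_def zz fisher_core_def)
      have we: "long_edge (walk_end e s) \<in> edges (fisher G)"
        using walk_end_edges[of G e s] saw by (auto simp: step_saw_def fisher_edges)
      have XE: "y \<in> edges (fisher G)" if "y \<in> ?X" for y using that by (auto simp: incident_edges_def)
      have sub: "?R \<subseteq> ?f ` ?T"
      proof
        fix q assume "q \<in> ?R"
        then have q: "q \<in> B" "H q = z" by auto
        obtain y t where yt: "q = (y, t)" by (cases q)
        have "fisher_core (y, t) e s c" using h[OF q(1)] q(2) by (simp add: H_def zz yt)
        then obtain ini fin where t: "t = ini @ lift_steps G e s c @ fin" "walk_end y ini = long_edge e"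
          "length ini \<le> 3" "length fin \<le> 3" by (auto simp: fisher_core_def)
        have yw: "y \<in> ?X" "step_walk (fisher G) y t" using q(1) B by (auto simp: yt step_saws_def step_saw_def)
        have "((y, ini), fin) \<in> ?T"
          using yw t walk_end_lift_steps[OF saw] by auto
        moreover have "q = ?f ((y, ini), fin)" by (simp add: yt t(1))
        ultimately show "q \<in> ?f ` ?T" by blast
      qed
      have fT: "finite ?T"
        using F.fundamental_domainD(4)[OF W1] F.short_walks_bound(1) XE we
        by (intro finite_cartesian_product finite_SigmaI) auto
      have "card ?R \<le> card (?f ` ?T)" using sub fT by (intro card_mono) auto
      also have "\<dots> \<le> card ?T" by (rule card_image_le[OF fT])
      also have "\<dots> = card (Sigma ?X ?I) * card (?I (long_edge (walk_end e s)))" by (rule card_cartesian_product)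
      also have "\<dots> \<le> (card ?X * 259) * 259"
      proof (rule mult_le_mono)
        have "card (Sigma ?X ?I) = (\<Sum>y\<in>?X. card (?I y))"
          using F.fundamental_domainD(4)[OF W1] F.short_walks_bound(1) XE by (intro card_SigmaI) blast+
        also have "\<dots> \<le> (\<Sum>y\<in>?X. 259)" using F.short_walks_bound(2) XE by (intro sum_mono) blast
        finally show "card (Sigma ?X ?I) \<le> card ?X * 259" by simp
        show "card (?I (long_edge (walk_end e s))) \<le> 259" by (rule F.short_walks_bound(2)[OF we])
      qed
      finally have "card ?R \<le> core_mult W" by (simp only: core_mult_def)
      moreover have "finite ?R" using sub fT finite_subset finite_imageI by blast
      ultimately show ?thesis by blast
    next
      case True
      show ?thesis unfolding True by simp
    qed
  qed
  also have "infsum ?w (Sigma A ?C) = (\<Sum>\<^sub>\<infinity>p\<in>A. \<Sum>c\<in>?C p. ?w (p, c))"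
    by (rule infsum_ennreal_Sigma_finite[symmetric]) (rule fin)
  also have "\<dots> = (\<Sum>\<^sub>\<infinity>p\<in>A. ennreal (a0 p * (x\<^sup>2 + x ^ 3) ^ length (snd p)))"
  proof (rule infsum_cong)
    fix p assume p: "p \<in> A"
    have "(\<Sum>c\<in>?C p. ?w (p, c)) = ennreal (\<Sum>c\<in>?C p. a0 p * x ^ (2 * length (snd p) + length (filter (\<lambda>b. b) c)))"
      using x a0[OF p] by (simp add: sum_ennreal)
    also have "\<dots> = ennreal (a0 p * (x\<^sup>2 + x ^ 3) ^ length (snd p))"
      unfolding sum_bool_lists_power[symmetric] sum_distrib_left ..
    finally show "(\<Sum>c\<in>?C p. ?w (p, c)) = ennreal (a0 p * (x\<^sup>2 + x ^ 3) ^ length (snd p))" .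
  qed
  finally show ?thesis .
qed

text \<open>The common source of the results on \<mu>, \<gamma> and \<nu>: \<open>\<rho>\<close>
  depends on the length, while \<open>D0\<close> and \<open>D1\<close> are quantities such as
  squared distances. Empty walks are left out so that lengths of corresponding walks stay within a
  factor of 9.\<close>

lemma weighted_sums_iff:
  fixes D0 :: "'a set \<times> ('a \<times> 'a set) list \<Rightarrow> real"
    and D1 :: "('a \<times> 'a) set \<times> (('a \<times> 'a) \<times> ('a \<times> 'a) set) list \<Rightarrow> real"
  assumes W: "fundamental_domain G W" and x: "0 \<le> x" and C: "0 \<le> C"
    and \<rho>: "\<And>n. 1 \<le> n \<Longrightarrow> 0 < \<rho> n"
    and K: "0 \<le> K" "\<And>n m. 1 \<le> n \<Longrightarrow> n \<le> m \<Longrightarrow> m \<le> 9 * n \<Longrightarrow> \<rho> m \<le> K * \<rho> n \<and> \<rho> n \<le> K * \<rho> m"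
    and D: "\<And>p. 0 \<le> D0 p" "\<And>q. 0 \<le> D1 q"
    and D10: "\<And>q e s c. fisher_core q e s c \<Longrightarrow> q \<in> step_saws (fisher G) (fisher_verts G W) \<Longrightarrow> s \<noteq> [] \<Longrightarrow>
      D1 q \<le> C * D0 (e, s)"
    and D01: "\<And>e s c. step_saw G e s \<Longrightarrow> length c = length s \<Longrightarrow> s \<noteq> [] \<Longrightarrow>
      D0 (e, s) \<le> C * D1 (long_edge e, lift_steps G e s c)"
  shows "(\<Sum>\<^sub>\<infinity>p\<in>{p\<in>step_saws G W. snd p \<noteq> []}.
      ennreal (D0 p * \<rho> (length (snd p)) * (x\<^sup>2 + x ^ 3) ^ length (snd p))) < \<infinity> \<longleftrightarrow>
    (\<Sum>\<^sub>\<infinity>q\<in>{q\<in>step_saws (fisher G) (fisher_verts G W). snd q \<noteq> []}.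
      ennreal (D1 q * \<rho> (length (snd q)) * x ^ length (snd q))) < \<infinity>"
    (is "infsum ?f0 ?A < \<infinity> \<longleftrightarrow> infsum ?f1 ?B < \<infinity>")
proof -
  have CK: "0 \<le> C * K" using C K(1) by simp
  have a0: "0 \<le> D0 p * \<rho> (length (snd p))" if "p \<in> ?A" for p
    using that D(1)[of p] \<rho>[of "length (snd p)"] by (cases "snd p") auto
  show ?thesis
  proof
    assume fin: "infsum ?f1 ?B < \<infinity>"
    have "infsum ?f0 ?A \<le> ennreal (C * K) * infsum ?f1 ?B"
    proof (rule infsum_lift_le)
      fix e s and c :: "bool list" assume es: "(e, s) \<in> ?A" "length c = length s"
      then have s: "(e, s) \<in> step_saws G W" "step_saw G e s" "s \<noteq> []" by (auto simp: step_saws_def)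
      let ?q = "(long_edge e, lift_steps G e s c)"
      have len: "length (snd ?q) = 2 * length s + length (filter (\<lambda>b. b) c)"
        using length_lift_steps[OF s(2) es(2)] by simp
      have fl: "length (filter (\<lambda>b. b) c) \<le> length s" using es(2) by (metis length_filter_le)
      have s1: "1 \<le> length s" using s(3) by (simp add: Suc_le_eq)
      have "?q \<in> ?B" using lift_in_step_saws[OF s(1) es(2)] len s(3) by auto
      moreover have "D0 (e, s) * \<rho> (length s) \<le> (C * D1 ?q) * (K * \<rho> (length (snd ?q)))"
        using D01[OF s(2) es(2) s(3)] K(2)[OF s1, of "length (snd ?q)"] len fl \<rho>[OF s1] C D s1
        by (intro mult_mono) auto
      ultimately show "?q \<in> ?B \<and> D0 (e, s) * \<rho> (length (snd (e, s))) \<le>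
          C * K * (D1 ?q * \<rho> (length (snd ?q)))" by (simp add: mult_ac)
    qed (use x CK a0 in auto)
    also have "\<dots> < \<infinity>" using fin by (simp add: ennreal_mult_less_top)
    finally show "infsum ?f0 ?A < \<infinity>" .
  next
    interpret F: qt_cubic_graph "fisher G" by (rule qt_cubic_fisher)
    assume fin: "infsum ?f0 ?A < \<infinity>"
    have W1: "fundamental_domain (fisher G) (fisher_verts G W)" by (rule fundamental_domain_fisher[OF W])
    \<comment> \<open>A walk of more than six steps has a core with a nonempty trace, to which the
      comparison applies; the shorter ones are finite in number.\<close>
    show "infsum ?f1 ?B < \<infinity>"
    proof (rule infsum_ennreal_less_top_split[where P = "\<lambda>q. length (snd q) \<le> 6"])
      have "finite {q\<in>?B. length (snd q) \<le> 6}"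
        by (rule finite_subset[OF _ F.finite_saws_le[OF W1, of 6]]) auto
      then show "infsum ?f1 {q\<in>?B. length (snd q) \<le> 6} < \<infinity>" by (rule infsum_ennreal_finite_less_top)
      have "infsum ?f1 {q\<in>?B. \<not> length (snd q) \<le> 6}
          \<le> ennreal ((C * K) * (1 + x) ^ 6) * of_nat (core_mult W) * infsum ?f0 ?A"
      proof (rule infsum_core_le[OF W])
        fix q assume q: "q \<in> {q\<in>?B. \<not> length (snd q) \<le> 6}"
        then have q': "q \<in> step_saws (fisher G) (fisher_verts G W)" "length (snd q) > 6" by auto
        from fisher_core_cases[OF q'(1)] q'(2) obtain e s c where
          esc: "fisher_core q e s c" "(e, s) \<in> step_saws G W" by auto
        have ne: "s \<noteq> []" using fisher_core_length(3)[OF esc(1)] q'(2) by auto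
        have s1: "1 \<le> length s" using ne by (simp add: Suc_le_eq)
        have "length s \<le> length (snd q)" "length (snd q) \<le> 9 * length s"
          using fisher_core_length[OF esc(1)] s1 by linarith+
        then have "\<rho> (length (snd q)) \<le> K * \<rho> (length s)" using K(2)[OF s1] by blast
        then have "D1 q * \<rho> (length (snd q)) \<le> (C * D0 (e, s)) * (K * \<rho> (length s))"
          using D10[OF esc(1) q'(1) ne] C D \<rho>[of "length (snd q)"] q'(2) by (intro mult_mono) auto
        then show "\<exists>e s c. fisher_core q e s c \<and> (e, s) \<in> ?A \<and>
            D1 q * \<rho> (length (snd q)) \<le> C * K * (D0 (e, s) * \<rho> (length (snd (e, s))))"
          using esc ne by (intro exI[of _ e] exI[of _ s] exI[of _ c]) (auto simp: mult_ac)
      qed (use x CK a0 in auto)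
      also have "\<dots> < \<infinity>" using fin by (simp add: ennreal_mult_less_top of_nat_less_top)
      finally show "infsum ?f1 {q\<in>?B. \<not> length (snd q) \<le> 6} < \<infinity>" .
    qed
  qed
qed

text \<open>Weights such as \<open>n powr y\<close> are comparable only from n = 1 on, so the
  finitely many empty walks are set aside.\<close>

lemma nonempty_saws_less_top_iff:
  assumes W: "fundamental_domain G W"
  shows "(\<Sum>\<^sub>\<infinity>p\<in>step_saws G W. ennreal (f p)) < \<infinity> \<longleftrightarrow>
    (\<Sum>\<^sub>\<infinity>p\<in>{p\<in>step_saws G W. snd p \<noteq> []}. ennreal (f p)) < \<infinity>"
proof
  assume "(\<Sum>\<^sub>\<infinity>p\<in>step_saws G W. ennreal (f p)) < \<infinity>"
  moreover have "(\<Sum>\<^sub>\<infinity>p\<in>{p\<in>step_saws G W. snd p \<noteq> []}. ennreal (f p)) \<le> (\<Sum>\<^sub>\<infinity>p\<in>step_saws G W. ennreal (f p))"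
    by (rule infsum_ennreal_mono_set) auto
  ultimately show "(\<Sum>\<^sub>\<infinity>p\<in>{p\<in>step_saws G W. snd p \<noteq> []}. ennreal (f p)) < \<infinity>" by (rule order_le_less_trans[rotated])
next
  assume *: "(\<Sum>\<^sub>\<infinity>p\<in>{p\<in>step_saws G W. snd p \<noteq> []}. ennreal (f p)) < \<infinity>"
  show "(\<Sum>\<^sub>\<infinity>p\<in>step_saws G W. ennreal (f p)) < \<infinity>"
  proof (rule infsum_ennreal_less_top_split[where P = "\<lambda>p. snd p \<noteq> []", OF *])
    have "finite {p\<in>step_saws G W. \<not> snd p \<noteq> []}"
      by (rule finite_subset[OF _ finite_saws_le[OF W, of 0]]) auto
    then show "(\<Sum>\<^sub>\<infinity>p\<in>{p\<in>step_saws G W. \<not> snd p \<noteq> []}. ennreal (f p)) < \<infinity>"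
      by (rule infsum_ennreal_finite_less_top)
  qed
qed

subsection \<open>The connective constants\<close>

lemma powr_comparable:
  fixes y :: real
  assumes "1 \<le> n" "n \<le> m" "m \<le> 9 * n"
  shows "real m powr y \<le> 9 powr \<bar>y\<bar> * real n powr y" "real n powr y \<le> 9 powr \<bar>y\<bar> * real m powr y"
proof -
  have n: "0 < real n" "0 < real m" using assms by auto
  have r: "1 \<le> real m / real n" "real m / real n \<le> 9" using assms by (auto simp: field_simps)
  have m: "real m powr y = (real m / real n) powr y * real n powr y"
    using n by (simp add: powr_divide)
  have "(real m / real n) powr y \<le> (real m / real n) powr \<bar>y\<bar>" using r by (intro powr_mono) auto
  also have "\<dots> \<le> 9 powr \<bar>y\<bar>" using r by (intro powr_mono2) auto
  finally show "real m powr y \<le> 9 powr \<bar>y\<bar> * real n powr y" unfolding m by (intro mult_right_mono) auto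
  have "(real m / real n) powr (- y) \<le> (real m / real n) powr \<bar>y\<bar>" using r by (intro powr_mono) auto
  also have "\<dots> \<le> 9 powr \<bar>y\<bar>" using r by (intro powr_mono2) auto
  finally have "(real m / real n) powr (- y) * real m powr y \<le> 9 powr \<bar>y\<bar> * real m powr y"
    by (intro mult_right_mono) auto
  moreover have "(real m / real n) powr (- y) * real m powr y = real n powr y"
    unfolding m using n by (simp add: powr_divide powr_minus field_simps)
  ultimately show "real n powr y \<le> 9 powr \<bar>y\<bar> * real m powr y" by simp
qed

lemma powr_sums_iff:
  assumes W: "fundamental_domain G W" and x: "0 \<le> x"
  shows "(\<Sum>\<^sub>\<infinity>p\<in>{p\<in>step_saws G W. snd p \<noteq> []}.
      ennreal (1 * real (length (snd p)) powr y * (x\<^sup>2 + x ^ 3) ^ length (snd p))) < \<infinity> \<longleftrightarrow>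
    (\<Sum>\<^sub>\<infinity>q\<in>{q\<in>step_saws (fisher G) (fisher_verts G W). snd q \<noteq> []}.
      ennreal (1 * real (length (snd q)) powr y * x ^ length (snd q))) < \<infinity>"
  by (rule weighted_sums_iff[OF W x, where C = 1 and K = "9 powr \<bar>y\<bar>" and \<rho> = "\<lambda>n. real n powr y"
        and ?D0.0 = "\<lambda>_. 1" and ?D1.0 = "\<lambda>_. 1"])
    (use powr_comparable in auto)

text \<open>The sums at x on the Fisher graph and at x^2 + x^3 on \<open>G\<close> converge
  together. Only convergence strictly below and divergence strictly above the critical points is
  known, so by continuity an inequality in either direction is refuted at a nearby x on the suitable
  side.\<close>

lemma inverse_connective_constant_fisher:
  "inverse (connective_constant G) =
    (inverse (connective_constant (fisher G)))\<^sup>2 + (inverse (connective_constant (fisher G))) ^ 3"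
proof -
  interpret F: qt_cubic_graph "fisher G" by (rule qt_cubic_fisher)
  obtain W where W: "fundamental_domain G W" using some_domain by blast
  have W1: "fundamental_domain (fisher G) (fisher_verts G W)" by (rule fundamental_domain_fisher[OF W])
  define t where "t = inverse F.growth"
  define r where "r = inverse growth"
  have t: "0 < t" using F.growth_ge_1 by (simp add: t_def)
  have r: "0 < r" using growth_ge_1 by (simp add: r_def)
  have iff: "(\<Sum>\<^sub>\<infinity>p\<in>step_saws G W. ennreal ((x\<^sup>2 + x ^ 3) ^ length (snd p))) < \<infinity> \<longleftrightarrow>
      (\<Sum>\<^sub>\<infinity>q\<in>step_saws (fisher G) (fisher_verts G W). ennreal (x ^ length (snd q))) < \<infinity>" if "0 \<le> x" for x
  proof -
    have "(\<Sum>\<^sub>\<infinity>p\<in>{p\<in>step_saws G W. snd p \<noteq> []}. ennreal ((x\<^sup>2 + x ^ 3) ^ length (snd p))) =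
      (\<Sum>\<^sub>\<infinity>p\<in>{p\<in>step_saws G W. snd p \<noteq> []}.
        ennreal (1 * real (length (snd p)) powr 0 * (x\<^sup>2 + x ^ 3) ^ length (snd p)))"
      by (rule infsum_cong) auto
    moreover have "(\<Sum>\<^sub>\<infinity>q\<in>{q\<in>step_saws (fisher G) (fisher_verts G W). snd q \<noteq> []}. ennreal (x ^ length (snd q))) =
      (\<Sum>\<^sub>\<infinity>q\<in>{q\<in>step_saws (fisher G) (fisher_verts G W). snd q \<noteq> []}.
        ennreal (1 * real (length (snd q)) powr 0 * x ^ length (snd q)))"
      by (rule infsum_cong) auto
    ultimately show ?thesis
      unfolding nonempty_saws_less_top_iff[OF W] F.nonempty_saws_less_top_iff[OF W1]
      using powr_sums_iff[OF W that, of 0] by simp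
  qed
  have cont: "isCont (\<lambda>x. x\<^sup>2 + x ^ 3) t" for t :: real by (intro continuous_intros)
  have "\<not> t\<^sup>2 + t ^ 3 < r"
  proof
    assume "t\<^sup>2 + t ^ 3 < r"
    then have "eventually (\<lambda>x. x\<^sup>2 + x ^ 3 < r) (at t)"
      using cont[of t] unfolding isCont_def by (intro order_tendstoD(2)) auto
    then have "eventually (\<lambda>x. x\<^sup>2 + x ^ 3 < r) (at_right t)"
      by (rule filter_leD[OF at_le, rotated]) simp
    moreover have "eventually (\<lambda>x. x > t) (at_right t)" by (rule eventually_at_right_less)
    ultimately have "eventually (\<lambda>x. x\<^sup>2 + x ^ 3 < r \<and> x > t) (at_right t)" by (rule eventually_conj)
    then obtain x where x: "x\<^sup>2 + x ^ 3 < r" "t < x"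
      using eventually_happens'[of "at_right t"] by auto
    have "0 < x\<^sup>2 + x ^ 3" using x t by (intro add_pos_pos zero_less_power) auto
    then have "(\<Sum>\<^sub>\<infinity>p\<in>step_saws G W. ennreal ((x\<^sup>2 + x ^ 3) ^ length (snd p))) < \<infinity>"
      using saw_sum_subcritical[OF W] x by (simp add: r_def)
    moreover have "(\<Sum>\<^sub>\<infinity>q\<in>step_saws (fisher G) (fisher_verts G W). ennreal (x ^ length (snd q))) = \<infinity>"
      using F.saw_sum_supercritical[OF W1] x by (simp add: t_def)
    ultimately show False using iff[of x] x t by simp
  qed
  moreover have "\<not> r < t\<^sup>2 + t ^ 3"
  proof
    assume "r < t\<^sup>2 + t ^ 3"
    then have "eventually (\<lambda>x. r < x\<^sup>2 + x ^ 3) (at t)"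
      using cont[of t] unfolding isCont_def by (intro order_tendstoD(1)) auto
    then have "eventually (\<lambda>x. r < x\<^sup>2 + x ^ 3) (at_left t)"
      by (rule filter_leD[OF at_le, rotated]) simp
    moreover have "eventually (\<lambda>x. x \<in> {0<..<t}) (at_left t)" using t by (rule eventually_at_left_real)
    ultimately have "eventually (\<lambda>x. r < x\<^sup>2 + x ^ 3 \<and> x \<in> {0<..<t}) (at_left t)" by (rule eventually_conj)
    then obtain x where x: "r < x\<^sup>2 + x ^ 3" "0 < x" "x < t"
      using eventually_happens'[of "at_left t"] by auto
    then have "(\<Sum>\<^sub>\<infinity>q\<in>step_saws (fisher G) (fisher_verts G W). ennreal (x ^ length (snd q))) < \<infinity>"
      using F.saw_sum_subcritical[OF W1] by (simp add: t_def)
    moreover have "(\<Sum>\<^sub>\<infinity>p\<in>step_saws G W. ennreal ((x\<^sup>2 + x ^ 3) ^ length (snd p))) = \<infinity>"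
      using saw_sum_supercritical[OF W] x by (simp add: r_def)
    ultimately show False using iff[of x] x by simp
  qed
  ultimately have "r = t\<^sup>2 + t ^ 3" by simp
  then show ?thesis by (simp add: connective_constant_eq F.connective_constant_eq r_def t_def)
qed

end

section \<open>The critical exponents\<close>

lemma not_less_top_iff: "\<not> (a::ennreal) < \<infinity> \<longleftrightarrow> a = \<infinity>"
  using less_top[of a] by (auto simp: infinity_ennreal_def)

lemma tendsto_infinity_ennreal_cmult:
  fixes f g :: "nat \<Rightarrow> ennreal"
  assumes f: "f \<longlonglongrightarrow> \<infinity>" and c: "c < \<infinity>" and le: "eventually (\<lambda>k. f k \<le> c * g k) sequentially"
  shows "g \<longlonglongrightarrow> \<infinity>"
proof (rule order_tendstoI)
  fix l :: ennreal assume "l < \<infinity>"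
  then have "c * l < \<infinity>" using c by (simp add: ennreal_mult_less_top)
  then have "eventually (\<lambda>k. c * l < f k) sequentially" by (rule order_tendstoD(1)[OF f])
  with le show "eventually (\<lambda>k. l < g k) sequentially"
  proof eventually_elim
    case (elim k)
    show ?case
    proof (rule ccontr)
      assume "\<not> l < g k"
      then have "c * g k \<le> c * l" by (intro mult_left_mono) auto
      then show False using elim by simp
    qed
  qed
qed simp

lemma tendsto_zero_ennreal_cmult:
  fixes f g :: "nat \<Rightarrow> ennreal"
  assumes g: "g \<longlonglongrightarrow> 0" and c: "c < \<infinity>" and le: "eventually (\<lambda>k. f k \<le> c * g k) sequentially"
  shows "f \<longlonglongrightarrow> 0"
proof (rule tendsto_sandwich[of "\<lambda>_. 0"])
  have "(\<lambda>k. c * g k) \<longlonglongrightarrow> c * 0" using c g by (intro ennreal_tendsto_cmult) auto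
  then show "(\<lambda>k. c * g k) \<longlonglongrightarrow> 0" by simp
qed (use le in auto)

context qt_cubic_graph
begin

lemma inverse_connective_constant_pos: "0 < inverse (connective_constant G)" "0 < connective_constant G"
  using growth_ge_1 by (auto simp: connective_constant_eq)

subsection \<open>The exponent \<open>\<gamma>\<close>\<close>

lemma Y_sum_conv:
  "Y_sum G W x y = (\<Sum>\<^sub>\<infinity>p\<in>step_saws G W. ennreal (x ^ length (snd p) /
     (if length (snd p) = 0 then 1 else real (length (snd p)) powr y)))"
  unfolding Y_sum_def infsum_saws by (simp cong: if_cong)

lemma Y_sum_less_top_iff:
  assumes W: "fundamental_domain G W"
  shows "Y_sum G W x y < \<infinity> \<longleftrightarrow> (\<Sum>\<^sub>\<infinity>p\<in>{p\<in>step_saws G W. snd p \<noteq> []}.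
      ennreal (1 * real (length (snd p)) powr (- y) * x ^ length (snd p))) < \<infinity>"
proof -
  have "(\<Sum>\<^sub>\<infinity>p\<in>{p\<in>step_saws G W. snd p \<noteq> []}. ennreal (x ^ length (snd p) /
     (if length (snd p) = 0 then 1 else real (length (snd p)) powr y))) =
     (\<Sum>\<^sub>\<infinity>p\<in>{p\<in>step_saws G W. snd p \<noteq> []}.
      ennreal (1 * real (length (snd p)) powr (- y) * x ^ length (snd p)))"
    by (rule infsum_cong) (auto simp: powr_minus field_simps)
  then show ?thesis unfolding Y_sum_conv nonempty_saws_less_top_iff[OF W] by simp
qed

lemma Y_sum_change_domain:
  assumes "fundamental_domain G W" "fundamental_domain G W'"
  shows "Y_sum G W' x y < \<infinity> \<longleftrightarrow> Y_sum G W x y < \<infinity>"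
  unfolding Y_sum_conv by (rule infsum_change_domain_iff[OF assms]) simp

text \<open>Reduces the exponent to convergence statements over one fixed domain, with divergence
  expressed as failure of convergence.\<close>

lemma is_gamma_iff:
  assumes W: "fundamental_domain G W"
  shows "is_gamma G g \<longleftrightarrow>
    (\<forall>y. (ereal y < g \<longrightarrow> \<not> Y_sum G W (inverse (connective_constant G)) y < \<infinity>) \<and>
         (g < ereal y \<longrightarrow> Y_sum G W (inverse (connective_constant G)) y < \<infinity>))"
  unfolding is_gamma_def not_less_top_iff[symmetric] using Y_sum_change_domain[OF W] W by blast

text \<open>Equality of the predicates makes the definite descriptions agree at once.\<close>

lemma is_gamma_fisher: "is_gamma (fisher G) = is_gamma G"
proof -
  interpret F: qt_cubic_graph "fisher G" by (rule qt_cubic_fisher)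
  note W = some_domain
  note W1 = fundamental_domain_fisher[OF W]
  have "Y_sum (fisher G) (fisher_verts G some_domain) (inverse (connective_constant (fisher G))) y < \<infinity> \<longleftrightarrow>
      Y_sum G some_domain (inverse (connective_constant G)) y < \<infinity>" for y
    unfolding Y_sum_less_top_iff[OF W] F.Y_sum_less_top_iff[OF W1] inverse_connective_constant_fisher
    by (rule powr_sums_iff[OF W, symmetric]) (rule less_imp_le[OF F.inverse_connective_constant_pos(1)])
  then show ?thesis unfolding F.is_gamma_iff[OF W1, abs_def] is_gamma_iff[OF W, abs_def] by simp
qed

subsection \<open>The exponent \<open>\<eta>\<close>\<close>

lemma Z_sum_conv:
  assumes "automorphism G \<alpha>" "W \<subseteq> verts G"
  shows "Z_sum G W \<alpha> x = (\<Sum>\<^sub>\<infinity>p\<in>{p\<in>step_saws G W. walk_end (fst p) (snd p) \<in> incident_edges G (\<alpha> ` W)}.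
    ennreal (1 * x ^ length (snd p)))"
proof -
  have "saws_to G W \<alpha> = mid_path_of ` {p\<in>step_saws G W. walk_end (fst p) (snd p) \<in> incident_edges G (\<alpha> ` W)}"
    unfolding saws_to_def automorphism_incident_edges[OF simple assms] saws_conv_step_saws by auto
  then show ?thesis unfolding Z_sum_def
    by (simp only:) (subst infsum_reindex, auto intro: inj_on_subset[OF inj_mid_path_of] simp: o_def)
qed

text \<open>Disjointness excludes the walks without a core: such a walk stays over a single vertex
  of \<open>W\<close>, which would have to lie in the translate as well.\<close>

lemma Z_sum_fisher:
  assumes W: "fundamental_domain G W" and \<alpha>: "automorphism G \<alpha>" and x: "0 \<le> x"
  shows "Z_sum G W \<alpha> (x\<^sup>2 + x ^ 3) \<le> Z_sum (fisher G) (fisher_verts G W) (map_prod \<alpha> \<alpha>) x"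
    and "W \<inter> \<alpha> ` W = {} \<Longrightarrow> Z_sum (fisher G) (fisher_verts G W) (map_prod \<alpha> \<alpha>) x
      \<le> ennreal (1 * (1 + x) ^ 6) * of_nat (core_mult W) * Z_sum G W \<alpha> (x\<^sup>2 + x ^ 3)"
proof -
  interpret F: qt_cubic_graph "fisher G" by (rule qt_cubic_fisher)
  note Wp = fundamental_domainD[OF W]
  note W1 = fundamental_domain_fisher[OF W]
  let ?F = "fisher G" and ?W = "fisher_verts G W"
  let ?A = "{p\<in>step_saws G W. walk_end (fst p) (snd p) \<in> incident_edges G (\<alpha> ` W)}"
  let ?B = "{q\<in>step_saws ?F ?W. walk_end (fst q) (snd q) \<in> incident_edges ?F (fisher_verts G (\<alpha> ` W))}"
  have Z0: "Z_sum G W \<alpha> (x\<^sup>2 + x ^ 3) = (\<Sum>\<^sub>\<infinity>p\<in>?A. ennreal (1 * (x\<^sup>2 + x ^ 3) ^ length (snd p)))"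
    by (rule Z_sum_conv[OF \<alpha> Wp(2)])
  have Z1: "Z_sum ?F ?W (map_prod \<alpha> \<alpha>) x = (\<Sum>\<^sub>\<infinity>q\<in>?B. ennreal (1 * x ^ length (snd q)))"
    using F.Z_sum_conv[OF automorphism_fisher[OF simple \<alpha>] F.fundamental_domainD(2)[OF W1]]
    unfolding fisher_verts_image[OF simple \<alpha> Wp(2)] .
  have "Z_sum G W \<alpha> (x\<^sup>2 + x ^ 3) \<le> ennreal 1 * Z_sum ?F ?W (map_prod \<alpha> \<alpha>) x"
    unfolding Z0 Z1
  proof (rule infsum_lift_le[OF _ x])
    fix e s and c :: "bool list" assume es: "(e, s) \<in> ?A" "length c = length s"
    then have s: "(e, s) \<in> step_saws G W" "step_saw G e s" by (auto simp: step_saws_def)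
    have "walk_end e s \<in> edges G" using es by (auto simp: incident_edges_def)
    then have "long_edge (walk_end e s) \<in> incident_edges ?F (fisher_verts G (\<alpha> ` W))"
      using es long_edge_incident by auto
    then show "(long_edge e, lift_steps G e s c) \<in> ?B \<and> (1::real) \<le> 1 * 1"
      using lift_in_step_saws[OF s(1) es(2)] walk_end_lift_steps[OF s(2) es(2)] by simp
  qed auto
  then show "Z_sum G W \<alpha> (x\<^sup>2 + x ^ 3) \<le> Z_sum ?F ?W (map_prod \<alpha> \<alpha>) x" by simp
  assume disj: "W \<inter> \<alpha> ` W = {}"
  show "Z_sum ?F ?W (map_prod \<alpha> \<alpha>) x
      \<le> ennreal (1 * (1 + x) ^ 6) * of_nat (core_mult W) * Z_sum G W \<alpha> (x\<^sup>2 + x ^ 3)"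
    unfolding Z0 Z1
  proof (rule infsum_core_le[OF W _ x])
    fix q assume q: "q \<in> ?B"
    then have q1: "q \<in> step_saws ?F ?W" by simp
    have qe: "fst ` walk_end (fst q) (snd q) \<inter> \<alpha> ` W \<noteq> {}" using q unfolding incident_edges_fisher by simp
    from fisher_core_cases[OF q1] show "\<exists>e s c. fisher_core q e s c \<and> (e, s) \<in> ?A \<and> (1::real) \<le> 1 * 1"
    proof (elim disjE exE conjE)
      assume "\<exists>v\<in>W. fst ` walk_end (fst q) (snd q) = {v}"
      then obtain v where v: "v \<in> W" "fst ` walk_end (fst q) (snd q) = {v}" by blast
      have "v \<in> \<alpha> ` W" using qe unfolding v(2) by simp
      with v(1) disj show ?thesis by blast
    next
      fix e s c assume c: "fisher_core q e s c" "(e, s) \<in> step_saws G W"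
        "fst ` walk_end (fst q) (snd q) \<subseteq> walk_end e s"
      have "walk_end e s \<in> edges G"
        using c(2) walk_end_edges by (auto simp: step_saws_def step_saw_def)
      moreover have "walk_end e s \<inter> \<alpha> ` W \<noteq> {}" using qe c(3) by blast
      ultimately have "(e, s) \<in> ?A" using c(2) by (simp add: incident_edges_def)
      then show ?thesis using c(1) by auto
    qed
  qed auto
qed

text \<open>A sequence on \<open>G\<close> is tested through the induced sequence
  \<open>map_prod\<close> on the Fisher graph. Distances agree up to a factor 2 and the sums up to
  constants once the distance is at least 1, which holds eventually.\<close>

lemma is_eta_fisher:
  assumes eta: "is_eta (fisher G) h"
  shows "is_eta G h"
  unfolding is_eta_def
proof (intro allI impI)
  fix W and \<alpha> :: "nat \<Rightarrow> 'a \<Rightarrow> 'a" and w :: real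
  assume W: "fundamental_domain G W" and \<alpha>: "\<forall>k. automorphism G (\<alpha> k)"
    and lim: "filterlim (\<lambda>k. set_graph_dist G W (\<alpha> k ` W)) at_top sequentially"
  interpret F: qt_cubic_graph "fisher G" by (rule qt_cubic_fisher)
  note Wp = fundamental_domainD[OF W]
  note W1 = fundamental_domain_fisher[OF W]
  let ?F = "fisher G" and ?W = "fisher_verts G W"
  define d0 where "d0 k = set_graph_dist G W (\<alpha> k ` W)" for k
  define d1 where "d1 k = set_graph_dist ?F ?W (map_prod (\<alpha> k) (\<alpha> k) ` ?W)" for k
  define x where "x = inverse (connective_constant ?F)"
  define Z0 where "Z0 k = Z_sum G W (\<alpha> k) (inverse (connective_constant G))" for k
  define Z1 where "Z1 k = Z_sum ?F ?W (map_prod (\<alpha> k) (\<alpha> k)) x" for k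
  have x0: "0 \<le> x" using F.inverse_connective_constant_pos(1) by (simp add: x_def)
  have "\<alpha> k ` verts G = verts G" for k using \<alpha> by (simp add: automorphism_def bij_betw_def)
  then have aW: "\<alpha> k ` W \<subseteq> verts G" "\<alpha> k ` W \<noteq> {}" for k using Wp(2,3) by blast+
  have d1: "d1 k = set_graph_dist ?F ?W (fisher_verts G (\<alpha> k ` W))" for k
    unfolding d1_def using fisher_verts_image[OF simple _ Wp(2)] \<alpha> by simp
  have d01: "d0 k \<le> d1 k" "1 \<le> d0 k \<Longrightarrow> d1 k \<le> 2 * d0 k" for k
    unfolding d1 d0_def using set_graph_dist_fisher[OF Wp(3) aW(2) Wp(2) aW(1)] by auto
  have lim1: "filterlim d1 at_top sequentially"
    by (rule filterlim_at_top_mono[OF lim]) (use d01(1) in \<open>auto simp: d0_def\<close>)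
  have aF: "\<forall>k. automorphism ?F (map_prod (\<alpha> k) (\<alpha> k))" using automorphism_fisher[OF simple] \<alpha> by blast
  have ev: "eventually (\<lambda>k. 1 \<le> d0 k) sequentially"
    using lim by (simp add: filterlim_at_top d0_def)
  \<comment> \<open>The two distances are within a factor 2, well inside the range of
    \<open>powr_comparable\<close>.\<close>
  define c where "c = 9 powr \<bar>w\<bar>"
  have c0: "0 \<le> c" by (simp add: c_def)
  have pw: "real (d0 k) powr w \<le> c * real (d1 k) powr w" "real (d1 k) powr w \<le> c * real (d0 k) powr w"
    if "1 \<le> d0 k" for k
    using powr_comparable[OF that d01(1)[of k], of w] d01(2)[OF that] that unfolding c_def by auto
  have Z: "Z0 k \<le> Z1 k" for k
    unfolding Z0_def Z1_def inverse_connective_constant_fisher x_def[symmetric]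
    by (rule Z_sum_fisher(1)[OF W \<alpha>[rule_format] x0])
  define M where "M = ennreal (1 * (1 + x) ^ 6) * of_nat (core_mult W)"
  have M: "M < \<infinity>" by (simp add: M_def ennreal_mult_less_top of_nat_less_top)
  have Z': "Z1 k \<le> M * Z0 k" if "1 \<le> d0 k" for k
  proof -
    have "W \<inter> \<alpha> k ` W = {}"
    proof (rule ccontr)
      assume "W \<inter> \<alpha> k ` W \<noteq> {}"
      then obtain v where "v \<in> W" "v \<in> \<alpha> k ` W" by blast
      then have "d0 k \<le> 0" unfolding d0_def by (rule set_graph_dist_le) simp
      then show False using that by simp
    qed
    then show ?thesis
      unfolding Z0_def Z1_def M_def inverse_connective_constant_fisher x_def[symmetric]
      by (rule Z_sum_fisher(2)[OF W \<alpha>[rule_format] x0])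
  qed
  have E: "(ereal w < h \<longrightarrow> (\<lambda>k. Z1 k * ennreal (real (d1 k) powr w)) \<longlonglongrightarrow> 0) \<and>
      (h < ereal w \<longrightarrow> (\<lambda>k. Z1 k * ennreal (real (d1 k) powr w)) \<longlonglongrightarrow> \<infinity>)"
    using eta[unfolded is_eta_def, THEN spec[of _ ?W], THEN spec[of _ "\<lambda>k. map_prod (\<alpha> k) (\<alpha> k)"],
        THEN mp, OF W1, THEN mp, OF aF, THEN mp, OF lim1[unfolded d1_def[abs_def]], THEN spec[of _ w]]
    unfolding Z1_def d1_def x_def .
  have le0: "eventually (\<lambda>k. Z0 k * ennreal (real (d0 k) powr w) \<le>
      ennreal c * (Z1 k * ennreal (real (d1 k) powr w))) sequentially"
    using ev
  proof eventually_elim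
    case (elim k)
    have "Z0 k * ennreal (real (d0 k) powr w) \<le> Z1 k * ennreal (c * real (d1 k) powr w)"
      using Z pw[OF elim] by (intro mult_mono ennreal_leI) auto
    then show ?case using c0 by (simp add: ennreal_mult' mult_ac)
  qed
  have le1: "eventually (\<lambda>k. Z1 k * ennreal (real (d1 k) powr w) \<le>
      (M * ennreal c) * (Z0 k * ennreal (real (d0 k) powr w))) sequentially"
    using ev
  proof eventually_elim
    case (elim k)
    have "Z1 k * ennreal (real (d1 k) powr w) \<le> (M * Z0 k) * ennreal (c * real (d0 k) powr w)"
      using Z'[OF elim] pw[OF elim] by (intro mult_mono ennreal_leI) auto
    then show ?case using c0 by (simp add: ennreal_mult' mult_ac)
  qed
  have cM: "M * ennreal c < \<infinity>" using M by (simp add: ennreal_mult_less_top)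
  have "(ereal w < h \<longrightarrow> (\<lambda>k. Z0 k * ennreal (real (d0 k) powr w)) \<longlonglongrightarrow> 0) \<and>
      (h < ereal w \<longrightarrow> (\<lambda>k. Z0 k * ennreal (real (d0 k) powr w)) \<longlonglongrightarrow> \<infinity>)"
    using E tendsto_zero_ennreal_cmult[OF _ _ le0] tendsto_infinity_ennreal_cmult[OF _ cM le1] by simp
  then show "(ereal w < h \<longrightarrow>
          (\<lambda>k. Z_sum G W (\<alpha> k) (inverse (connective_constant G)) *
               ennreal (real (set_graph_dist G W (\<alpha> k ` W)) powr w)) \<longlonglongrightarrow> 0) \<and>
    (h < ereal w \<longrightarrow>
          (\<lambda>k. Z_sum G W (\<alpha> k) (inverse (connective_constant G)) *
               ennreal (real (set_graph_dist G W (\<alpha> k ` W)) powr w)) \<longlonglongrightarrow> \<infinity>)"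
    unfolding Z0_def d0_def .
qed

text \<open>For a \<open>w\<close> strictly between two candidates, one sequence of far
  automorphisms would tend both to 0 and to infinity.\<close>

lemma is_eta_unique:
  assumes "is_eta G h" "is_eta G h'"
  shows "h = h'"
proof -
  have "\<not> h1 < h2" if eta: "is_eta G h1" "is_eta G h2" for h1 h2
  proof
    assume "h1 < h2"
    then obtain w where w: "h1 < ereal w" "ereal w < h2" using ereal_dense2 by blast
    note W = some_domain
    from ex_far_automorphism[OF W] obtain \<alpha> where
      \<alpha>: "\<And>k. automorphism G (\<alpha> k)" "\<And>k. k \<le> set_graph_dist G some_domain (\<alpha> k ` some_domain)" by metis
    have lim: "filterlim (\<lambda>k. set_graph_dist G some_domain (\<alpha> k ` some_domain)) at_top sequentially"
      by (rule filterlim_at_top_mono[OF filterlim_ident]) (use \<alpha>(2) in auto)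
    let ?f = "\<lambda>k. Z_sum G some_domain (\<alpha> k) (inverse (connective_constant G)) *
               ennreal (real (set_graph_dist G some_domain (\<alpha> k ` some_domain)) powr w)"
    have "?f \<longlonglongrightarrow> \<infinity>" using eta(1) W \<alpha>(1) lim w(1) unfolding is_eta_def by blast
    moreover have "?f \<longlonglongrightarrow> 0" using eta(2) W \<alpha>(1) lim w(2) unfolding is_eta_def by blast
    ultimately have "(\<infinity>::ennreal) = 0" by (rule LIMSEQ_unique)
    then show False by simp
  qed
  then show ?thesis using assms by (meson linorder_neqE)
qed

lemma eta_exponent_eqI: "is_eta G h \<Longrightarrow> eta_exponent G = h"
  unfolding eta_exponent_def using is_eta_unique by blast

subsection \<open>The exponent \<open>\<nu>\<close>\<close>

text \<open>The share of a single walk in V(z) when the averages are spread over the walks.\<close>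

abbreviation V_term :: "'a set \<Rightarrow> real \<Rightarrow> 'a set \<times> ('a \<times> 'a set) list \<Rightarrow> real" where
  "V_term W z p \<equiv> (real (mid_dist G (fst p) (walk_end (fst p) (snd p))))\<^sup>2 *
     (real (length (snd p)) powr (- (2 * z + 1)) / real (card (saws_len G W (length (snd p)))))"

lemma V_sum_conv:
  assumes W: "fundamental_domain G W"
  shows "V_sum G W z = (\<Sum>\<^sub>\<infinity>p\<in>{p\<in>step_saws G W. snd p \<noteq> []}. ennreal (V_term W z p))"
proof -
  let ?A = "{p\<in>step_saws G W. snd p \<noteq> []}"
  have An: "{p\<in>?A. length (snd p) = n} = saws_len G W n" if "n \<in> {1..}" for n using that by auto
  have fin: "finite {p\<in>?A. length (snd p) = n}" for n
    by (rule finite_subset[OF _ finite_saws_len[OF W, of n]]) auto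
  have "(\<Sum>\<^sub>\<infinity>p\<in>?A. ennreal (V_term W z p)) =
      (\<Sum>\<^sub>\<infinity>n\<in>{1..}. \<Sum>p\<in>{p\<in>?A. length (snd p) = n}. ennreal (V_term W z p))"
    by (rule infsum_ennreal_by_nat[OF fin]) (auto simp: Suc_le_eq)
  also have "\<dots> = (\<Sum>\<^sub>\<infinity>n\<in>{1..}. ennreal (real n powr (- (2 * z + 1)) * mean_square_dist G W n))"
  proof (rule infsum_cong)
    fix n :: nat assume n: "n \<in> {1..}"
    have "(\<Sum>p\<in>{p\<in>?A. length (snd p) = n}. ennreal (V_term W z p)) =
        ennreal (\<Sum>p\<in>saws_len G W n. V_term W z p)"
      unfolding An[OF n] by (rule sum_ennreal) auto
    also have "(\<Sum>p\<in>saws_len G W n. V_term W z p) = (\<Sum>p\<in>saws_len G W n.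
        (real (mid_dist G (fst p) (walk_end (fst p) (snd p))))\<^sup>2) *
        (real n powr (- (2 * z + 1)) / real (card (saws_len G W n)))"
      unfolding sum_distrib_right by (rule sum.cong) auto
    also have "(\<Sum>p\<in>saws_len G W n. (real (mid_dist G (fst p) (walk_end (fst p) (snd p))))\<^sup>2) =
        (\<Sum>\<pi>\<in>saws_n G W n. (real (endpoint_dist G \<pi>))\<^sup>2)"
      unfolding saws_n_conv
      by (subst sum.reindex[OF inj_on_subset[OF inj_mid_path_of subset_UNIV]]) (simp add: endpoint_dist_def)
    finally show "(\<Sum>p\<in>{p\<in>?A. length (snd p) = n}. ennreal (V_term W z p)) =
        ennreal (real n powr (- (2 * z + 1)) * mean_square_dist G W n)"
      by (simp add: mean_square_dist_def card_saws_n mult_ac)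
  qed
  finally show ?thesis by (simp add: V_sum_def)
qed

lemma card_saws_len_change_domain:
  assumes "fundamental_domain G W" "fundamental_domain G W'"
  shows "card (saws_len G W' n) \<le> card (incident_edges G W') * card (saws_len G W n)"
proof -
  let ?F = "\<lambda>p :: 'a set \<times> ('a \<times> 'a set) list. if length (snd p) = n then 1 else 0 :: ennreal"
  have *: "infsum ?F (step_saws G V) = of_nat (card (saws_len G V n))" if "fundamental_domain G V" for V
  proof -
    have "infsum ?F (step_saws G V) = infsum (\<lambda>_. 1) (saws_len G V n)"
      by (rule infsum_cong_neutral) auto
    then show ?thesis using finite_saws_len[OF that] by simp
  qed
  have "infsum ?F (step_saws G W') \<le> of_nat (card (incident_edges G W')) * infsum ?F (step_saws G W)"
    by (rule infsum_change_domain[OF assms]) simp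
  then have "(of_nat (card (saws_len G W' n)) :: ennreal) \<le>
      of_nat (card (incident_edges G W') * card (saws_len G W n))"
    unfolding *[OF assms(1)] *[OF assms(2)] by simp
  then show ?thesis by (simp only: of_nat_le_iff)
qed

text \<open>The domain enters twice. The walks are exchanged first, with the counts of
  \<open>W\<close> kept in the denominators so that the summand is invariant under automorphisms;
  then the denominators are exchanged by comparing the counts.\<close>

lemma V_sum_change_domain:
  assumes W: "fundamental_domain G W" "fundamental_domain G W'" and fin: "V_sum G W z < \<infinity>"
  shows "V_sum G W' z < \<infinity>"
proof -
  have "(\<Sum>\<^sub>\<infinity>p\<in>step_saws G W. ennreal (V_term W z p)) < \<infinity>"
    using fin unfolding V_sum_conv[OF W(1)] nonempty_saws_less_top_iff[OF W(1)] .
  then have "(\<Sum>\<^sub>\<infinity>p\<in>step_saws G W'. ennreal (V_term W z p)) < \<infinity>"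
  proof (subst infsum_change_domain_iff[OF W])
    fix \<alpha> e s assume a: "automorphism G \<alpha>" "step_saw G e s"
    have "mid_dist G (\<alpha> ` e) (walk_end (\<alpha> ` e) (map_steps \<alpha> s)) = mid_dist G e (walk_end e s)"
      unfolding walk_end_map_steps using a by (intro mid_dist_automorphism[OF simple]) (auto simp: step_saw_def)
    then show "ennreal (V_term W z (\<alpha> ` e, map_steps \<alpha> s)) = ennreal (V_term W z (e, s))" by simp
  qed
  then have fin': "(\<Sum>\<^sub>\<infinity>p\<in>{p\<in>step_saws G W'. snd p \<noteq> []}. ennreal (V_term W z p)) < \<infinity>"
    unfolding nonempty_saws_less_top_iff[OF W(2)] .
  let ?X = "real (card (incident_edges G W))"
  have inv: "1 / real (card (saws_len G W' n)) \<le> ?X * (1 / real (card (saws_len G W n)))" for n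
  proof (cases "card (saws_len G W' n) = 0")
    case False
    then have pos: "0 < card (saws_len G W' n)" "0 < card (saws_len G W n)"
      using card_saws_len_change_domain[OF W, of n] by (auto intro: Nat.gr0I)
    have "real (card (saws_len G W n)) \<le> real (card (incident_edges G W) * card (saws_len G W' n))"
      by (rule of_nat_mono[OF card_saws_len_change_domain[OF W(2,1)]])
    then show ?thesis using pos by (simp add: field_simps)
  qed simp
  show ?thesis unfolding V_sum_conv[OF W(2)]
  proof (rule infsum_ennreal_less_top_mono[OF fin'])
    fix p
    let ?n = "length (snd p)" and ?d = "(real (mid_dist G (fst p) (walk_end (fst p) (snd p))))\<^sup>2"
    have "?d * real ?n powr (- (2 * z + 1)) * (1 / real (card (saws_len G W' ?n)))
        \<le> ?d * real ?n powr (- (2 * z + 1)) * (?X * (1 / real (card (saws_len G W ?n))))"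
      using inv by (intro mult_left_mono) auto
    then show "V_term W' z p \<le> ?X * V_term W z p" by (simp add: mult_ac)
  qed simp
qed

lemma is_nu_iff:
  assumes W: "fundamental_domain G W"
  shows "is_nu G v \<longleftrightarrow> (\<forall>z. (ereal z < v \<longrightarrow> \<not> V_sum G W z < \<infinity>) \<and> (v < ereal z \<longrightarrow> V_sum G W z < \<infinity>))"
  unfolding is_nu_def not_less_top_iff[symmetric] using V_sum_change_domain W by blast

lemma card_saws_len_pos:
  assumes W: "fundamental_domain G W" and n: "1 \<le> n"
  shows "0 < card (saws_len G W n)"
proof -
  obtain v where v: "v \<in> W" "v \<in> verts G" using fundamental_domainD[OF W] by auto
  have "1 \<le> real (card (saws_len G W (Suc (n - 1))))"
    using saw_count_ge_1[OF v(2)] saw_count_le_card[OF W v(1)] by (rule order_trans)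
  then show ?thesis using n by simp
qed

text \<open>Replaces the number of walks in the denominator by its assumed order of magnitude. The
  exponent is -(2z + 1) - (g - 1) = -2z - g, and the power of the connective constant moves to the
  numerator as the critical weight.\<close>

lemma V_sum_less_top_iff:
  assumes W: "fundamental_domain G W" and C: "0 < C1" "0 < C2" and L: "\<And>n::nat. 1 \<le> n \<Longrightarrow> 0 < L (real n)"
    and bounds: "\<And>n. 1 \<le> n \<Longrightarrow> C1 * L (real n) * real n powr (g - 1) * connective_constant G ^ n
        \<le> real (card (saws_n G W n)) \<and>
      real (card (saws_n G W n)) \<le> C2 * L (real n) * real n powr (g - 1) * connective_constant G ^ n"
  shows "V_sum G W z < \<infinity> \<longleftrightarrow> (\<Sum>\<^sub>\<infinity>p\<in>{p\<in>step_saws G W. snd p \<noteq> []}.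
      ennreal ((real (mid_dist G (fst p) (walk_end (fst p) (snd p))))\<^sup>2 *
        (real (length (snd p)) powr (- 2 * z - g) / L (real (length (snd p)))) *
        inverse (connective_constant G) ^ length (snd p))) < \<infinity>"
proof -
  let ?A = "{p\<in>step_saws G W. snd p \<noteq> []}"
  let ?d = "\<lambda>p. (real (mid_dist G (fst p) (walk_end (fst p) (snd p))))\<^sup>2"
  let ?r = "\<lambda>n. real n powr (- 2 * z - g) / L (real n) * inverse (connective_constant G) ^ n"
  have rel: "real n powr (- (2 * z + 1)) / real (card (saws_len G W n)) \<le> (1 / C1) * ?r n \<and>
      ?r n \<le> C2 * (real n powr (- (2 * z + 1)) / real (card (saws_len G W n)))" if n: "1 \<le> n" for n :: nat
  proof -
    define M where "M = L (real n) * real n powr (g - 1) * connective_constant G ^ n"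
    have M: "0 < M" unfolding M_def using L[OF n] n inverse_connective_constant_pos(2) by simp
    have b: "C1 * M \<le> real (card (saws_len G W n))" "real (card (saws_len G W n)) \<le> C2 * M"
      using bounds[OF n] unfolding M_def card_saws_n by (auto simp: mult_ac)
    have c0: "0 < real (card (saws_len G W n))" using card_saws_len_pos[OF W n] by simp
    have "real n powr (- 2 * z - g) = real n powr (- (2 * z + 1)) / real n powr (g - 1)"
      by (simp add: powr_diff[symmetric])
    then have r: "?r n = real n powr (- (2 * z + 1)) / M"
      unfolding M_def by (simp add: power_inverse divide_inverse)
    have "real n powr (- (2 * z + 1)) / real (card (saws_len G W n)) \<le> real n powr (- (2 * z + 1)) / (C1 * M)"
      using b(1) M C c0 by (intro divide_left_mono) auto
    moreover have "C2 * (real n powr (- (2 * z + 1)) / (C2 * M))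
        \<le> C2 * (real n powr (- (2 * z + 1)) / real (card (saws_len G W n)))"
      using b(2) M C c0 by (intro mult_left_mono divide_left_mono) auto
    moreover have "C2 * (real n powr (- (2 * z + 1)) / (C2 * M)) = real n powr (- (2 * z + 1)) / M"
      using C by simp
    ultimately show ?thesis unfolding r by simp
  qed
  have len: "1 \<le> length (snd p)" if "p \<in> ?A" for p using that by (auto simp: Suc_le_eq)
  show ?thesis unfolding V_sum_conv[OF W]
  proof
    assume "(\<Sum>\<^sub>\<infinity>p\<in>?A. ennreal (V_term W z p)) < \<infinity>"
    then show "(\<Sum>\<^sub>\<infinity>p\<in>?A. ennreal (?d p * (real (length (snd p)) powr (- 2 * z - g) / L (real (length (snd p)))) *
        inverse (connective_constant G) ^ length (snd p))) < \<infinity>"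
    proof (rule infsum_ennreal_less_top_mono[where C = C2])
      fix p assume "p \<in> ?A"
      from mult_left_mono[OF rel[OF len[OF this], THEN conjunct2], of "?d p"]
      show "?d p * (real (length (snd p)) powr (- 2 * z - g) / L (real (length (snd p)))) *
        inverse (connective_constant G) ^ length (snd p) \<le> C2 * V_term W z p" by (simp add: mult_ac)
    qed (use C in auto)
  next
    assume "(\<Sum>\<^sub>\<infinity>p\<in>?A. ennreal (?d p * (real (length (snd p)) powr (- 2 * z - g) / L (real (length (snd p)))) *
        inverse (connective_constant G) ^ length (snd p))) < \<infinity>"
    then show "(\<Sum>\<^sub>\<infinity>p\<in>?A. ennreal (V_term W z p)) < \<infinity>"
    proof (rule infsum_ennreal_less_top_mono[where C = "1 / C1"])
      fix p assume "p \<in> ?A"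
      from mult_left_mono[OF rel[OF len[OF this], THEN conjunct1], of "?d p"]
      show "V_term W z p \<le> 1 / C1 * (?d p * (real (length (snd p)) powr (- 2 * z - g) / L (real (length (snd p)))) *
        inverse (connective_constant G) ^ length (snd p))" by (simp add: mult_ac)
    qed (use C in auto)
  qed
qed

text \<open>After the replacement both sums have the shape of \<open>weighted_sums_iff\<close>, with
  the squared endpoint distance as \<open>D0\<close>, \<open>D1\<close>. Sharing \<open>g\<close>
  and \<open>L\<close> lets one \<open>\<rho>\<close> serve both graphs.\<close>

lemma is_nu_fisher:
  assumes W: "fundamental_domain G W" and L: "slowly_varying L"
    and C: "0 < C10" "0 < C20" "0 < C11" "0 < C21"
    and bounds0: "\<And>n. 1 \<le> n \<Longrightarrow> C10 * L (real n) * real n powr (g - 1) * connective_constant G ^ n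
        \<le> real (card (saws_n G W n)) \<and>
      real (card (saws_n G W n)) \<le> C20 * L (real n) * real n powr (g - 1) * connective_constant G ^ n"
    and bounds1: "\<And>n. 1 \<le> n \<Longrightarrow> C11 * L (real n) * real n powr (g - 1) * connective_constant (fisher G) ^ n
        \<le> real (card (saws_n (fisher G) (fisher_verts G W) n)) \<and>
      real (card (saws_n (fisher G) (fisher_verts G W) n))
        \<le> C21 * L (real n) * real n powr (g - 1) * connective_constant (fisher G) ^ n"
  shows "is_nu (fisher G) = is_nu G"
proof -
  interpret F: qt_cubic_graph "fisher G" by (rule qt_cubic_fisher)
  note W1 = fundamental_domain_fisher[OF W]
  \<comment> \<open>Slow variation gives positivity only far out; at every positive integer it
    follows from the upper bound, since walks of each length exist.\<close>
  have Lpos: "0 < L (real n)" if n: "1 \<le> n" for n :: nat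
  proof -
    have "0 < real (card (saws_n G W n))" using card_saws_len_pos[OF W n] by (simp add: card_saws_n)
    also have "\<dots> \<le> (C20 * real n powr (g - 1) * connective_constant G ^ n) * L (real n)"
      using bounds0[OF n] by (simp add: mult_ac)
    finally have "0 < (C20 * real n powr (g - 1) * connective_constant G ^ n) * L (real n)" .
    moreover have "0 < C20 * real n powr (g - 1) * connective_constant G ^ n"
      using C n inverse_connective_constant_pos(2) by simp
    ultimately show ?thesis by (rule zero_less_mult_pos)
  qed
  obtain K where K: "0 < K" "\<And>n m::nat. 1 \<le> n \<Longrightarrow> n \<le> m \<Longrightarrow> m \<le> 9 * n \<Longrightarrow>
      L (real m) \<le> K * L (real n) \<and> L (real n) \<le> K * L (real m)"
    using slowly_varying_nat_bounded[OF L Lpos] by blast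
  have "V_sum (fisher G) (fisher_verts G W) z < \<infinity> \<longleftrightarrow> V_sum G W z < \<infinity>" for z
  proof -
    let ?\<rho> = "\<lambda>n::nat. real n powr (- 2 * z - g) / L (real n)"
    define c where "c = 9 powr \<bar>- 2 * z - g\<bar>"
    have \<rho>: "?\<rho> m \<le> (c * K) * ?\<rho> n \<and> ?\<rho> n \<le> (c * K) * ?\<rho> m" if nm: "1 \<le> n" "n \<le> m" "m \<le> 9 * n" for n m
    proof -
      have p: "0 < L (real n)" "0 < L (real m)" using Lpos nm by auto
      have inv: "1 / L (real m) \<le> K * (1 / L (real n))" "1 / L (real n) \<le> K * (1 / L (real m))"
        using K(2)[OF nm] p by (auto simp: field_simps)
      note pw = powr_comparable[OF nm, of "- 2 * z - g", folded c_def]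
      have "real m powr (- 2 * z - g) * (1 / L (real m)) \<le> (c * real n powr (- 2 * z - g)) * (K * (1 / L (real n)))"
        using pw inv p by (intro mult_mono) (auto simp: c_def)
      moreover have "real n powr (- 2 * z - g) * (1 / L (real n)) \<le> (c * real m powr (- 2 * z - g)) * (K * (1 / L (real m)))"
        using pw inv p by (intro mult_mono) (auto simp: c_def)
      ultimately show ?thesis by (simp add: mult_ac)
    qed
    let ?x = "inverse (connective_constant (fisher G))"
    have "V_sum G W z < \<infinity> \<longleftrightarrow> (\<Sum>\<^sub>\<infinity>p\<in>{p\<in>step_saws G W. snd p \<noteq> []}.
      ennreal ((real (mid_dist G (fst p) (walk_end (fst p) (snd p))))\<^sup>2 * ?\<rho> (length (snd p)) *
        (?x\<^sup>2 + ?x ^ 3) ^ length (snd p))) < \<infinity>"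
      using V_sum_less_top_iff[OF W C(1,2) Lpos bounds0] unfolding inverse_connective_constant_fisher .
    also have "\<dots> \<longleftrightarrow> (\<Sum>\<^sub>\<infinity>q\<in>{q\<in>step_saws (fisher G) (fisher_verts G W). snd q \<noteq> []}.
      ennreal ((real (mid_dist (fisher G) (fst q) (walk_end (fst q) (snd q))))\<^sup>2 * ?\<rho> (length (snd q)) *
        ?x ^ length (snd q))) < \<infinity>"
    \<comment> \<open>With d \<ge> 1 the distance bound 6 + 2d is at most 8d, and 64 is the square
      of 8.\<close>
    proof (rule weighted_sums_iff[OF W, where C = 64 and K = "c * K" and \<rho> = ?\<rho>
        and ?D0.0 = "\<lambda>p. (real (mid_dist G (fst p) (walk_end (fst p) (snd p))))\<^sup>2"
        and ?D1.0 = "\<lambda>q. (real (mid_dist (fisher G) (fst q) (walk_end (fst q) (snd q))))\<^sup>2"])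
      show "0 \<le> ?x" using F.inverse_connective_constant_pos(1) by simp
      show "0 < ?\<rho> n" if "1 \<le> n" for n using Lpos[OF that] that by simp
      show "0 \<le> c * K" using K(1) by (simp add: c_def)
      show "?\<rho> m \<le> c * K * ?\<rho> n \<and> ?\<rho> n \<le> c * K * ?\<rho> m" if "1 \<le> n" "n \<le> m" "m \<le> 9 * n" for n m
        by (rule \<rho>[OF that])
    next
      fix q e s c
      assume q: "fisher_core q e s c" "q \<in> step_saws (fisher G) (fisher_verts G W)" "s \<noteq> []"
      from q(1)[unfolded fisher_core_def] obtain ini fin where i: "snd q = ini @ lift_steps G e s c @ fin" "walk_end (fst q) ini = long_edge e"
        "step_saw G e s" "length c = length s" "length ini \<le> 3" "length fin \<le> 3"
        by (elim exE conjE) (rule that, assumption+)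
      have "step_saw (fisher G) (fst q) (ini @ lift_steps G e s c @ fin)"
        using q(2) i(1) by (auto simp: step_saws_def)
      from mid_dist_fisher_le[OF this i(2-6)]
      have "mid_dist (fisher G) (fst q) (walk_end (fst q) (snd q)) \<le> 6 + 2 * mid_dist G e (walk_end e s)"
        by (simp only: i(1))
      also have "\<dots> \<le> 8 * mid_dist G e (walk_end e s)" using mid_dist_saw_pos[OF i(3) q(3)] by simp
      finally have "real (mid_dist (fisher G) (fst q) (walk_end (fst q) (snd q))) \<le> real (8 * mid_dist G e (walk_end e s))"
        by (rule of_nat_mono)
      then have "(real (mid_dist (fisher G) (fst q) (walk_end (fst q) (snd q))))\<^sup>2 \<le> (real (8 * mid_dist G e (walk_end e s)))\<^sup>2"
        by (intro power_mono) auto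
      then show "(real (mid_dist (fisher G) (fst q) (walk_end (fst q) (snd q))))\<^sup>2
          \<le> 64 * (real (mid_dist G (fst (e, s)) (walk_end (fst (e, s)) (snd (e, s)))))\<^sup>2"
        by (simp add: power_mult_distrib)
    next
      fix e s and c :: "bool list" assume s: "step_saw G e s" "length c = length s" "s \<noteq> []"
      have e: "e \<in> edges G" "walk_end e s \<in> edges G" using s(1) walk_end_edges by (auto simp: step_saw_def)
      have "step_walk (fisher G) (long_edge e) (lift_steps G e s c)"
        using lift_steps_saw[OF s(1,2)] by (simp add: step_saw_def)
      from mid_dist_fisher_ge[OF e this walk_end_lift_steps[OF s(1,2)]]
      have "real (mid_dist G e (walk_end e s)) \<le> real (mid_dist (fisher G) (long_edge e) (long_edge (walk_end e s)))"
        by (rule of_nat_mono)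
      then have "(real (mid_dist G e (walk_end e s)))\<^sup>2 \<le> (real (mid_dist (fisher G) (long_edge e) (long_edge (walk_end e s))))\<^sup>2"
        by (intro power_mono) auto
      also have "\<dots> \<le> 64 * (real (mid_dist (fisher G) (long_edge e) (long_edge (walk_end e s))))\<^sup>2" by simp
      finally show "(real (mid_dist G (fst (e, s)) (walk_end (fst (e, s)) (snd (e, s)))))\<^sup>2
          \<le> 64 * (real (mid_dist (fisher G) (fst (long_edge e, lift_steps G e s c))
             (walk_end (fst (long_edge e, lift_steps G e s c)) (snd (long_edge e, lift_steps G e s c)))))\<^sup>2"
        using walk_end_lift_steps[OF s(1,2)] by simp
    qed auto
    also have "\<dots> \<longleftrightarrow> V_sum (fisher G) (fisher_verts G W) z < \<infinity>"
      using F.V_sum_less_top_iff[OF W1 C(3,4) Lpos bounds1, symmetric] .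
    finally show ?thesis by simp
  qed
  then show ?thesis unfolding F.is_nu_iff[OF W1, abs_def] is_nu_iff[OF W, abs_def] by simp
qed

end

theorem theorem3p2:
  fixes G0 :: "'a ugraph" and G1 :: "('a \<times> 'a) ugraph"
  assumes "simple_graph G0"
    and "infinite (verts G0)"
    and "connected_graph G0"
    and "cubic G0"
    and "quasi_transitive G0"
    and "G1 = fisher G0"
    and "\<bar>gamma_exponent G0\<bar> < \<infinity>"
    and "eta_exists G1"
  shows "(gamma_exponent G0 = gamma_exponent G1 \<and>
          eta_exists G0 \<and> eta_exponent G0 = eta_exponent G1) \<and>
         (\<forall>W0 W1 (g::real) L C10 C20 C11 C21.
            minimal_fundamental_domain G0 W0 \<longrightarrow>
            W1 = fisher_verts G0 W0 \<longrightarrow>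
            gamma_exponent G0 = ereal g \<longrightarrow>
            slowly_varying L \<longrightarrow>
            0 < C10 \<longrightarrow> 0 < C20 \<longrightarrow> 0 < C11 \<longrightarrow> 0 < C21 \<longrightarrow>
            (\<forall>n\<ge>1.
               C10 * L (real n) * real n powr (g - 1) * connective_constant G0 ^ n
                 \<le> real (card (saws_n G0 W0 n)) \<and>
               real (card (saws_n G0 W0 n))
                 \<le> C20 * L (real n) * real n powr (g - 1) * connective_constant G0 ^ n) \<longrightarrow>
            (\<forall>n\<ge>1.
               C11 * L (real n) * real n powr (g - 1) * connective_constant G1 ^ n
                 \<le> real (card (saws_n G1 W1 n)) \<and>
               real (card (saws_n G1 W1 n))
                 \<le> C21 * L (real n) * real n powr (g - 1) * connective_constant G1 ^ n) \<longrightarrow>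
            nu_exponent G0 = nu_exponent G1)"
proof -
  interpret G: qt_cubic_graph G0 by unfold_locales fact+
  interpret F: qt_cubic_graph "fisher G0" by (rule G.qt_cubic_fisher)
  obtain h where h: "is_eta (fisher G0) h" using assms(6,8) by (auto simp: eta_exists_def)
  have h0: "is_eta G0 h" by (rule G.is_eta_fisher[OF h])
  have "gamma_exponent G0 = gamma_exponent G1"
    unfolding gamma_exponent_def assms(6) by (simp only: G.is_gamma_fisher)
  moreover have "eta_exists G0" using h0 by (auto simp: eta_exists_def)
  moreover have "eta_exponent G0 = eta_exponent G1"
    unfolding assms(6) G.eta_exponent_eqI[OF h0] F.eta_exponent_eqI[OF h] ..
  moreover have "nu_exponent G0 = nu_exponent G1"
    if min: "minimal_fundamental_domain G0 W0" and W1: "W1 = fisher_verts G0 W0" and L: "slowly_varying L"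
      and C: "0 < C10" "0 < C20" "0 < C11" "0 < C21"
      and b0: "\<forall>n\<ge>1. C10 * L (real n) * real n powr (g - 1) * connective_constant G0 ^ n
                 \<le> real (card (saws_n G0 W0 n)) \<and>
               real (card (saws_n G0 W0 n))
                 \<le> C20 * L (real n) * real n powr (g - 1) * connective_constant G0 ^ n"
      and b1: "\<forall>n\<ge>1. C11 * L (real n) * real n powr (g - 1) * connective_constant G1 ^ n
                 \<le> real (card (saws_n G1 W1 n)) \<and>
               real (card (saws_n G1 W1 n))
                 \<le> C21 * L (real n) * real n powr (g - 1) * connective_constant G1 ^ n"
    for W0 W1 and g :: real and L C10 C20 C11 C21
  proof -
    have W: "fundamental_domain G0 W0" using min by (simp add: minimal_fundamental_domain_def)
    have "is_nu (fisher G0) = is_nu G0"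
      by (rule G.is_nu_fisher[OF W L C]) (use b0 b1 W1 assms(6) in auto)
    then show ?thesis unfolding nu_exponent_def assms(6) by simp
  qed
  ultimately show ?thesis by blast
qed

end
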